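(* For every $1<p<\infty$ there exists a $p$-disjointly homogeneous reflexive rearrangement invariant space $X_p$ on $[0,1]$ such that its dual space $X_p^*$ is not disjointly homogeneous.
   Context: Rearrangement invariant spaces: Let $m$ be Lebesgue measure on $[0,1]$. A Banach function lattice on $[0,1]$ is a (nonzero) Banach space $X$ of (a.e. equivalence classes of) real-valued measurable functions on $[0,1]$ such that if $f$ is measurable, $|f|\le|g|$ a.e. and $g\in X$, then $f\in X$ and $\|f\|_X\le\|g\|_X$. It is a rearrangement invariant (r.i.) space if, whenever $y\in X$ and $x$ is equimeasurable with $y$ (i.e. $m\{|x|>\tau\}=m\{|y|>\tau\}$ for all $\tau>0$), then $x\in X$ and $\|x\|_X=\|y\|_X$. By convention every r.i. space is assumed to be either separable or maximal, i.e. $X=X''$, where $X'$ is the Köthe dual: all measurable $f$ with $\|f\|_{X'}=\sup_{\|g\|_X\le1}\int|fg|<\infty$. (For separable $X$ the Banach dual $X^*$ coincides with $X'$.) Equivalence: Sequences $\{x_n\}\subset A$, $\{y_n\}\subset B$ in Banach spaces are equivalent if there are $c,C>0$ such that $c\|\sum a_nx_n\|_A\le\|\sum a_ny_n\|_B\le C\|\sum a_nx_n\|_A$ for all finitely supported real sequences $(a_n)$. A Banach lattice $E$ is disjointly homogeneous (DH) if any two normalized disjoint sequences in $E$ contain equivalent subsequences (i.e. the first has a subsequence that is equivalent to some subsequence of the second). For $1\le p\le\infty$, $E$ is $p$-disjointly homogeneous ($p$-DH) if every normalized disjoint sequence in $E$ has a subsequence equivalent to the unit vector basis of $l_p$ ($c_0$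 when $p=\infty$). *)

theory Defs
  imports "HOL-Analysis.Analysis"
begin

text \<open>Banach lattices are given by explicit carriers: a set \<open>vecs\<close> of real-valued
  functions with pointwise vector operations, a seminorm \<open>nrm\<close> and a preorder \<open>leq\<close>. Elements \<open>x\<close>,
  \<open>y\<close> with \<open>nrm (x - y) = 0\<close> represent the same point of the lattice. Thus a function space on
  \<open>[0,1]\<close> consists of representatives of its a.e. classes, and a dual space, which consists of
  functionals, is again a structure of the same kind. The values of \<open>nrm\<close> and \<open>leq\<close> outside
  \<open>vecs\<close> carry no meaning.\<close>

record 'i blat =
  vecs :: "('i \<Rightarrow> real) set"
  nrm  :: "('i \<Rightarrow> real) \<Rightarrow> real"
  leq  :: "('i \<Rightarrow> real) \<Rightarrow> ('i \<Rightarrow> real) \<Rightarrow> bool"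

definition is_modulus :: "'i blat \<Rightarrow> ('i \<Rightarrow> real) \<Rightarrow> ('i \<Rightarrow> real) \<Rightarrow> bool" where
  "is_modulus E x a \<longleftrightarrow> a \<in> vecs E \<and> leq E x a \<and> leq E (\<lambda>i. - x i) a \<and>
     (\<forall>b\<in>vecs E. leq E x b \<and> leq E (\<lambda>i. - x i) b \<longrightarrow> leq E a b)"

definition is_meet :: "'i blat \<Rightarrow> ('i \<Rightarrow> real) \<Rightarrow> ('i \<Rightarrow> real) \<Rightarrow> ('i \<Rightarrow> real) \<Rightarrow> bool" where
  "is_meet E a b c \<longleftrightarrow> c \<in> vecs E \<and> leq E c a \<and> leq E c b \<and>
     (\<forall>d\<in>vecs E. leq E d a \<and> leq E d b \<longrightarrow> leq E d c)"

definition lat_disjoint :: "'i blat \<Rightarrow> ('i \<Rightarrow> real) \<Rightarrow> ('i \<Rightarrow> real) \<Rightarrow> bool" where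
  "lat_disjoint E x y \<longleftrightarrow>
     (\<exists>a b. is_modulus E x a \<and> is_modulus E y b \<and> is_meet E a b (\<lambda>i. 0))"

definition normalized_disjoint_seq :: "'i blat \<Rightarrow> (nat \<Rightarrow> 'i \<Rightarrow> real) \<Rightarrow> bool" where
  "normalized_disjoint_seq E x \<longleftrightarrow> (\<forall>n. x n \<in> vecs E \<and> nrm E (x n) = 1) \<and>
     (\<forall>m n. m \<noteq> n \<longrightarrow> lat_disjoint E (x m) (x n))"

definition lin_comb :: "(nat \<Rightarrow> real) \<Rightarrow> (nat \<Rightarrow> 'i \<Rightarrow> real) \<Rightarrow> 'i \<Rightarrow> real" where
  "lin_comb a x = (\<lambda>i. \<Sum>n | a n \<noteq> 0. a n * x n i)"

definition equivalent_seqs ::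
  "(('i \<Rightarrow> real) \<Rightarrow> real) \<Rightarrow> (nat \<Rightarrow> 'i \<Rightarrow> real) \<Rightarrow>
   (('j \<Rightarrow> real) \<Rightarrow> real) \<Rightarrow> (nat \<Rightarrow> 'j \<Rightarrow> real) \<Rightarrow> bool" where
  "equivalent_seqs NA x NB y \<longleftrightarrow> (\<exists>c>0. \<exists>C>0. \<forall>a. finite {n. a n \<noteq> 0} \<longrightarrow>
     c * NA (lin_comb a x) \<le> NB (lin_comb a y) \<and>
     NB (lin_comb a y) \<le> C * NA (lin_comb a x))"

definition disjointly_homogeneous :: "'i blat \<Rightarrow> bool" where
  "disjointly_homogeneous E \<longleftrightarrow>
     (\<forall>x y. normalized_disjoint_seq E x \<and> normalized_disjoint_seq E y \<longrightarrow>
       (\<exists>r s. strict_mono r \<and> strict_mono s \<and>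
          equivalent_seqs (nrm E) (x \<circ> r) (nrm E) (y \<circ> s)))"

definition lp_norm :: "real \<Rightarrow> (nat \<Rightarrow> real) \<Rightarrow> real" where
  "lp_norm p x = (\<Sum>k. \<bar>x k\<bar> powr p) powr (1 / p)"

definition unit_seq :: "nat \<Rightarrow> nat \<Rightarrow> real" where
  "unit_seq n = (\<lambda>k. if k = n then 1 else 0)"

text \<open>Only meant for finite exponents \<open>p \<ge> 1\<close>.\<close>

definition p_disjointly_homogeneous :: "real \<Rightarrow> 'i blat \<Rightarrow> bool" where
  "p_disjointly_homogeneous p E \<longleftrightarrow>
     (\<forall>x. normalized_disjoint_seq E x \<longrightarrow>
       (\<exists>r. strict_mono r \<and> equivalent_seqs (nrm E) (x \<circ> r) (lp_norm p) unit_seq))"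

text \<open>The Banach dual with its usual lattice order. Functionals on \<open>vecs E\<close> are extended by \<open>0\<close>
  to the whole type, which keeps the space closed under pointwise operations. Boundedness forces
  a functional to agree on representatives of the same point.\<close>

definition banach_dual :: "'i blat \<Rightarrow> ('i \<Rightarrow> real) blat" where
  "banach_dual E = \<lparr>
     vecs = {\<phi>. (\<forall>f. f \<notin> vecs E \<longrightarrow> \<phi> f = 0) \<and>
                (\<forall>f\<in>vecs E. \<forall>g\<in>vecs E. \<phi> (\<lambda>i. f i + g i) = \<phi> f + \<phi> g) \<and>
                (\<forall>f\<in>vecs E. \<forall>c. \<phi> (\<lambda>i. c * f i) = c * \<phi> f) \<and>
                (\<exists>C. \<forall>f\<in>vecs E. \<bar>\<phi> f\<bar> \<le> C * nrm E f)},
     nrm = (\<lambda>\<phi>. SUP f\<in>{f \<in> vecs E. nrm E f \<le> 1}. \<bar>\<phi> f\<bar>),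
     leq = (\<lambda>\<phi> \<psi>. \<forall>f\<in>vecs E. leq E (\<lambda>i. 0) f \<longrightarrow> \<phi> f \<le> \<psi> f) \<rparr>"

text \<open>Surjectivity of the canonical embedding into the bidual.\<close>

definition reflexive_space :: "'i blat \<Rightarrow> bool" where
  "reflexive_space E \<longleftrightarrow>
     (\<forall>\<Psi>\<in>vecs (banach_dual (banach_dual E)).
        \<exists>f\<in>vecs E. \<forall>\<phi>\<in>vecs (banach_dual E). \<Psi> \<phi> = \<phi> f)"

abbreviation leb01 :: "real measure" where
  "leb01 \<equiv> lebesgue_on {0..1}"

definition banach_function_lattice :: "real blat \<Rightarrow> bool" where
  "banach_function_lattice E \<longleftrightarrow>
     vecs E \<subseteq> borel_measurable leb01 \<and>
     (\<forall>f\<in>vecs E. \<forall>g\<in>vecs E. leq E f g \<longleftrightarrow> (AE t in leb01. f t \<le> g t)) \<and>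
     (\<forall>f\<in>vecs E. \<forall>g\<in>vecs E. (\<lambda>t. f t + g t) \<in> vecs E \<and>
        nrm E (\<lambda>t. f t + g t) \<le> nrm E f + nrm E g) \<and>
     (\<forall>f\<in>vecs E. \<forall>c. (\<lambda>t. c * f t) \<in> vecs E \<and> nrm E (\<lambda>t. c * f t) = \<bar>c\<bar> * nrm E f) \<and>
     (\<forall>f\<in>vecs E. 0 \<le> nrm E f \<and> (nrm E f = 0 \<longleftrightarrow> (AE t in leb01. f t = 0))) \<and>
     (\<exists>f\<in>vecs E. nrm E f \<noteq> 0) \<and>
     (\<forall>x :: nat \<Rightarrow> real \<Rightarrow> real. (\<forall>n. x n \<in> vecs E) \<and>
        (\<forall>e>0. \<exists>M. \<forall>m\<ge>M. \<forall>n\<ge>M. nrm E (\<lambda>t. x m t - x n t) < e) \<longrightarrow>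
        (\<exists>f\<in>vecs E. (\<lambda>n. nrm E (\<lambda>t. x n t - f t)) \<longlonglongrightarrow> 0)) \<and>
     (\<forall>g\<in>vecs E. \<forall>f\<in>borel_measurable leb01. (AE t in leb01. \<bar>f t\<bar> \<le> \<bar>g t\<bar>) \<longrightarrow>
        f \<in> vecs E \<and> nrm E f \<le> nrm E g)"

definition equimeasurable :: "(real \<Rightarrow> real) \<Rightarrow> (real \<Rightarrow> real) \<Rightarrow> bool" where
  "equimeasurable x y \<longleftrightarrow>
     (\<forall>\<tau>>0. measure leb01 {t\<in>{0..1}. \<tau> < \<bar>x t\<bar>} = measure leb01 {t\<in>{0..1}. \<tau> < \<bar>y t\<bar>})"

definition separable_space :: "'i blat \<Rightarrow> bool" where
  "separable_space E \<longleftrightarrow> (\<exists>D\<subseteq>vecs E. countable D \<and>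
     (\<forall>f\<in>vecs E. \<forall>e>0. \<exists>d\<in>D. nrm E (\<lambda>i. f i - d i) < e))"

definition kothe_norm :: "real blat \<Rightarrow> (real \<Rightarrow> real) \<Rightarrow> ennreal" where
  "kothe_norm E f =
     (SUP g\<in>{g \<in> vecs E. nrm E g \<le> 1}. \<integral>\<^sup>+ t. ennreal \<bar>f t * g t\<bar> \<partial>leb01)"

definition kothe_dual :: "real blat \<Rightarrow> real blat" where
  "kothe_dual E = \<lparr>
     vecs = {f \<in> borel_measurable leb01. kothe_norm E f < \<infinity>},
     nrm = (\<lambda>f. enn2real (kothe_norm E f)),
     leq = (\<lambda>f g. AE t in leb01. f t \<le> g t) \<rparr>"

definition maximal_space :: "real blat \<Rightarrow> bool" where
  "maximal_space E \<longleftrightarrow> vecs E = vecs (kothe_dual (kothe_dual E)) \<and>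
     (\<forall>f\<in>vecs E. nrm E f = nrm (kothe_dual (kothe_dual E)) f)"

definition ri_space :: "real blat \<Rightarrow> bool" where
  "ri_space E \<longleftrightarrow> banach_function_lattice E \<and>
     (\<forall>y\<in>vecs E. \<forall>x\<in>borel_measurable leb01. equimeasurable x y \<longrightarrow>
        x \<in> vecs E \<and> nrm E x = nrm E y) \<and>
     (separable_space E \<or> maximal_space E)"

lemma lat_disjoint_function_lattice:
  assumes E: "banach_function_lattice E" and f: "f \<in> vecs E" and g: "g \<in> vecs E"
  shows "lat_disjoint E f g \<longleftrightarrow> (AE t in leb01. f t = 0 \<or> g t = 0)"
proof -
  have meas: "\<And>h. h \<in> vecs E \<Longrightarrow> h \<in> borel_measurable leb01"
    and le: "\<And>h k. h \<in> vecs E \<Longrightarrow> k \<in> vecs E \<Longrightarrow> leq E h k \<longleftrightarrow> (AE t in leb01. h t \<le> k t)"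
    and scale: "\<And>h c. h \<in> vecs E \<Longrightarrow> (\<lambda>t. c * h t) \<in> vecs E"
    and ideal: "\<And>h k. h \<in> vecs E \<Longrightarrow> k \<in> borel_measurable leb01 \<Longrightarrow>
          (AE t in leb01. \<bar>k t\<bar> \<le> \<bar>h t\<bar>) \<Longrightarrow> k \<in> vecs E"
    using E unfolding banach_function_lattice_def by blast+
  have neg: "\<And>h. h \<in> vecs E \<Longrightarrow> (\<lambda>t. - h t) \<in> vecs E" using scale[of _ "-1"] by simp
  have abs: "(\<lambda>t. \<bar>h t\<bar>) \<in> vecs E" if "h \<in> vecs E" for h
    by (rule ideal[OF that]) (use meas[OF that] in auto)
  have zero: "(\<lambda>t. 0) \<in> vecs E" using scale[OF f, of 0] by simp
  have modulus: "is_modulus E h a \<longleftrightarrow> a \<in> vecs E \<and> (AE t in leb01. a t = \<bar>h t\<bar>)"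
    if h: "h \<in> vecs E" for h a
  proof
    assume m: "is_modulus E h a"
    then have a: "a \<in> vecs E" by (simp add: is_modulus_def)
    have "AE t in leb01. h t \<le> a t" "AE t in leb01. - h t \<le> a t"
      using m le[OF h a] le[OF neg[OF h] a] by (auto simp: is_modulus_def)
    moreover have "leq E a (\<lambda>t. \<bar>h t\<bar>)"
      using m abs[OF h] le[OF h abs[OF h]] le[OF neg[OF h] abs[OF h]]
      by (auto simp: is_modulus_def)
    then have "AE t in leb01. a t \<le> \<bar>h t\<bar>" using le[OF a abs[OF h]] by simp
    ultimately have "AE t in leb01. a t = \<bar>h t\<bar>" by eventually_elim linarith
    with a show "a \<in> vecs E \<and> (AE t in leb01. a t = \<bar>h t\<bar>)" by simp
  next
    assume asm: "a \<in> vecs E \<and> (AE t in leb01. a t = \<bar>h t\<bar>)"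
    then have a: "a \<in> vecs E" and ae: "AE t in leb01. a t = \<bar>h t\<bar>" by auto
    have "AE t in leb01. h t \<le> a t" "AE t in leb01. - h t \<le> a t"
      using ae by (eventually_elim, simp)+
    moreover have "AE t in leb01. a t \<le> b t"
      if "AE t in leb01. h t \<le> b t" "AE t in leb01. - h t \<le> b t" for b
      using that ae by eventually_elim linarith
    ultimately show "is_modulus E h a"
      unfolding is_modulus_def using a le h neg by auto
  qed
  show ?thesis
  proof
    assume "lat_disjoint E f g"
    then obtain a b where a: "a \<in> vecs E" "AE t in leb01. a t = \<bar>f t\<bar>"
      and b: "b \<in> vecs E" "AE t in leb01. b t = \<bar>g t\<bar>" and m: "is_meet E a b (\<lambda>t. 0)"
      unfolding lat_disjoint_def using modulus f g by blast
    let ?d = "\<lambda>t. min \<bar>f t\<bar> \<bar>g t\<bar>"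
    have d: "?d \<in> vecs E"
      by (rule ideal[OF f]) (use meas[OF f] meas[OF g] in auto)
    have "AE t in leb01. ?d t \<le> a t" using a(2) by eventually_elim simp
    moreover have "AE t in leb01. ?d t \<le> b t" using b(2) by eventually_elim simp
    ultimately have "leq E ?d (\<lambda>t. 0)"
      using m d le[OF d a(1)] le[OF d b(1)] by (auto simp: is_meet_def)
    then have "AE t in leb01. ?d t \<le> 0" using le[OF d zero] by simp
    then show "AE t in leb01. f t = 0 \<or> g t = 0" by eventually_elim (auto simp: min_def split: if_splits)
  next
    assume ae: "AE t in leb01. f t = 0 \<or> g t = 0"
    have "AE t in leb01. d t \<le> 0"
      if "AE t in leb01. d t \<le> \<bar>f t\<bar>" "AE t in leb01. d t \<le> \<bar>g t\<bar>" for d :: "real \<Rightarrow> real"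
      using that ae by eventually_elim auto
    then have "is_meet E (\<lambda>t. \<bar>f t\<bar>) (\<lambda>t. \<bar>g t\<bar>) (\<lambda>t. 0)"
      unfolding is_meet_def using zero le abs f g by auto
    then show "lat_disjoint E f g"
      unfolding lat_disjoint_def using modulus f g abs by blast
  qed
qed

end

theory Submission
  imports Defs
begin

text \<open>The space is a \<open>p\<close>-convexification: \<open>f\<close> belongs to it when \<open>\<bar>f\<bar> powr p\<close> has finite norm \<open>mixed_norm\<close>,
  and \<open>mixed_norm u = (\<Sum>n. max (SUP k. \<rho> (n,k) u) (eps n * (\<Sum>k. \<rho> (n,k) u)))\<close>. Here every \<open>\<rho> (n,k)\<close> is a
  multiple of a K-functional of the couple \<open>(L\<^sub>1, L\<^sub>\<infinity>)\<close>, so it is subadditive and depends on the distribution of \<open>u\<close>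
  only. The parameters of the \<open>\<rho> (n,k)\<close> are so lacunary that functions
  living at scale \<open>(n,k)\<close> behave like unit vectors of the sequence lattice in which \<open>\<rho>\<close> is measured,
  an \<open>l\<^sub>1\<close>-sum of rows. On the row \<open>n\<close> the norm is the maximum of the \<open>l\<^sub>\<infinity>\<close> norm and \<open>eps n\<close> times the
  \<open>l\<^sub>1\<close> norm; it is equivalent to the \<open>l\<^sub>1\<close> norm, but with a constant that gets worse as \<open>n\<close> grows.

  Why the space is \<open>p\<close>-disjointly homogeneous. For disjoint \<open>f\<^sub>k\<close> the function \<open>\<bar>\<Sum>a\<^sub>k f\<^sub>k\<bar> powr p\<close> is
  \<open>\<Sum>\<bar>a\<^sub>k\<bar> powr p * \<bar>f\<^sub>k\<bar> powr p\<close>, so the upper \<open>l\<^sub>p\<close> estimate is subadditivity. For the lower one a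
  subsequence suffices, and its constant may depend on the sequence. Either the \<open>L\<^sub>1\<close> norms of the
  \<open>\<bar>f\<^sub>k\<bar> powr p\<close> do not tend to zero, or
  they do and the \<open>\<rho>\<close>-coordinates tend to zero one by one. In the latter case a gliding hump
  works inside one row if some row sum does not tend to zero, and across the rows
  otherwise (\<open>mixed_norm_lower_estimate\<close>).

  Why the dual is not disjointly homogeneous. The bad constants of the rows cannot be avoided by a
  functional that acts on all rows at once. Adding \<open>m\<close> of the functionals
  \<open>\<Sum>n. (1/2)^n * coord (n,k)\<close>, with \<open>m * eps n = 1\<close>, and testing on a sum of \<open>m\<close> unit functions in row
  \<open>n\<close>, whose norm is bounded, gives a norm of order at least \<open>m / 2^n\<close>. This beats \<open>m powr (1 - 1/p)\<close>
  because \<open>eps n\<close> decays like \<open>4 powr (- n\<^sup>2)\<close>. The functionals \<open>coord (0,k)\<close>, on the other hand, satisfy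
  an upper \<open>m powr (1 - 1/p)\<close> estimate, so no two subsequences are equivalent.

  Reflexivity comes from order continuity of the space and of its Koethe dual. Order continuity
  makes every bounded functional an integral against a function (\<open>dual_representation\<close>, through the
  Radon--Nikodym theorem). Applying this twice identifies the bidual with the second Koethe dual, and
  the latter is the space itself, as \<open>mixed_norm\<close> is a supremum of integrals (\<open>maximal_mixed_space\<close>).\<close>

section \<open>Suprema of integrals\<close>

text \<open>A functional of this form is monotone, homogeneous, subadditive and lower semicontinuous (Fatou),
  and the form survives countable sums, suprema and scaling. Hence these properties need not be checked
  separately for \<open>mixed_norm\<close>, and the representing set itself yields the maximality of the space.\<close>

definition sup_of_integrals :: "'a measure \<Rightarrow> (('a \<Rightarrow> ennreal) \<Rightarrow> ennreal) \<Rightarrow> bool" where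
  "sup_of_integrals M F \<longleftrightarrow> (\<exists>V. V \<noteq> {} \<and> V \<subseteq> borel_measurable M \<and>
     (\<forall>u\<in>borel_measurable M. F u = (SUP v\<in>V. \<integral>\<^sup>+t. u t * v t \<partial>M)))"

lemma sup_of_integralsI:
  assumes "V \<noteq> {}" "V \<subseteq> borel_measurable M"
    and "\<And>u. u \<in> borel_measurable M \<Longrightarrow> F u = (SUP v\<in>V. \<integral>\<^sup>+t. u t * v t \<partial>M)"
  shows "sup_of_integrals M F"
  using assms unfolding sup_of_integrals_def by blast

lemma sup_of_integralsE:
  assumes "sup_of_integrals M F"
  obtains V where "V \<noteq> {}" "V \<subseteq> borel_measurable M"
    "\<And>u. u \<in> borel_measurable M \<Longrightarrow> F u = (SUP v\<in>V. \<integral>\<^sup>+t. u t * v t \<partial>M)"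
  using assms unfolding sup_of_integrals_def by blast

text \<open>Along sequences of choices that approach all suprema monotonically, monotone convergence
  exchanges the sum with the supremum.\<close>

lemma suminf_SUP_choice:
  fixes F :: "nat \<Rightarrow> 'b \<Rightarrow> ennreal"
  assumes "\<And>i. V i \<noteq> {}"
  shows "(\<Sum>i. SUP v\<in>V i. F i v) = (SUP s\<in>Pi UNIV V. \<Sum>i. F i (s i))"
proof (rule antisym)
  have "\<exists>f. incseq f \<and> range f \<subseteq> F i ` V i \<and> (SUP v\<in>V i. F i v) = (SUP n. f n)" for i
    using ennreal_Sup_countable_SUP[of "F i ` V i"] assms by auto
  then obtain f where f: "\<And>i. incseq (f i)" "\<And>i. range (f i) \<subseteq> F i ` V i"
    "\<And>i. (SUP v\<in>V i. F i v) = (SUP n. f i n)" by metis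
  have "\<forall>i n. \<exists>v\<in>V i. f i n = F i v" using f(2) by blast
  then obtain s where s: "\<And>i n. s i n \<in> V i" "\<And>i n. f i n = F i (s i n)" by metis
  have "(\<Sum>i. SUP v\<in>V i. F i v) = (\<Sum>i. SUP n. f i n)" using f(3) by simp
  also have "\<dots> = (SUP n. \<Sum>i. f i n)"
    using f(1) by (intro ennreal_suminf_SUP_eq) auto
  also have "\<dots> \<le> (SUP s\<in>Pi UNIV V. \<Sum>i. F i (s i))"
    by (rule SUP_least) (use s in \<open>auto intro!: SUP_upper2[where i="\<lambda>i. s i _"]\<close>)
  finally show "(\<Sum>i. SUP v\<in>V i. F i v) \<le> (SUP s\<in>Pi UNIV V. \<Sum>i. F i (s i))" .
  show "(SUP s\<in>Pi UNIV V. \<Sum>i. F i (s i)) \<le> (\<Sum>i. SUP v\<in>V i. F i v)"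
    by (intro SUP_least suminf_le SUP_upper) auto
qed

lemma sup_of_integrals_suminf:
  fixes M :: "'a measure"
  assumes "\<And>i::nat. sup_of_integrals M (F i)"
  shows "sup_of_integrals M (\<lambda>u. \<Sum>i. F i u)"
proof -
  have "\<forall>i. \<exists>V. V \<noteq> {} \<and> V \<subseteq> borel_measurable M \<and>
     (\<forall>u\<in>borel_measurable M. F i u = (SUP v\<in>V. \<integral>\<^sup>+t. u t * v t \<partial>M))"
    using assms unfolding sup_of_integrals_def by blast
  then obtain V where V: "\<And>i. V i \<noteq> {}" "\<And>i. V i \<subseteq> borel_measurable M"
    "\<And>i u. u \<in> borel_measurable M \<Longrightarrow> F i u = (SUP v\<in>V i. \<integral>\<^sup>+t. u t * v t \<partial>M)"
    by metis
  have ne: "Pi UNIV V \<noteq> {}" using V(1) by (auto simp: Pi_eq_empty)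
  have m: "s i \<in> borel_measurable M" if "s \<in> Pi UNIV V" for s i
    using that V(2)[of i] by auto
  show ?thesis
  proof (rule sup_of_integralsI[where V="(\<lambda>s t. \<Sum>i. s i t) ` Pi UNIV V"])
    show "(\<lambda>s t. \<Sum>i. s i t) ` Pi UNIV V \<noteq> {}" using ne by simp
    show "(\<lambda>s t. \<Sum>i. s i t) ` Pi UNIV V \<subseteq> borel_measurable M"
      using m by auto
    fix u :: "'a \<Rightarrow> ennreal" assume u: "u \<in> borel_measurable M"
    have "(\<Sum>i. F i u) = (SUP s\<in>Pi UNIV V. \<Sum>i. \<integral>\<^sup>+t. u t * s i t \<partial>M)"
      unfolding V(3)[OF u] by (rule suminf_SUP_choice[OF V(1)])
    also have "\<dots> = (SUP s\<in>Pi UNIV V. \<integral>\<^sup>+t. u t * (\<Sum>i. s i t) \<partial>M)"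
    proof (rule SUP_cong[OF refl])
      fix s assume "s \<in> Pi UNIV V"
      then show "(\<Sum>i. \<integral>\<^sup>+t. u t * s i t \<partial>M) = (\<integral>\<^sup>+t. u t * (\<Sum>i. s i t) \<partial>M)"
        using m[of s] u by (subst nn_integral_suminf[symmetric]) (auto simp: ennreal_suminf_cmult)
    qed
    finally show "(\<Sum>i. F i u) = (SUP v\<in>(\<lambda>s t. \<Sum>i. s i t) ` Pi UNIV V. \<integral>\<^sup>+t. u t * v t \<partial>M)"
      by (simp add: image_image)
  qed
qed

lemma sup_of_integrals_SUP:
  fixes M :: "'a measure"
  assumes "\<And>i. i \<in> I \<Longrightarrow> sup_of_integrals M (F i)" "I \<noteq> {}"
  shows "sup_of_integrals M (\<lambda>u. SUP i\<in>I. F i u)"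
proof -
  have "\<forall>i\<in>I. \<exists>V. V \<noteq> {} \<and> V \<subseteq> borel_measurable M \<and>
     (\<forall>u\<in>borel_measurable M. F i u = (SUP v\<in>V. \<integral>\<^sup>+t. u t * v t \<partial>M))"
    using assms unfolding sup_of_integrals_def by blast
  then obtain V where V: "\<And>i. i \<in> I \<Longrightarrow> V i \<noteq> {}" "\<And>i. i \<in> I \<Longrightarrow> V i \<subseteq> borel_measurable M"
    "\<And>i u. i \<in> I \<Longrightarrow> u \<in> borel_measurable M \<Longrightarrow> F i u = (SUP v\<in>V i. \<integral>\<^sup>+t. u t * v t \<partial>M)"
    by metis
  show ?thesis
  proof (rule sup_of_integralsI[where V="\<Union>i\<in>I. V i"])
    show "(\<Union>i\<in>I. V i) \<noteq> {}" using V(1) assms(2) by auto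
    show "(\<Union>i\<in>I. V i) \<subseteq> borel_measurable M" using V(2) by auto
    fix u :: "'a \<Rightarrow> ennreal" assume u: "u \<in> borel_measurable M"
    show "(SUP i\<in>I. F i u) = (SUP v\<in>(\<Union>i\<in>I. V i). \<integral>\<^sup>+t. u t * v t \<partial>M)"
      using V(3)[OF _ u] by (simp add: SUP_UNION)
  qed
qed

lemma sup_of_integrals_max:
  assumes "sup_of_integrals M F" "sup_of_integrals M G"
  shows "sup_of_integrals M (\<lambda>u. max (F u) (G u))"
proof -
  have "sup_of_integrals M (\<lambda>u. SUP b\<in>(UNIV::bool set). if b then F u else G u)"
  proof (rule sup_of_integrals_SUP)
    fix b :: bool
    show "sup_of_integrals M (\<lambda>u. if b then F u else G u)" using assms by (cases b) auto
  qed simp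
  then show ?thesis by (simp add: UNIV_bool sup_max max.commute)
qed

lemma sup_of_integrals_cmult:
  assumes "sup_of_integrals M F"
  shows "sup_of_integrals M (\<lambda>u. c * F u)"
proof -
  obtain V where V: "V \<noteq> {}" "V \<subseteq> borel_measurable M"
    "\<And>u. u \<in> borel_measurable M \<Longrightarrow> F u = (SUP v\<in>V. \<integral>\<^sup>+t. u t * v t \<partial>M)"
    by (rule sup_of_integralsE[OF assms]) blast
  show ?thesis
  proof (rule sup_of_integralsI[where V="(\<lambda>v t. c * v t) ` V"])
    show "(\<lambda>v t. c * v t) ` V \<noteq> {}" using V(1) by simp
    show "(\<lambda>v t. c * v t) ` V \<subseteq> borel_measurable M" using V(2) by auto
    fix u :: "'a \<Rightarrow> ennreal" assume u: "u \<in> borel_measurable M"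
    have "(SUP v\<in>V. \<integral>\<^sup>+t. u t * (c * v t) \<partial>M) = (SUP v\<in>V. c * (\<integral>\<^sup>+t. u t * v t \<partial>M))"
    proof (rule SUP_cong[OF refl])
      fix v assume "v \<in> V"
      then show "(\<integral>\<^sup>+t. u t * (c * v t) \<partial>M) = c * (\<integral>\<^sup>+t. u t * v t \<partial>M)"
        using V(2) u by (subst nn_integral_cmult[symmetric]) (auto simp: mult_ac)
    qed
    then show "c * F u = (SUP v\<in>(\<lambda>v t. c * v t) ` V. \<integral>\<^sup>+t. u t * v t \<partial>M)"
      using V(1) by (simp add: V(3)[OF u] image_image SUP_mult_left_ennreal)
  qed
qed

lemma sup_of_integrals_mono:
  assumes "sup_of_integrals M F" "u \<in> borel_measurable M" "u' \<in> borel_measurable M"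
    and "AE t in M. u t \<le> u' t"
  shows "F u \<le> F u'"
proof -
  obtain V where V: "V \<noteq> {}" "V \<subseteq> borel_measurable M"
    "\<And>u. u \<in> borel_measurable M \<Longrightarrow> F u = (SUP v\<in>V. \<integral>\<^sup>+t. u t * v t \<partial>M)"
    by (rule sup_of_integralsE[OF assms(1)]) blast
  show ?thesis unfolding V(3)[OF assms(2)] V(3)[OF assms(3)]
    by (intro SUP_mono' nn_integral_mono_AE)
       (use assms(4) in \<open>auto elim!: eventually_mono intro: mult_right_mono\<close>)
qed

lemma sup_of_integrals_cong_AE:
  assumes "sup_of_integrals M F" "u \<in> borel_measurable M" "u' \<in> borel_measurable M"
    and "AE t in M. u t = u' t"
  shows "F u = F u'"
  by (rule antisym; rule sup_of_integrals_mono[OF assms(1)])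
     (use assms in \<open>auto elim: eventually_mono\<close>)

lemma sup_of_integrals_scale:
  assumes "sup_of_integrals M F" "u \<in> borel_measurable M"
  shows "F (\<lambda>t. c * u t) = c * F u"
proof -
  obtain V where V: "V \<noteq> {}" "V \<subseteq> borel_measurable M"
    "\<And>u. u \<in> borel_measurable M \<Longrightarrow> F u = (SUP v\<in>V. \<integral>\<^sup>+t. u t * v t \<partial>M)"
    by (rule sup_of_integralsE[OF assms(1)]) blast
  have "F (\<lambda>t. c * u t) = (SUP v\<in>V. \<integral>\<^sup>+t. c * u t * v t \<partial>M)"
    using V(3) assms(2) by simp
  also have "\<dots> = (SUP v\<in>V. c * (\<integral>\<^sup>+t. u t * v t \<partial>M))"
    using V(2) assms(2)
    by (intro SUP_cong refl) (subst nn_integral_cmult[symmetric], auto simp: mult_ac)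
  finally show ?thesis using V(1) assms(2) by (simp add: V(3) SUP_mult_left_ennreal)
qed

lemma sup_of_integrals_add:
  assumes "sup_of_integrals M F" "u \<in> borel_measurable M" "u' \<in> borel_measurable M"
  shows "F (\<lambda>t. u t + u' t) \<le> F u + F u'"
proof -
  obtain V where V: "V \<noteq> {}" "V \<subseteq> borel_measurable M"
    "\<And>u. u \<in> borel_measurable M \<Longrightarrow> F u = (SUP v\<in>V. \<integral>\<^sup>+t. u t * v t \<partial>M)"
    by (rule sup_of_integralsE[OF assms(1)]) blast
  have "(\<integral>\<^sup>+t. (u t + u' t) * v t \<partial>M) \<le> F u + F u'" if "v \<in> V" for v
  proof -
    have "(\<integral>\<^sup>+t. (u t + u' t) * v t \<partial>M) = (\<integral>\<^sup>+t. u t * v t \<partial>M) + (\<integral>\<^sup>+t. u' t * v t \<partial>M)"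
      using assms V(2) that by (subst nn_integral_add[symmetric]) (auto simp: distrib_right)
    also have "\<dots> \<le> F u + F u'"
      unfolding V(3)[OF assms(2)] V(3)[OF assms(3)] using that
      by (intro add_mono SUP_upper)
    finally show ?thesis .
  qed
  moreover have "F (\<lambda>t. u t + u' t) = (SUP v\<in>V. \<integral>\<^sup>+t. (u t + u' t) * v t \<partial>M)"
    using assms by (intro V(3)) auto
  ultimately show ?thesis by (auto intro: SUP_least)
qed

lemma sup_of_integrals_sum:
  assumes "sup_of_integrals M F" "finite K" "\<And>k. k \<in> K \<Longrightarrow> u k \<in> borel_measurable M"
  shows "F (\<lambda>t. \<Sum>k\<in>K. u k t) \<le> (\<Sum>k\<in>K. F (u k))"
  using assms(2,3)
proof (induction K rule: finite_induct)
  case empty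
  show ?case using sup_of_integrals_scale[OF assms(1), of "\<lambda>_. 0" 0] by simp
next
  case (insert k K)
  have "F (\<lambda>t. u k t + (\<Sum>k\<in>K. u k t)) \<le> F (u k) + F (\<lambda>t. \<Sum>k\<in>K. u k t)"
    using insert by (intro sup_of_integrals_add[OF assms(1)]) auto
  also have "\<dots> \<le> F (u k) + (\<Sum>k\<in>K. F (u k))"
    using insert by (intro add_left_mono) auto
  finally show ?case using insert by simp
qed

lemma sup_of_integrals_Fatou:
  assumes "sup_of_integrals M F" "\<And>n. u n \<in> borel_measurable M"
  shows "F (\<lambda>t. liminf (\<lambda>n. u n t)) \<le> liminf (\<lambda>n. F (u n))"
proof -
  obtain V where V: "V \<noteq> {}" "V \<subseteq> borel_measurable M"
    "\<And>u. u \<in> borel_measurable M \<Longrightarrow> F u = (SUP v\<in>V. \<integral>\<^sup>+t. u t * v t \<partial>M)"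
    by (rule sup_of_integralsE[OF assms(1)]) blast
  have "(\<integral>\<^sup>+t. liminf (\<lambda>n. u n t) * v t \<partial>M) \<le> liminf (\<lambda>n. F (u n))" if "v \<in> V" for v
  proof -
    have "liminf (\<lambda>n. u n t) * v t \<le> liminf (\<lambda>n. u n t * v t)" for t
    proof -
      have "(INF m\<in>{n..}. u m t) * v t \<le> (INF m\<in>{n..}. u m t * v t)" for n
        by (intro INF_greatest mult_right_mono INF_lower) auto
      then have "(SUP n. (INF m\<in>{n..}. u m t) * v t) \<le> (SUP n. INF m\<in>{n..}. u m t * v t)"
        by (intro SUP_mono) auto
      then show ?thesis unfolding liminf_SUP_INF by (simp add: SUP_mult_right_ennreal)
    qed
    then have "(\<integral>\<^sup>+t. liminf (\<lambda>n. u n t) * v t \<partial>M) \<le> (\<integral>\<^sup>+t. liminf (\<lambda>n. u n t * v t) \<partial>M)"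
      by (rule nn_integral_mono)
    also have "\<dots> \<le> liminf (\<lambda>n. \<integral>\<^sup>+t. u n t * v t \<partial>M)"
      using assms(2) V(2) that by (intro nn_integral_liminf) auto
    also have "\<dots> \<le> liminf (\<lambda>n. F (u n))"
      using assms(2) that by (intro Liminf_mono always_eventually allI) (auto simp: V(3) intro: SUP_upper)
    finally show ?thesis .
  qed
  moreover have "F (\<lambda>t. liminf (\<lambda>n. u n t)) = (SUP v\<in>V. \<integral>\<^sup>+t. liminf (\<lambda>n. u n t) * v t \<partial>M)"
    using assms by (intro V(3)) auto
  ultimately show ?thesis by (auto intro: SUP_least)
qed

section \<open>The rearrangement invariant norm\<close>

lemma space_leb01 [simp]: "space leb01 = {0..1}"
  by (simp add: space_restrict_space)

lemma emeasure_leb01_space: "emeasure leb01 {0..1} = 1"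
  by (simp add: emeasure_restrict_space)

lemma finite_measure_leb01: "finite_measure leb01"
  by (rule finite_measureI) (simp add: emeasure_leb01_space)

lemma suminf_dominated_tendsto_0:
  fixes a :: "nat \<Rightarrow> nat \<Rightarrow> ennreal"
  assumes "\<And>i k. a i k \<le> b k" "(\<Sum>k. b k) < \<infinity>" "\<And>k. (\<lambda>i. a i k) \<longlonglongrightarrow> 0"
  shows "(\<lambda>i. \<Sum>k. a i k) \<longlonglongrightarrow> 0"
proof -
  have "(\<lambda>i. \<integral>\<^sup>+k. a i k \<partial>count_space UNIV) \<longlonglongrightarrow> (\<integral>\<^sup>+k. 0 \<partial>count_space (UNIV::nat set))"
    by (rule nn_integral_dominated_convergence[where w=b])
       (use assms in \<open>auto simp: nn_integral_count_space_nat\<close>)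
  then show ?thesis by (simp add: nn_integral_count_space_nat)
qed

lemma suminf_half_powers:
  assumes "0 \<le> c"
  shows "(\<Sum>k. ennreal (c * (1/2)^k)) = ennreal (2 * c)"
proof -
  have "(\<lambda>k. c * (1/2)^k) sums (c * 2)"
    using geometric_sums[of "1/2::real"] by (intro sums_mult) simp
  then show ?thesis using assms by (intro suminf_ennreal_eq) (auto simp: mult.commute)
qed

text \<open>The growth \<open>wt i / wt j \<le> (1/2)^(i + j)\<close> for \<open>i < j\<close>, which a quadratic exponent provides, bounds
  the matrix of the values of \<open>rho i\<close> on the unit functions below by a summable perturbation of the identity.\<close>

definition wt :: "nat \<Rightarrow> real" where
  "wt i = 2 ^ ((i+1)^2)"

text \<open>The supremum \<open>rho i\<close> over these weights is \<open>wt i\<close> times the K-functional \<open>K (1/(wt i)\<^sup>2, u; L\<^sub>1, L\<^sub>\<infinity>)\<close>, that is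
  \<open>wt i\<close> times the integral of the decreasing rearrangement over an interval of length \<open>1/(wt i)\<^sup>2\<close>.\<close>

definition weights :: "nat \<Rightarrow> (real \<Rightarrow> ennreal) set" where
  "weights i = {v \<in> borel_measurable leb01. (\<forall>t. v t \<le> ennreal (wt i)) \<and>
      (\<integral>\<^sup>+t. v t \<partial>leb01) \<le> ennreal (1 / wt i)}"

definition rho :: "nat \<Rightarrow> (real \<Rightarrow> ennreal) \<Rightarrow> ennreal" where
  "rho i u = (SUP v\<in>weights i. \<integral>\<^sup>+t. u t * v t \<partial>leb01)"

definition eps :: "nat \<Rightarrow> real" where
  "eps n = (1/4) ^ (n^2)"

text \<open>The index \<open>i\<close> of \<open>rho\<close> runs through pairs (row, position), coded by \<open>prod_encode\<close>.\<close>

definition row_sum :: "nat \<Rightarrow> (real \<Rightarrow> ennreal) \<Rightarrow> ennreal" where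
  "row_sum n u = (\<Sum>k. rho (prod_encode (n, k)) u)"

definition row_norm :: "nat \<Rightarrow> (real \<Rightarrow> ennreal) \<Rightarrow> ennreal" where
  "row_norm n u = max (SUP k. rho (prod_encode (n, k)) u) (ennreal (eps n) * row_sum n u)"

definition mixed_norm :: "(real \<Rightarrow> ennreal) \<Rightarrow> ennreal" where
  "mixed_norm u = (\<Sum>n. row_norm n u)"

lemma wt_pos [simp]: "0 < wt i" by (simp add: wt_def)

lemma wt_nonzero [simp]: "wt i \<noteq> 0" by (simp add: wt_def)

lemma wt_nonneg [simp]: "0 \<le> wt i" by (simp add: wt_def)

lemma wt_ge_power: "2 ^ i \<le> wt i"
  unfolding wt_def by (rule power_increasing) (auto simp: power2_eq_square)

lemma wt_ge_1: "1 \<le> wt i"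
  by (simp add: wt_def)

lemma eps_pos [simp]: "0 < eps n" by (simp add: eps_def)

lemma eps_nonneg [simp]: "0 \<le> eps n" by (simp add: eps_def)

lemma eps_le_1: "eps n \<le> 1" by (simp add: eps_def power_le_one)

lemma zero_in_weights: "(\<lambda>_. 0) \<in> weights i"
  by (simp add: weights_def)

lemma weights_measurable: "v \<in> weights i \<Longrightarrow> v \<in> borel_measurable leb01"
  by (simp add: weights_def)

lemma sup_of_integrals_rho: "sup_of_integrals leb01 (rho i)"
  by (rule sup_of_integralsI[where V="weights i"])
     (use zero_in_weights[of i] weights_measurable in \<open>auto simp: rho_def\<close>)

lemma sup_of_integrals_row_sum: "sup_of_integrals leb01 (row_sum n)"
  unfolding row_sum_def [abs_def] by (intro sup_of_integrals_suminf sup_of_integrals_rho)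

lemma sup_of_integrals_row_norm: "sup_of_integrals leb01 (row_norm n)"
  unfolding row_norm_def [abs_def]
  by (intro sup_of_integrals_max sup_of_integrals_cmult sup_of_integrals_SUP
        sup_of_integrals_rho sup_of_integrals_row_sum) simp

lemma sup_of_integrals_mixed_norm: "sup_of_integrals leb01 mixed_norm"
  unfolding mixed_norm_def [abs_def] by (intro sup_of_integrals_suminf sup_of_integrals_row_norm)

text \<open>The constant weight \<open>1 / wt i\<close> is admissible because \<open>[0,1]\<close> has measure one.\<close>

lemma rho_ge_integral:
  assumes "u \<in> borel_measurable leb01"
  shows "ennreal (1 / wt i) * (\<integral>\<^sup>+t. u t \<partial>leb01) \<le> rho i u"
proof -
  have "1 / wt i \<le> 1 / 1" using wt_ge_1[of i] by (intro divide_left_mono) auto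
  then have "1 / wt i \<le> wt i" using wt_ge_1[of i] by linarith
  then have "(\<lambda>_. ennreal (1 / wt i)) \<in> weights i"
    by (simp add: weights_def emeasure_leb01_space ennreal_leI)
  then have "(\<integral>\<^sup>+t. u t * ennreal (1 / wt i) \<partial>leb01) \<le> rho i u"
    unfolding rho_def by (rule SUP_upper)
  then show ?thesis using assms by (simp add: nn_integral_multc mult.commute)
qed

lemma rho_ge_set_integral:
  assumes "u \<in> borel_measurable leb01" "D \<in> sets leb01" "emeasure leb01 D \<le> ennreal (1 / wt i ^ 2)"
  shows "ennreal (wt i) * (\<integral>\<^sup>+t. u t * indicator D t \<partial>leb01) \<le> rho i u"
proof -
  have "(\<integral>\<^sup>+t. ennreal (wt i) * indicator D t \<partial>leb01) = ennreal (wt i) * emeasure leb01 D"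
    using assms(2) by (simp add: nn_integral_cmult_indicator)
  also have "\<dots> \<le> ennreal (wt i) * ennreal (1 / wt i ^ 2)"
    using assms(3) by (rule mult_left_mono) simp
  also have "\<dots> = ennreal (1 / wt i)"
    by (simp add: ennreal_mult[symmetric] power2_eq_square)
  finally have "(\<lambda>t. ennreal (wt i) * indicator D t) \<in> weights i"
    using assms(2) by (auto simp: weights_def indicator_def)
  then have "(\<integral>\<^sup>+t. u t * (ennreal (wt i) * indicator D t) \<partial>leb01) \<le> rho i u"
    unfolding rho_def by (rule SUP_upper)
  then show ?thesis using assms by (simp add: nn_integral_cmult[symmetric] mult_ac)
qed

lemma rho_le_integral:
  assumes "u \<in> borel_measurable leb01"
  shows "rho i u \<le> ennreal (wt i) * (\<integral>\<^sup>+t. u t \<partial>leb01)"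
  unfolding rho_def
proof (rule SUP_least)
  fix v assume v: "v \<in> weights i"
  have "u t * v t \<le> ennreal (wt i) * u t" for t
    using v mult_right_mono[of "v t" "ennreal (wt i)" "u t"] by (simp add: weights_def mult.commute)
  then have "(\<integral>\<^sup>+t. u t * v t \<partial>leb01) \<le> (\<integral>\<^sup>+t. ennreal (wt i) * u t \<partial>leb01)"
    by (intro nn_integral_mono)
  then show "(\<integral>\<^sup>+t. u t * v t \<partial>leb01) \<le> ennreal (wt i) * (\<integral>\<^sup>+t. u t \<partial>leb01)"
    using assms by (simp add: nn_integral_cmult)
qed

lemma rho_le_bound:
  assumes "\<And>t. u t \<le> c"
  shows "rho i u \<le> c * ennreal (1 / wt i)"
  unfolding rho_def
proof (rule SUP_least)
  fix v assume v: "v \<in> weights i"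
  have "(\<integral>\<^sup>+t. u t * v t \<partial>leb01) \<le> (\<integral>\<^sup>+t. c * v t \<partial>leb01)"
    using assms by (intro nn_integral_mono mult_right_mono) auto
  also have "\<dots> = c * (\<integral>\<^sup>+t. v t \<partial>leb01)"
    using v by (simp add: nn_integral_cmult weights_def)
  also have "\<dots> \<le> c * ennreal (1 / wt i)"
    using v by (intro mult_left_mono) (auto simp: weights_def)
  finally show "(\<integral>\<^sup>+t. u t * v t \<partial>leb01) \<le> c * ennreal (1 / wt i)" .
qed

lemma rho_le_row_norm: "rho (prod_encode (n, k)) u \<le> row_norm n u"
  unfolding row_norm_def by (rule max.coboundedI1, rule SUP_upper) simp

lemma eps_row_sum_le_row_norm: "ennreal (eps n) * row_sum n u \<le> row_norm n u"
  unfolding row_norm_def by (rule max.cobounded2)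

lemma ennreal_term_le_suminf: "f i \<le> (\<Sum>i. f i :: ennreal)"
  using sum_le_suminf[of f "{i}"] by simp

lemma row_norm_le_row_sum: "row_norm n u \<le> row_sum n u"
proof -
  have "(SUP k. rho (prod_encode (n, k)) u) \<le> row_sum n u"
    unfolding row_sum_def by (intro SUP_least ennreal_term_le_suminf[of "\<lambda>k. rho (prod_encode (n, k)) u"])
  moreover have "ennreal (eps n) * row_sum n u \<le> 1 * row_sum n u"
    using eps_le_1[of n] by (intro mult_right_mono) (auto simp: ennreal_le_1)
  ultimately show ?thesis by (simp add: row_norm_def)
qed

lemma row_norm_le_mixed_norm: "row_norm n u \<le> mixed_norm u"
  unfolding mixed_norm_def by (rule ennreal_term_le_suminf[of "\<lambda>n. row_norm n u"])

lemma row_sum_finite: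
  assumes "mixed_norm u < \<infinity>"
  shows "row_sum n u < \<infinity>"
proof -
  have "ennreal (eps n) * row_sum n u < \<infinity>"
    by (rule order_le_less_trans[OF order_trans[OF eps_row_sum_le_row_norm row_norm_le_mixed_norm] assms])
  moreover have "ennreal (eps n) \<noteq> 0" using eps_pos[of n] by (simp add: ennreal_eq_0_iff not_le)
  ultimately have "row_sum n u \<noteq> top" by (auto simp: ennreal_mult_eq_top_iff)
  then show ?thesis by (simp add: less_top)
qed

lemma integral_le_mixed_norm:
  assumes "u \<in> borel_measurable leb01"
  shows "(\<integral>\<^sup>+t. u t \<partial>leb01) \<le> 2 * mixed_norm u"
proof -
  have "ennreal (1 / wt 0) * (\<integral>\<^sup>+t. u t \<partial>leb01) \<le> rho (prod_encode (0,0)) u"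
    using rho_ge_integral[OF assms, of 0] by (simp add: prod_encode_def)
  also have "\<dots> \<le> mixed_norm u"
    using rho_le_row_norm row_norm_le_mixed_norm by (rule order_trans)
  finally have "ennreal 2 * (ennreal (1 / wt 0) * (\<integral>\<^sup>+t. u t \<partial>leb01)) \<le> ennreal 2 * mixed_norm u"
    by (rule mult_left_mono) simp
  moreover have "ennreal 2 * ennreal (1 / wt 0) = 1"
    by (subst ennreal_mult[symmetric]) (auto simp: wt_def)
  ultimately show ?thesis by (simp add: mult.assoc[symmetric])
qed

text \<open>Each single \<open>rho i\<close> is dominated by the \<open>L\<^sub>1\<close> norm. Only infinitely many of them together can
  detect a sequence that is null in \<open>L\<^sub>1\<close>.\<close>

lemma rho_tendsto_0:
  assumes "\<And>m. u m \<in> borel_measurable leb01" "(\<lambda>m. \<integral>\<^sup>+t. u m t \<partial>leb01) \<longlonglongrightarrow> 0"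
  shows "(\<lambda>m. rho i (u m)) \<longlonglongrightarrow> 0"
proof (rule tendsto_sandwich[OF _ _ tendsto_const[of 0]])
  show "(\<lambda>m. ennreal (wt i) * (\<integral>\<^sup>+t. u m t \<partial>leb01)) \<longlonglongrightarrow> 0"
    using ennreal_tendsto_cmult[OF _ assms(2), of "ennreal (wt i)"] by simp
  show "\<forall>\<^sub>F m in sequentially. rho i (u m) \<le> ennreal (wt i) * (\<integral>\<^sup>+t. u m t \<partial>leb01)"
    using rho_le_integral[OF assms(1)] by simp
qed auto

text \<open>Dominated convergence for series, first along each row and then across the rows: each row sum is
  finite as \<open>eps n\<close> does not vanish.\<close>

lemma mixed_norm_order_continuous:
  assumes u: "u \<in> borel_measurable leb01" "mixed_norm u < \<infinity>"
    and um: "\<And>m. u' m \<in> borel_measurable leb01" "\<And>m t. u' m t \<le> u t"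
    and lim: "(\<lambda>m. \<integral>\<^sup>+t. u' m t \<partial>leb01) \<longlonglongrightarrow> 0"
  shows "(\<lambda>m. mixed_norm (u' m)) \<longlonglongrightarrow> 0"
proof -
  have row: "(\<lambda>m. row_sum n (u' m)) \<longlonglongrightarrow> 0" for n
    unfolding row_sum_def
  proof (rule suminf_dominated_tendsto_0)
    show "rho (prod_encode (n, k)) (u' m) \<le> rho (prod_encode (n, k)) u" for m k
      using um u by (intro sup_of_integrals_mono[OF sup_of_integrals_rho]) auto
    show "(\<Sum>k. rho (prod_encode (n, k)) u) < \<infinity>"
      using row_sum_finite[OF u(2)] by (simp add: row_sum_def)
  qed (rule rho_tendsto_0[OF um(1) lim])
  have "(\<lambda>m. row_norm n (u' m)) \<longlonglongrightarrow> 0" for n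
    by (rule tendsto_sandwich[OF _ _ _ row[of n]]) (auto simp: row_norm_le_row_sum)
  then show ?thesis
    unfolding mixed_norm_def
  proof (rule suminf_dominated_tendsto_0[rotated 2])
    show "row_norm n (u' m) \<le> row_norm n u" for m n
      using um u by (intro sup_of_integrals_mono[OF sup_of_integrals_row_norm]) auto
    show "(\<Sum>n. row_norm n u) < \<infinity>" using u(2) by (simp add: mixed_norm_def)
  qed
qed

lemma add_le_prod_encode: "n + k \<le> prod_encode (n, k)"
proof -
  have "m \<le> triangle m" for m by (induction m) auto
  from this[of "n + k"] show ?thesis by (simp add: prod_encode_def)
qed

lemma half_power_prod_encode: "(1/2::real) ^ prod_encode (n, k) \<le> (1/2) ^ n * (1/2) ^ k"
  using power_decreasing[OF add_le_prod_encode[of n k], of "1/2::real"] by (simp add: power_add)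

lemma mixed_norm_one: "mixed_norm (\<lambda>_. 1) \<le> ennreal 4"
proof -
  have "rho i (\<lambda>_. 1) \<le> ennreal ((1/2) ^ i)" for i
  proof -
    have "rho i (\<lambda>_. 1) \<le> 1 * ennreal (1 / wt i)" by (rule rho_le_bound) simp
    also have "1 / wt i \<le> 1 / 2 ^ i"
      using wt_ge_power[of i] by (intro divide_left_mono) auto
    then have "1 * ennreal (1 / wt i) \<le> ennreal ((1/2) ^ i)"
      by (simp add: power_one_over ennreal_leI)
    finally show ?thesis .
  qed
  note rho_le = this
  have rho_le': "rho (prod_encode (n, k)) (\<lambda>_. 1) \<le> ennreal ((1/2)^n * (1/2)^k)" for n k
    by (rule order_trans[OF rho_le ennreal_leI[OF half_power_prod_encode]])
  have row: "row_norm n (\<lambda>_. 1) \<le> ennreal (2 * (1/2)^n)" for n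
  proof -
    have "row_norm n (\<lambda>_. 1) \<le> row_sum n (\<lambda>_. 1)" by (rule row_norm_le_row_sum)
    also have "\<dots> \<le> (\<Sum>k. ennreal ((1/2)^n * (1/2)^k))"
      unfolding row_sum_def by (intro suminf_le rho_le' summableI)
    also have "\<dots> = ennreal (2 * (1/2)^n)" by (rule suminf_half_powers) simp
    finally show ?thesis .
  qed
  have "mixed_norm (\<lambda>_. 1) \<le> (\<Sum>n. ennreal (2 * (1/2)^n))"
    unfolding mixed_norm_def by (intro suminf_le row summableI)
  also have "\<dots> = ennreal (2 * 2)" by (rule suminf_half_powers) simp
  finally show ?thesis by simp
qed

section \<open>Unit functions at separate scales\<close>

text \<open>Disjoint sets of measure \<open>1/(wt j)\<^sup>2\<close>, which is the length at which \<open>rho j\<close> looks.\<close>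

definition cell :: "nat \<Rightarrow> real set" where
  "cell j = {1 / wt j ^ 2 <.. 2 / wt j ^ 2}"

definition unit_fun :: "nat \<Rightarrow> real \<Rightarrow> ennreal" where
  "unit_fun j t = ennreal (wt j) * indicator (cell j) t"

lemma wt_Suc: "2 * wt i ^ 2 \<le> wt (Suc i) ^ 2"
proof -
  have "2 * wt i ^ 2 = 2 ^ (2 * (i+1)^2 + 1)" by (simp add: wt_def mult.commute flip: power_mult)
  also have "\<dots> \<le> (2::real) ^ (2 * (i+2)^2)"
    by (rule power_increasing) (auto simp: power2_eq_square algebra_simps)
  finally show ?thesis by (simp add: wt_def flip: power_mult) (simp add: mult.commute)
qed

lemma cell_subset: "cell j \<subseteq> {0..1}"
proof -
  have "2 \<le> wt j" using power_increasing[of 1 "(j+1)^2" "2::real"] by (simp add: wt_def)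
  then have "2 * 1 \<le> wt j * wt j" by (intro mult_mono) auto
  then have "2 / wt j ^ 2 \<le> 1" by (simp add: divide_le_eq power2_eq_square)
  moreover have "0 \<le> 1 / wt j ^ 2" by simp
  ultimately have "0 \<le> t \<and> t \<le> 1" if "1 / wt j ^ 2 < t" "t \<le> 2 / wt j ^ 2" for t
    using that by linarith
  then show ?thesis by (auto simp: cell_def)
qed

lemma cell_sets [measurable, simp]: "cell j \<in> sets leb01"
  using cell_subset[of j] by (auto simp: sets_restrict_space_iff cell_def)

lemma emeasure_cell: "emeasure leb01 (cell j) = ennreal (1 / wt j ^ 2)"
proof -
  have "emeasure leb01 (cell j) = emeasure lborel (cell j)"
    using cell_subset[of j] by (simp add: emeasure_restrict_space cell_def)
  also have "\<dots> = ennreal (2 / wt j ^ 2 - 1 / wt j ^ 2)"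
    unfolding cell_def by (rule emeasure_lborel_Ioc) (simp add: divide_right_mono)
  finally show ?thesis by (simp add: diff_divide_distrib[symmetric])
qed

lemma cell_disjoint:
  assumes "i \<noteq> j" shows "cell i \<inter> cell j = {}"
proof -
  have *: "cell i \<inter> cell j = {}" if "i < j" for i j
  proof -
    have "2 * wt i ^ 2 \<le> wt (Suc i) ^ 2" by (rule wt_Suc)
    also have "\<dots> \<le> wt j ^ 2"
      unfolding wt_def using that by (intro power_mono power_increasing) auto
    finally have "2 / wt j ^ 2 \<le> 1 / wt i ^ 2"
      by (simp add: pos_divide_le_eq pos_le_divide_eq)
    then show ?thesis by (auto simp: cell_def)
  qed
  show ?thesis using *[of i j] *[of j i] assms by (cases "i < j") (auto simp: Int_commute)
qed

lemma unit_fun_measurable [measurable, simp]: "unit_fun j \<in> borel_measurable leb01"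
  unfolding unit_fun_def by measurable

lemma nn_integral_unit_fun: "(\<integral>\<^sup>+t. unit_fun j t \<partial>leb01) = ennreal (1 / wt j)"
  unfolding unit_fun_def
  by (simp add: nn_integral_cmult_indicator emeasure_cell ennreal_mult[symmetric] power2_eq_square)

lemma rho_unit_fun_le: "rho i (unit_fun j) \<le> ennreal (wt i / wt j)"
  "rho i (unit_fun j) \<le> ennreal (wt j / wt i)"
proof -
  show "rho i (unit_fun j) \<le> ennreal (wt i / wt j)"
    using rho_le_integral[of "unit_fun j" i]
    by (simp add: nn_integral_unit_fun ennreal_mult[symmetric])
  show "rho i (unit_fun j) \<le> ennreal (wt j / wt i)"
    using rho_le_bound[of "unit_fun j" "ennreal (wt j)" i]
    by (simp add: unit_fun_def indicator_def ennreal_mult[symmetric])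
qed

lemma wt_ratio:
  assumes "i < j" shows "wt i / wt j \<le> (1/2) ^ i * (1/2) ^ j"
proof -
  have "(i+1)^2 + (i + j) \<le> (j+1)^2"
  proof -
    obtain d where d: "j = Suc (i + d)" using assms less_imp_Suc_add by blast
    show ?thesis unfolding d by (simp add: power2_eq_square algebra_simps)
  qed
  then have "wt i * 2 ^ (i + j) \<le> wt j"
    unfolding wt_def power_add[symmetric] by (rule power_increasing) simp
  then show ?thesis by (simp add: field_simps power_add power_one_over)
qed

text \<open>Both inequalities of \<open>rho_unit_fun_le\<close> enter: the \<open>L\<^sub>1\<close> bound is the good one for \<open>i < j\<close>, the
  \<open>L\<^sub>\<infinity>\<close> bound for \<open>i > j\<close>.\<close>

lemma rho_unit_fun:
  "rho i (unit_fun j) \<le> ennreal (of_bool (i = j) + (1/2) ^ i * (1/2) ^ j)"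
proof (cases i j rule: linorder_cases)
  case less
  then show ?thesis using rho_unit_fun_le(1)[of i j] wt_ratio[of i j]
    by (auto intro: order_trans ennreal_leI)
next
  case equal
  have "rho i (unit_fun j) \<le> ennreal 1" using rho_unit_fun_le(1)[of i j] equal by simp
  also have "\<dots> \<le> ennreal (of_bool (i = j) + (1/2) ^ i * (1/2) ^ j)"
    using equal by (intro ennreal_leI) simp
  finally show ?thesis .
next
  case greater
  then show ?thesis using rho_unit_fun_le(2)[of i j] wt_ratio[of j i]
    by (auto intro: order_trans ennreal_leI simp: mult.commute)
qed

text \<open>The diagonal contributes \<open>max 1 (eps n * card K)\<close>, the norm of an indicator sequence in row
  \<open>n\<close>; all off-diagonal contributions together stay below a constant, also in the other rows. So a set
  of about \<open>1 / eps n\<close> unit functions in row \<open>n\<close> has a sum of bounded norm.\<close>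

lemma mixed_norm_row_of_unit_funs:
  assumes K: "finite K"
  shows "mixed_norm (\<lambda>t. \<Sum>k\<in>K. unit_fun (prod_encode (n, k)) t) \<le> ennreal (9 + eps n * card K)"
proof -
  define u where "u = (\<lambda>t. \<Sum>k\<in>K. unit_fun (prod_encode (n, k)) t)"
  have geo: "(\<Sum>k\<in>K. (1/2::real) ^ prod_encode (n, k)) \<le> 2"
  proof -
    have "(\<Sum>k\<in>K. (1/2::real) ^ prod_encode (n, k)) \<le> (\<Sum>k\<in>K. (1/2) ^ k)"
      by (intro sum_mono power_decreasing) (auto simp: le_prod_encode_2)
    also have "\<dots> \<le> (\<Sum>k. (1/2::real) ^ k)"
      by (intro sum_le_suminf K) auto
    also have "\<dots> = 2" using suminf_geometric[of "1/2::real"] by simp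
    finally show ?thesis .
  qed
  have rho_u: "rho i u \<le> ennreal ((\<Sum>k\<in>K. of_bool (i = prod_encode (n, k))) + 2 * (1/2) ^ i)" for i
  proof -
    have "rho i u \<le> (\<Sum>k\<in>K. rho i (unit_fun (prod_encode (n, k))))"
      unfolding u_def by (intro sup_of_integrals_sum[OF sup_of_integrals_rho] K) auto
    also have "\<dots> \<le> (\<Sum>k\<in>K. ennreal (of_bool (i = prod_encode (n, k)) + (1/2) ^ i * (1/2) ^ prod_encode (n, k)))"
      by (intro sum_mono rho_unit_fun)
    also have "\<dots> = ennreal (\<Sum>k\<in>K. of_bool (i = prod_encode (n, k)) + (1/2) ^ i * (1/2) ^ prod_encode (n, k))"
      by (rule sum_ennreal) auto
    also have "\<dots> \<le> ennreal ((\<Sum>k\<in>K. of_bool (i = prod_encode (n, k))) + 2 * (1/2) ^ i)"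
      using geo by (intro ennreal_leI) (simp add: sum.distrib sum_distrib_left[symmetric] mult.commute)
    finally show ?thesis .
  qed
  have rho_le: "rho (prod_encode (n', k)) u \<le> ennreal (of_bool (n' = n \<and> k \<in> K) + 2 * (1/2)^n' * (1/2)^k)" for n' k
  proof -
    have "(\<Sum>k'\<in>K. of_bool (prod_encode (n', k) = prod_encode (n, k'))) = (of_bool (n' = n \<and> k \<in> K) :: real)"
      using K by (cases "n' = n") (auto simp: of_bool_def sum.delta)
    then show ?thesis using rho_u[of "prod_encode (n', k)"] half_power_prod_encode[of n' k]
      by (auto elim!: order_trans intro!: ennreal_leI)
  qed
  have row: "row_norm n' u \<le> ennreal (of_bool (n' = n) * (1 + eps n * card K) + 4 * (1/2)^n')" for n'
  proof -
    have 1: "(SUP k. rho (prod_encode (n', k)) u) \<le> ennreal (of_bool (n' = n) * (1 + eps n * card K) + 4 * (1/2)^n')"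
    proof (rule SUP_least)
      fix k
      have "(1/2::real)^k \<le> 1" by (simp add: power_le_one)
      then have "2 * (1/2)^n' * (1/2)^k \<le> 4 * (1/2::real)^n'"
        by (simp add: mult_mono)
      then have "of_bool (n' = n \<and> k \<in> K) + 2 * (1/2)^n' * (1/2)^k
          \<le> of_bool (n' = n) * (1 + eps n * card K) + 4 * (1/2)^n'"
        by (intro add_mono) auto
      then show "rho (prod_encode (n', k)) u \<le> ennreal (of_bool (n' = n) * (1 + eps n * card K) + 4 * (1/2)^n')"
        by (rule order_trans[OF rho_le ennreal_leI])
    qed
    have fin: "(\<Sum>k. ennreal (of_bool (n' = n \<and> k \<in> K))) = ennreal (of_bool (n' = n) * card K)"
    proof -
      have "(\<Sum>k. ennreal (of_bool (n' = n \<and> k \<in> K))) = (\<Sum>k\<in>K. ennreal (of_bool (n' = n \<and> k \<in> K)))"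
        by (rule suminf_finite[OF K]) simp
      also have "\<dots> = (\<Sum>k\<in>K. ennreal (of_bool (n' = n)))"
        by (rule sum.cong) auto
      also have "\<dots> = ennreal (of_bool (n' = n) * card K)"
        by (cases "n' = n") (simp_all add: ennreal_of_nat_eq_real_of_nat)
      finally show ?thesis .
    qed
    have geo': "(\<Sum>k. ennreal (2 * (1/2)^n' * (1/2)^k)) = ennreal (4 * (1/2)^n')"
    proof -
      have "(\<Sum>k. ennreal (2 * (1/2)^n' * (1/2)^k)) = ennreal (2 * (2 * (1/2)^n'))"
        by (rule suminf_half_powers) simp
      also have "2 * (2 * (1/2::real)^n') = 4 * (1/2)^n'" by linarith
      finally show ?thesis .
    qed
    have "row_sum n' u \<le> (\<Sum>k. ennreal (of_bool (n' = n \<and> k \<in> K)) + ennreal (2 * (1/2)^n' * (1/2)^k))"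
      unfolding row_sum_def by (intro suminf_le summableI order_trans[OF rho_le]) (subst ennreal_plus, auto)
    also have "\<dots> = (\<Sum>k. ennreal (of_bool (n' = n \<and> k \<in> K))) + (\<Sum>k. ennreal (2 * (1/2)^n' * (1/2)^k))"
      by (rule suminf_add[symmetric]; rule summableI)
    also have "\<dots> = ennreal (of_bool (n' = n) * card K + 4 * (1/2)^n')"
      unfolding fin geo' by (rule ennreal_plus[symmetric]) simp_all
    finally have rs: "row_sum n' u \<le> ennreal (of_bool (n' = n) * card K + 4 * (1/2)^n')" .
    have "ennreal (eps n') * row_sum n' u \<le> ennreal (eps n') * ennreal (of_bool (n' = n) * card K + 4 * (1/2)^n')"
      using rs by (intro mult_left_mono) auto
    also have "\<dots> = ennreal (eps n' * (of_bool (n' = n) * card K + 4 * (1/2)^n'))"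
      by (simp add: ennreal_mult)
    also have "\<dots> \<le> ennreal (of_bool (n' = n) * (1 + eps n * card K) + 4 * (1/2)^n')"
    proof (rule ennreal_leI)
      have "eps n' * (4 * (1/2)^n') \<le> 1 * (4 * (1/2)^n')"
        using eps_le_1[of n'] by (intro mult_right_mono) auto
      moreover have "eps n' * (of_bool (n' = n) * card K) \<le> of_bool (n' = n) * (1 + eps n * card K)"
        by auto
      moreover have "eps n' * (of_bool (n' = n) * card K + 4 * (1/2)^n')
        = eps n' * (of_bool (n' = n) * card K) + eps n' * (4 * (1/2)^n')"
        by (rule distrib_left)
      ultimately show "eps n' * (of_bool (n' = n) * card K + 4 * (1/2)^n')
        \<le> of_bool (n' = n) * (1 + eps n * card K) + 4 * (1/2)^n'"
        by linarith
    qed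
    finally show ?thesis using 1 by (simp add: row_norm_def)
  qed
  have fin: "(\<Sum>n'. ennreal (of_bool (n' = n) * (1 + eps n * card K))) = ennreal (1 + eps n * card K)"
  proof -
    have "(\<Sum>n'. ennreal (of_bool (n' = n) * (1 + eps n * card K)))
      = (\<Sum>n'\<in>{n}. ennreal (of_bool (n' = n) * (1 + eps n * card K)))"
      by (rule suminf_finite) auto
    then show ?thesis by simp
  qed
  have geo': "(\<Sum>n'. ennreal (4 * (1/2)^n')) = ennreal 8"
  proof -
    have "(\<Sum>n'. ennreal (4 * (1/2)^n')) = ennreal (2 * 4)"
      by (rule suminf_half_powers) simp
    then show ?thesis by simp
  qed
  have "mixed_norm u \<le> (\<Sum>n'. ennreal (of_bool (n' = n) * (1 + eps n * card K)) + ennreal (4 * (1/2)^n'))"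
    unfolding mixed_norm_def
    by (intro suminf_le summableI order_trans[OF row]) (subst ennreal_plus, auto)
  also have "\<dots> = (\<Sum>n'. ennreal (of_bool (n' = n) * (1 + eps n * card K))) + (\<Sum>n'. ennreal (4 * (1/2)^n'))"
    by (rule suminf_add[symmetric]; rule summableI)
  also have "\<dots> = ennreal (1 + eps n * card K + 8)"
    unfolding fin geo' by (rule ennreal_plus[symmetric]) simp_all
  also have "1 + eps n * card K + 8 = 9 + eps n * card K" by simp
  finally show ?thesis unfolding u_def .
qed

section \<open>The Banach lattice\<close>

text \<open>Convexity of \<open>s powr p\<close>, written as a tangent inequality at \<open>r\<close>; equivalently Young's inequality.\<close>

lemma powr_tangent:
  fixes s r p :: real
  assumes "1 < p" "0 \<le> s" "0 \<le> r"
  shows "p * s * r powr (p - 1) \<le> s powr p + (p - 1) * r powr p"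
proof -
  have "s * r powr (p - 1) \<le> s powr p / p + (r powr (p - 1)) powr (p / (p - 1)) / (p / (p - 1))"
    using assms by (intro Youngs_inequality) (auto simp: field_simps)
  also have "(r powr (p - 1)) powr (p / (p - 1)) = r powr p"
    using assms by (simp add: powr_powr)
  finally have "p * (s * r powr (p - 1)) \<le> p * (s powr p / p + r powr p / (p / (p - 1)))"
    using assms by (intro mult_left_mono) auto
  also have "\<dots> = s powr p + (p - 1) * r powr p"
    using assms by (simp add: distrib_left)
  finally show ?thesis by (simp add: mult.assoc)
qed

text \<open>Convexity of the power at the convex combination of \<open>x/a\<close> and \<open>y/b\<close> with weights \<open>a/(a+b)\<close> and
  \<open>b/(a+b)\<close>. This is what turns subadditivity of \<open>mixed_norm\<close> into the triangle inequality for the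
  convexification.\<close>

lemma powr_add_le:
  fixes x y a b p :: real
  assumes "1 < p" "0 \<le> x" "0 \<le> y" "0 < a" "0 < b"
  shows "(x + y) powr p \<le> (a + b) powr (p - 1) * (a powr (1 - p) * x powr p + b powr (1 - p) * y powr p)"
proof -
  define r where "r = (x + y) / (a + b)"
  have r: "0 \<le> r" using assms by (simp add: r_def)
  have *: "p * z * r powr (p - 1) \<le> c powr (1 - p) * z powr p + (p - 1) * c * r powr p"
    if "0 \<le> z" "0 < c" for z c
  proof -
    have "c * (p * (z / c) * r powr (p - 1)) \<le> c * ((z / c) powr p + (p - 1) * r powr p)"
      using that assms r by (intro mult_left_mono powr_tangent) auto
    moreover have "c * (z / c) powr p = c powr (1 - p) * z powr p"
      using that by (simp add: powr_divide powr_diff)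
    ultimately show ?thesis using that by (simp add: distrib_left mult_ac)
  qed
  have rp: "r * r powr (p - 1) = r powr p"
  proof (cases "r = 0")
    case False then show ?thesis using r by (simp add: powr_diff)
  qed simp
  have "p * x * r powr (p - 1) + p * y * r powr (p - 1) = p * (a + b) * (r * r powr (p - 1))"
    using assms by (simp add: r_def field_simps)
  then have "p * (a + b) * r powr p \<le> (a powr (1 - p) * x powr p + b powr (1 - p) * y powr p)
      + (p - 1) * (a + b) * r powr p"
    using *[of x a] *[of y b] assms rp by (simp add: algebra_simps)
  then have "(a + b) * r powr p \<le> a powr (1 - p) * x powr p + b powr (1 - p) * y powr p"
    by (simp add: algebra_simps)
  then have "(a + b) powr (p - 1) * ((a + b) * r powr p)
      \<le> (a + b) powr (p - 1) * (a powr (1 - p) * x powr p + b powr (1 - p) * y powr p)"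
    by (rule mult_left_mono) simp
  moreover have "(a + b) powr (p - 1) * ((a + b) * r powr p) = (x + y) powr p"
    using assms by (simp add: r_def powr_divide powr_diff)
  ultimately show ?thesis by simp
qed

text \<open>An elementary replacement for Hoelder's inequality: the parameter \<open>d\<close> is adapted to the
  size of \<open>x\<close> in each application.\<close>

lemma le_add_powr:
  fixes x d p :: real
  assumes "1 < p" "0 \<le> x" "0 < d"
  shows "x \<le> d + d powr (1 - p) * x powr p"
proof (cases "x \<le> d")
  case True
  then show ?thesis using assms by (simp add: add_increasing2)
next
  case False
  then have "d powr (p - 1) \<le> x powr (p - 1)" using assms by (intro powr_mono2) auto
  then have "d powr (1 - p) * x * d powr (p - 1) \<le> d powr (1 - p) * x * x powr (p - 1)"
    using assms by (intro mult_left_mono) auto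
  moreover have "d powr (1 - p) * x * d powr (p - 1) = x"
    using assms by (simp add: powr_diff)
  moreover have "d powr (1 - p) * x * x powr (p - 1) = d powr (1 - p) * x powr p"
    using assms False by (simp add: powr_diff)
  ultimately show ?thesis using assms by simp
qed

abbreviation pw :: "real \<Rightarrow> (real \<Rightarrow> real) \<Rightarrow> real \<Rightarrow> ennreal" where
  "pw p f \<equiv> (\<lambda>t. ennreal (\<bar>f t\<bar> powr p))"

definition mixed_space :: "real \<Rightarrow> real blat" where
  "mixed_space p = \<lparr>
     vecs = {f \<in> borel_measurable leb01. mixed_norm (pw p f) < \<infinity>},
     nrm = (\<lambda>f. enn2real (mixed_norm (pw p f)) powr (1 / p)),
     leq = (\<lambda>f g. AE t in leb01. f t \<le> g t) \<rparr>"

lemma vecs_mixed_space: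
  "f \<in> vecs (mixed_space p) \<longleftrightarrow> f \<in> borel_measurable leb01 \<and> mixed_norm (pw p f) < \<infinity>"
  by (simp add: mixed_space_def)

lemma mixed_space_measurable: "f \<in> vecs (mixed_space p) \<Longrightarrow> f \<in> borel_measurable leb01"
  by (simp add: vecs_mixed_space)

lemma leq_mixed_space: "leq (mixed_space p) f g \<longleftrightarrow> (AE t in leb01. f t \<le> g t)"
  by (simp add: mixed_space_def)

lemma nrm_mixed_space_nonneg: "0 \<le> nrm (mixed_space p) f"
  by (simp add: mixed_space_def)

lemma pw_measurable [measurable (raw)]:
  "f \<in> borel_measurable leb01 \<Longrightarrow> pw p f \<in> borel_measurable leb01"
  by measurable

lemma nrm_powr_mixed_space:
  assumes "1 < p" "f \<in> vecs (mixed_space p)"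
  shows "ennreal (nrm (mixed_space p) f powr p) = mixed_norm (pw p f)"
  using assms by (simp add: mixed_space_def powr_powr)

text \<open>Almost all norm estimates below are shown for \<open>mixed_norm (pw p f)\<close>, which needs no roots, and
  carried over by this equivalence; the left side also contains the membership of \<open>f\<close>.\<close>

lemma mixed_norm_le_iff:
  assumes "1 < p" "f \<in> borel_measurable leb01" "0 \<le> c"
  shows "mixed_norm (pw p f) \<le> ennreal (c powr p) \<longleftrightarrow>
    f \<in> vecs (mixed_space p) \<and> nrm (mixed_space p) f \<le> c"
proof
  assume *: "mixed_norm (pw p f) \<le> ennreal (c powr p)"
  then have f: "f \<in> vecs (mixed_space p)"
    using assms by (auto simp: vecs_mixed_space intro: order_le_less_trans)
  have "enn2real (mixed_norm (pw p f)) \<le> c powr p"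
    using * by (intro enn2real_leI) auto
  then have "enn2real (mixed_norm (pw p f)) powr (1 / p) \<le> (c powr p) powr (1 / p)"
    using assms by (intro powr_mono2) auto
  then show "f \<in> vecs (mixed_space p) \<and> nrm (mixed_space p) f \<le> c"
    using f assms by (simp add: mixed_space_def powr_powr)
next
  assume *: "f \<in> vecs (mixed_space p) \<and> nrm (mixed_space p) f \<le> c"
  then have "nrm (mixed_space p) f powr p \<le> c powr p"
    using assms nrm_mixed_space_nonneg[of p f] by (intro powr_mono2) auto
  then show "mixed_norm (pw p f) \<le> ennreal (c powr p)"
    using * assms by (simp add: nrm_powr_mixed_space[symmetric] ennreal_leI)
qed

lemma mixed_norm_pw_add:
  assumes p: "1 < p" and m: "f \<in> borel_measurable leb01" "g \<in> borel_measurable leb01"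
    and a: "0 < a" "mixed_norm (pw p f) \<le> ennreal (a powr p)"
    and b: "0 < b" "mixed_norm (pw p g) \<le> ennreal (b powr p)"
  shows "mixed_norm (pw p (\<lambda>t. f t + g t)) \<le> ennreal ((a + b) powr p)"
proof -
  define A where "A = (a + b) powr (p - 1) * a powr (1 - p)"
  define B where "B = (a + b) powr (p - 1) * b powr (1 - p)"
  have AB: "0 \<le> A" "0 \<le> B" by (auto simp: A_def B_def)
  have pt: "ennreal (\<bar>f t + g t\<bar> powr p) \<le> ennreal A * ennreal (\<bar>f t\<bar> powr p) + ennreal B * ennreal (\<bar>g t\<bar> powr p)" for t
  proof -
    have "\<bar>f t + g t\<bar> powr p \<le> (\<bar>f t\<bar> + \<bar>g t\<bar>) powr p"
      using p by (intro powr_mono2) auto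
    also have "\<dots> \<le> A * \<bar>f t\<bar> powr p + B * \<bar>g t\<bar> powr p"
      using powr_add_le[OF p, of "\<bar>f t\<bar>" "\<bar>g t\<bar>" a b] a b
      by (simp add: A_def B_def algebra_simps)
    finally show ?thesis using AB
      by (simp add: ennreal_leI flip: ennreal_mult ennreal_plus)
  qed
  have "mixed_norm (pw p (\<lambda>t. f t + g t)) \<le> mixed_norm (\<lambda>t. ennreal A * pw p f t + ennreal B * pw p g t)"
    using m pt by (intro sup_of_integrals_mono[OF sup_of_integrals_mixed_norm]) auto
  also have "\<dots> \<le> mixed_norm (\<lambda>t. ennreal A * pw p f t) + mixed_norm (\<lambda>t. ennreal B * pw p g t)"
    using m by (intro sup_of_integrals_add[OF sup_of_integrals_mixed_norm]) auto
  also have "\<dots> = ennreal A * mixed_norm (pw p f) + ennreal B * mixed_norm (pw p g)"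
    using m by (simp add: sup_of_integrals_scale[OF sup_of_integrals_mixed_norm])
  also have "\<dots> \<le> ennreal A * ennreal (a powr p) + ennreal B * ennreal (b powr p)"
    using a b by (intro add_mono mult_left_mono) auto
  also have "\<dots> = ennreal (A * a powr p + B * b powr p)"
    using AB by (simp flip: ennreal_mult ennreal_plus)
  also have "A * a powr p + B * b powr p = (a + b) powr p"
  proof -
    have "A * a powr p = (a + b) powr (p - 1) * a" "B * b powr p = (a + b) powr (p - 1) * b"
      using a b by (auto simp: A_def B_def powr_diff)
    then have "A * a powr p + B * b powr p = (a + b) powr (p - 1) * (a + b)"
      by (simp add: distrib_left)
    then show ?thesis using a b by (simp add: powr_diff)
  qed
  finally show ?thesis .
qed

lemma mixed_space_add:
  assumes p: "1 < p" and f: "f \<in> vecs (mixed_space p)" and g: "g \<in> vecs (mixed_space p)"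
  shows "(\<lambda>t. f t + g t) \<in> vecs (mixed_space p)"
    "nrm (mixed_space p) (\<lambda>t. f t + g t) \<le> nrm (mixed_space p) f + nrm (mixed_space p) g"
proof -
  have m: "f \<in> borel_measurable leb01" "g \<in> borel_measurable leb01"
    using f g by (auto simp: vecs_mixed_space)
  have *: "(\<lambda>t. f t + g t) \<in> vecs (mixed_space p) \<and>
    nrm (mixed_space p) (\<lambda>t. f t + g t) \<le> nrm (mixed_space p) f + nrm (mixed_space p) g + e" if "0 < e" for e
  proof -
    let ?a = "nrm (mixed_space p) f + e / 2" and ?b = "nrm (mixed_space p) g + e / 2"
    have pos: "0 < ?a" "0 < ?b" using that nrm_mixed_space_nonneg[of p] by (auto intro: add_nonneg_pos)
    have "mixed_norm (pw p f) \<le> ennreal (?a powr p)" "mixed_norm (pw p g) \<le> ennreal (?b powr p)"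
      using mixed_norm_le_iff[OF p m(1), of ?a] mixed_norm_le_iff[OF p m(2), of ?b] f g pos that by auto
    then have "mixed_norm (pw p (\<lambda>t. f t + g t)) \<le> ennreal ((?a + ?b) powr p)"
      using pos by (intro mixed_norm_pw_add p m) auto
    then have "(\<lambda>t. f t + g t) \<in> vecs (mixed_space p) \<and> nrm (mixed_space p) (\<lambda>t. f t + g t) \<le> ?a + ?b"
      using mixed_norm_le_iff[OF p, of "\<lambda>t. f t + g t" "?a + ?b"] m pos by auto
    then show ?thesis by (simp add: algebra_simps)
  qed
  from *[of 1] show "(\<lambda>t. f t + g t) \<in> vecs (mixed_space p)" by simp
  show "nrm (mixed_space p) (\<lambda>t. f t + g t) \<le> nrm (mixed_space p) f + nrm (mixed_space p) g"
  proof (rule field_le_epsilon)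
    fix e :: real assume "0 < e"
    from *[OF this] show "nrm (mixed_space p) (\<lambda>t. f t + g t)
      \<le> nrm (mixed_space p) f + nrm (mixed_space p) g + e" by simp
  qed
qed

lemma mixed_space_scale:
  assumes p: "1 < p" and f: "f \<in> vecs (mixed_space p)"
  shows "(\<lambda>t. c * f t) \<in> vecs (mixed_space p)"
    "nrm (mixed_space p) (\<lambda>t. c * f t) = \<bar>c\<bar> * nrm (mixed_space p) f"
proof -
  have m: "f \<in> borel_measurable leb01" using f by (simp add: vecs_mixed_space)
  have "pw p (\<lambda>t. c * f t) = (\<lambda>t. ennreal (\<bar>c\<bar> powr p) * pw p f t)"
    by (simp add: abs_mult powr_mult ennreal_mult)
  then have *: "mixed_norm (pw p (\<lambda>t. c * f t)) = ennreal (\<bar>c\<bar> powr p) * mixed_norm (pw p f)"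
    using m by (simp add: sup_of_integrals_scale[OF sup_of_integrals_mixed_norm])
  then show "(\<lambda>t. c * f t) \<in> vecs (mixed_space p)"
    using f borel_measurable_times[OF borel_measurable_const m, of c]
    by (simp add: vecs_mixed_space ennreal_mult_less_top)
  show "nrm (mixed_space p) (\<lambda>t. c * f t) = \<bar>c\<bar> * nrm (mixed_space p) f"
    using p by (simp add: mixed_space_def * enn2real_mult powr_mult powr_powr)
qed

lemma mixed_space_solid:
  assumes p: "1 < p" and g: "g \<in> vecs (mixed_space p)" and f: "f \<in> borel_measurable leb01"
    and le: "AE t in leb01. \<bar>f t\<bar> \<le> \<bar>g t\<bar>"
  shows "f \<in> vecs (mixed_space p)" "nrm (mixed_space p) f \<le> nrm (mixed_space p) g"
proof -
  have "mixed_norm (pw p f) \<le> mixed_norm (pw p g)"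
    using le p by (intro sup_of_integrals_mono[OF sup_of_integrals_mixed_norm] pw_measurable f
        mixed_space_measurable[OF g]) (auto elim!: eventually_mono intro!: ennreal_leI powr_mono2)
  then have "f \<in> vecs (mixed_space p) \<and> nrm (mixed_space p) f \<le> nrm (mixed_space p) g"
    using mixed_norm_le_iff[OF p f nrm_mixed_space_nonneg[of p g]] nrm_powr_mixed_space[OF p g] by simp
  then show "f \<in> vecs (mixed_space p)" "nrm (mixed_space p) f \<le> nrm (mixed_space p) g" by auto
qed

lemma mixed_space_eq_0_iff:
  assumes p: "1 < p" and f: "f \<in> vecs (mixed_space p)"
  shows "nrm (mixed_space p) f = 0 \<longleftrightarrow> (AE t in leb01. f t = 0)"
proof
  have m: "f \<in> borel_measurable leb01" using f by (simp add: vecs_mixed_space)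
  assume "nrm (mixed_space p) f = 0"
  then have "mixed_norm (pw p f) = 0" using nrm_powr_mixed_space[OF p f] by simp
  then have "(\<integral>\<^sup>+t. pw p f t \<partial>leb01) = 0"
    using integral_le_mixed_norm[of "pw p f"] m by simp
  then have "AE t in leb01. pw p f t = 0"
    using m by (subst (asm) nn_integral_0_iff_AE) auto
  then show "AE t in leb01. f t = 0"
    by eventually_elim (simp add: ennreal_eq_0_iff powr_eq_0_iff le_less)
next
  assume "AE t in leb01. f t = 0"
  then have "nrm (mixed_space p) f \<le> nrm (mixed_space p) (\<lambda>t. 0 * f t)"
    by (intro mixed_space_solid(2)[OF p mixed_space_scale(1)[OF p f] mixed_space_measurable[OF f]]) simp
  also have "\<dots> = 0" using mixed_space_scale(2)[OF p f, of 0] by simp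
  finally show "nrm (mixed_space p) f = 0" using nrm_mixed_space_nonneg[of p f] by simp
qed

lemma mixed_space_one:
  assumes "1 < p" shows "(\<lambda>_. 1) \<in> vecs (mixed_space p)"
proof -
  have "mixed_norm (\<lambda>_. 1) < \<infinity>" using mixed_norm_one by (rule order_le_less_trans) simp
  then show ?thesis by (simp add: vecs_mixed_space)
qed

lemma integral_abs_le:
  assumes p: "1 < p" and f: "f \<in> vecs (mixed_space p)" and d: "0 < d" "nrm (mixed_space p) f \<le> d"
  shows "(\<integral>\<^sup>+t. ennreal \<bar>f t\<bar> \<partial>leb01) \<le> ennreal (3 * d)"
proof -
  have m: "f \<in> borel_measurable leb01" using f by (simp add: vecs_mixed_space)
  have "ennreal \<bar>f t\<bar> \<le> ennreal d + ennreal (d powr (1 - p)) * pw p f t" for t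
    using le_add_powr[OF p _ d(1), of "\<bar>f t\<bar>"] d
    by (simp add: ennreal_leI flip: ennreal_mult ennreal_plus)
  then have "(\<integral>\<^sup>+t. ennreal \<bar>f t\<bar> \<partial>leb01) \<le> (\<integral>\<^sup>+t. ennreal d + ennreal (d powr (1 - p)) * pw p f t \<partial>leb01)"
    by (intro nn_integral_mono)
  also have "\<dots> = ennreal d + ennreal (d powr (1 - p)) * (\<integral>\<^sup>+t. pw p f t \<partial>leb01)"
    using m by (simp add: nn_integral_add nn_integral_cmult emeasure_leb01_space)
  also have "\<dots> \<le> ennreal d + ennreal (d powr (1 - p)) * (2 * ennreal (d powr p))"
  proof (intro add_left_mono mult_left_mono)
    have "(\<integral>\<^sup>+t. pw p f t \<partial>leb01) \<le> 2 * mixed_norm (pw p f)"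
      using m by (intro integral_le_mixed_norm) auto
    also have "\<dots> \<le> 2 * ennreal (d powr p)"
      using mixed_norm_le_iff[OF p m, of d] f d by (intro mult_left_mono) auto
    finally show "(\<integral>\<^sup>+t. pw p f t \<partial>leb01) \<le> 2 * ennreal (d powr p)" .
  qed simp
  also have "\<dots> = ennreal (d + d powr (1 - p) * (2 * d powr p))"
    using d by (simp flip: ennreal_mult ennreal_plus ennreal_numeral)
  also have "d + d powr (1 - p) * (2 * d powr p) = 3 * d"
    using d by (simp add: powr_diff)
  finally show ?thesis .
qed

text \<open>The space embeds into \<open>L\<^sub>1\<close>, so a Cauchy sequence has a subsequence that converges almost
  everywhere, and Fatou's lemma for \<open>mixed_norm\<close> shows that its limit is a limit in norm.\<close>

lemma mixed_space_complete:
  assumes p: "1 < p" and x: "\<And>n. x n \<in> vecs (mixed_space p)"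
    and cauchy: "\<And>e. e > 0 \<Longrightarrow> \<exists>M. \<forall>m\<ge>M. \<forall>n\<ge>M. nrm (mixed_space p) (\<lambda>t. x m t - x n t) < e"
  shows "\<exists>f\<in>vecs (mixed_space p). (\<lambda>n. nrm (mixed_space p) (\<lambda>t. x n t - f t)) \<longlonglongrightarrow> 0"
proof -
  have m: "x n \<in> borel_measurable leb01" for n using x[of n] by (simp add: vecs_mixed_space)
  have diff: "(\<lambda>t. f t - g t) \<in> vecs (mixed_space p)"
    if "f \<in> vecs (mixed_space p)" "g \<in> vecs (mixed_space p)" for f g
    using mixed_space_add(1)[OF p that(1) mixed_space_scale(1)[OF p that(2), of "-1"]] by simp
  have int: "integrable leb01 f" if "f \<in> vecs (mixed_space p)" for f
  proof (rule integrableI_bounded)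
    show "f \<in> borel_measurable leb01" using that by (simp add: vecs_mixed_space)
    have "(\<integral>\<^sup>+t. ennreal \<bar>f t\<bar> \<partial>leb01) \<le> ennreal (3 * (nrm (mixed_space p) f + 1))"
      using nrm_mixed_space_nonneg[of p f] by (intro integral_abs_le[OF p that]) auto
    also have "\<dots> < \<infinity>" by simp
    finally show "(\<integral>\<^sup>+t. ennreal (norm (f t)) \<partial>leb01) < \<infinity>" by simp
  qed
  obtain r where r: "strict_mono r" "AE t in leb01. Cauchy (\<lambda>i. x (r i) t)"
  proof (rule cauchy_L1_AE_cauchy_subseq[of leb01 x])
    fix e :: real assume e: "0 < e"
    obtain M where M: "\<forall>m\<ge>M. \<forall>n\<ge>M. nrm (mixed_space p) (\<lambda>t. x m t - x n t) < e / 4"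
      using cauchy[of "e/4"] e by auto
    have "(LINT t|leb01. norm (x i t - x j t)) < e" if "i \<ge> M" "j \<ge> M" for i j
    proof -
      have "ennreal (LINT t|leb01. norm (x i t - x j t)) = (\<integral>\<^sup>+t. ennreal \<bar>x i t - x j t\<bar> \<partial>leb01)"
        using int[OF diff[OF x[of i] x[of j]]] by (simp add: nn_integral_eq_integral)
      also have "\<dots> \<le> ennreal (3 * (e / 4))"
        using M that e by (intro integral_abs_le[OF p diff[OF x x]]) (auto intro: less_imp_le)
      finally have "(LINT t|leb01. norm (x i t - x j t)) \<le> 3 * (e / 4)"
        using e by (subst (asm) ennreal_le_iff) auto
      then show ?thesis using e by simp
    qed
    then show "\<exists>N. \<forall>i\<ge>N. \<forall>j\<ge>N. (LINT t|leb01. norm (x i t - x j t)) < e" by blast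
  qed (use int x in auto)
  define f where "f = (\<lambda>t. lim (\<lambda>i. x (r i) t))"
  have f_meas: "f \<in> borel_measurable leb01" unfolding f_def using m by measurable
  have lim: "AE t in leb01. (\<lambda>i. x (r i) t) \<longlonglongrightarrow> f t"
    using r(2) by eventually_elim (simp add: f_def Cauchy_convergent_iff convergent_LIMSEQ_iff)
  have key: "(\<lambda>t. x n t - f t) \<in> vecs (mixed_space p) \<and> nrm (mixed_space p) (\<lambda>t. x n t - f t) \<le> e"
    if e: "0 < e" and M: "\<forall>m\<ge>M. \<forall>n\<ge>M. nrm (mixed_space p) (\<lambda>t. x m t - x n t) < e" and n: "M \<le> n"
    for e M n
  proof -
    have "AE t in leb01. pw p (\<lambda>t. x n t - f t) t = liminf (\<lambda>i. pw p (\<lambda>t. x n t - x (r i) t) t)"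
      using lim
    proof eventually_elim
      case (elim t)
      have "(\<lambda>i. \<bar>x n t - x (r i) t\<bar> powr p) \<longlonglongrightarrow> \<bar>x n t - f t\<bar> powr p"
        using p by (intro tendsto_powr' tendsto_intros elim) auto
      then have "(\<lambda>i. ennreal (\<bar>x n t - x (r i) t\<bar> powr p)) \<longlonglongrightarrow> ennreal (\<bar>x n t - f t\<bar> powr p)"
        by (rule tendsto_ennrealI)
      then show ?case using lim_imp_Liminf[OF sequentially_bot] by force
    qed
    then have "mixed_norm (pw p (\<lambda>t. x n t - f t)) = mixed_norm (\<lambda>t. liminf (\<lambda>i. pw p (\<lambda>t. x n t - x (r i) t) t))"
      using m f_meas by (intro sup_of_integrals_cong_AE[OF sup_of_integrals_mixed_norm]) auto
    also have "\<dots> \<le> liminf (\<lambda>i. mixed_norm (pw p (\<lambda>t. x n t - x (r i) t)))"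
      using m by (intro sup_of_integrals_Fatou[OF sup_of_integrals_mixed_norm]) auto
    also have "\<dots> \<le> liminf (\<lambda>i. ennreal (e powr p))"
    proof (rule Liminf_mono)
      show "\<forall>\<^sub>F i in sequentially. mixed_norm (pw p (\<lambda>t. x n t - x (r i) t)) \<le> ennreal (e powr p)"
        unfolding eventually_sequentially
      proof (intro exI allI impI)
        fix i assume "M \<le> i"
        then have "M \<le> r i" using seq_suble[OF r(1), of i] by simp
        then have "nrm (mixed_space p) (\<lambda>t. x n t - x (r i) t) \<le> e" using M n by (simp add: less_imp_le)
        then show "mixed_norm (pw p (\<lambda>t. x n t - x (r i) t)) \<le> ennreal (e powr p)"
          using mixed_norm_le_iff[OF p, of "\<lambda>t. x n t - x (r i) t" e] diff[OF x x] m e by auto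
      qed
    qed
    also have "\<dots> = ennreal (e powr p)" by (simp add: Liminf_const)
    finally show ?thesis
      using mixed_norm_le_iff[OF p, of "\<lambda>t. x n t - f t" e] m f_meas e by auto
  qed
  obtain M1 where M1: "\<forall>m\<ge>M1. \<forall>n\<ge>M1. nrm (mixed_space p) (\<lambda>t. x m t - x n t) < 1"
    using cauchy[of 1] by auto
  have "f \<in> vecs (mixed_space p)"
    using diff[OF x[of M1] conjunct1[OF key[OF _ M1, of M1]]] by simp
  moreover have "(\<lambda>n. nrm (mixed_space p) (\<lambda>t. x n t - f t)) \<longlonglongrightarrow> 0"
  proof (rule LIMSEQ_I)
    fix e :: real assume e: "0 < e"
    obtain M where M: "\<forall>m\<ge>M. \<forall>n\<ge>M. nrm (mixed_space p) (\<lambda>t. x m t - x n t) < e / 2"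
      using cauchy[of "e/2"] e by auto
    have "norm (nrm (mixed_space p) (\<lambda>t. x n t - f t) - 0) < e" if "M \<le> n" for n
      using conjunct2[OF key[OF _ M that]] e nrm_mixed_space_nonneg[of p "\<lambda>t. x n t - f t"] by simp
    then show "\<exists>M. \<forall>n\<ge>M. norm (nrm (mixed_space p) (\<lambda>t. x n t - f t) - 0) < e" by blast
  qed
  ultimately show ?thesis by blast
qed

lemma banach_function_lattice_mixed_space:
  assumes p: "1 < p"
  shows "banach_function_lattice (mixed_space p)"
proof -
  have "\<not> (AE t in leb01. (1::real) = 0)"
  proof
    assume "AE t in leb01. (1::real) = 0"
    then have "emeasure leb01 (space leb01) = 0"
      by (subst (asm) AE_iff_measurable[of "space leb01"]) auto
    then show False by (simp add: emeasure_leb01_space)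
  qed
  then have "nrm (mixed_space p) (\<lambda>_. 1) \<noteq> 0"
    using mixed_space_eq_0_iff[OF p mixed_space_one[OF p]] by simp
  then have nz: "\<exists>f\<in>vecs (mixed_space p). nrm (mixed_space p) f \<noteq> 0"
    using mixed_space_one[OF p] by blast
  have sub: "vecs (mixed_space p) \<subseteq> borel_measurable leb01"
    using mixed_space_measurable by blast
  show ?thesis
    unfolding banach_function_lattice_def
  proof (intro conjI)
    show "vecs (mixed_space p) \<subseteq> borel_measurable leb01" by (rule sub)
    show "\<forall>f\<in>vecs (mixed_space p). \<forall>g\<in>vecs (mixed_space p).
        leq (mixed_space p) f g \<longleftrightarrow> (AE t in leb01. f t \<le> g t)"
      by (simp add: leq_mixed_space)
    show "\<forall>f\<in>vecs (mixed_space p). \<forall>g\<in>vecs (mixed_space p). (\<lambda>t. f t + g t) \<in> vecs (mixed_space p) \<and>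
        nrm (mixed_space p) (\<lambda>t. f t + g t) \<le> nrm (mixed_space p) f + nrm (mixed_space p) g"
      using mixed_space_add[OF p] by blast
    show "\<forall>f\<in>vecs (mixed_space p). \<forall>c. (\<lambda>t. c * f t) \<in> vecs (mixed_space p) \<and>
        nrm (mixed_space p) (\<lambda>t. c * f t) = \<bar>c\<bar> * nrm (mixed_space p) f"
      using mixed_space_scale[OF p] by blast
    show "\<forall>f\<in>vecs (mixed_space p). 0 \<le> nrm (mixed_space p) f \<and>
        (nrm (mixed_space p) f = 0 \<longleftrightarrow> (AE t in leb01. f t = 0))"
      using mixed_space_eq_0_iff[OF p] nrm_mixed_space_nonneg by blast
    show "\<exists>f\<in>vecs (mixed_space p). nrm (mixed_space p) f \<noteq> 0" by (rule nz)
    show "\<forall>x :: nat \<Rightarrow> real \<Rightarrow> real. (\<forall>n. x n \<in> vecs (mixed_space p)) \<and>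
        (\<forall>e>0. \<exists>M. \<forall>m\<ge>M. \<forall>n\<ge>M. nrm (mixed_space p) (\<lambda>t. x m t - x n t) < e) \<longrightarrow>
        (\<exists>f\<in>vecs (mixed_space p). (\<lambda>n. nrm (mixed_space p) (\<lambda>t. x n t - f t)) \<longlonglongrightarrow> 0)"
      using mixed_space_complete[OF p] by blast
    show "\<forall>g\<in>vecs (mixed_space p). \<forall>f\<in>borel_measurable leb01. (AE t in leb01. \<bar>f t\<bar> \<le> \<bar>g t\<bar>) \<longrightarrow>
        f \<in> vecs (mixed_space p) \<and> nrm (mixed_space p) f \<le> nrm (mixed_space p) g"
      using mixed_space_solid[OF p] by blast
  qed
qed

section \<open>Rearrangement invariance and maximality\<close>

lemma emeasure_distr_abs:
  fixes x :: "real \<Rightarrow> real"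
  assumes "x \<in> borel_measurable leb01"
  shows "emeasure (distr leb01 borel (\<lambda>t. \<bar>x t\<bar>)) {\<tau><..} = emeasure leb01 {t\<in>{0..1}. \<tau> < \<bar>x t\<bar>}"
proof -
  have "(\<lambda>t. \<bar>x t\<bar>) -` {\<tau><..} \<inter> space leb01 = {t\<in>{0..1}. \<tau> < \<bar>x t\<bar>}"
    by auto
  moreover have "(\<lambda>t. \<bar>x t\<bar>) \<in> borel_measurable leb01" by (rule borel_measurable_abs[OF assms])
  ultimately show ?thesis
    using emeasure_distr[of "\<lambda>t. \<bar>x t\<bar>" leb01 borel "{\<tau><..}"] greaterThan_borel[of \<tau>] by simp
qed

text \<open>Equimeasurability only speaks of levels \<open>\<tau> > 0\<close>; the level \<open>0\<close> follows from continuity of the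
  measure, and negative levels are trivial since the total mass is finite and the same.\<close>

lemma distr_abs_equimeasurable:
  assumes x: "x \<in> borel_measurable leb01" and y: "y \<in> borel_measurable leb01"
    and xy: "equimeasurable x y"
  shows "distr leb01 borel (\<lambda>t. \<bar>x t\<bar>) = distr leb01 borel (\<lambda>t. \<bar>y t\<bar>)"
proof (rule measure_eqI_lessThan)
  interpret finite_measure leb01 by (rule finite_measure_leb01)
  have pos: "emeasure leb01 {t\<in>{0..1}. \<tau> < \<bar>x t\<bar>} = emeasure leb01 {t\<in>{0..1}. \<tau> < \<bar>y t\<bar>}" if "0 < \<tau>" for \<tau>
    using xy that by (simp add: emeasure_eq_measure equimeasurable_def)
  fix \<tau> :: real
  show "emeasure (distr leb01 borel (\<lambda>t. \<bar>x t\<bar>)) {\<tau><..} < \<infinity>"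
    unfolding emeasure_distr_abs[OF x] using emeasure_finite[of "{t\<in>{0..1}. \<tau> < \<bar>x t\<bar>}"]
    unfolding infinity_ennreal_def less_top .
  have "emeasure leb01 {t\<in>{0..1}. \<tau> < \<bar>x t\<bar>} = emeasure leb01 {t\<in>{0..1}. \<tau> < \<bar>y t\<bar>}"
  proof (cases \<tau> "0 :: real" rule: linorder_cases)
    case less
    then have "{t\<in>{0..1}. \<tau> < \<bar>x t\<bar>} = {0..1}" "{t\<in>{0..1}. \<tau> < \<bar>y t\<bar>} = {0..1}"
      by (auto intro: less_le_trans)
    then show ?thesis by simp
  next
    case greater
    then show ?thesis by (rule pos)
  next
    case equal
    have lim: "emeasure leb01 {t\<in>{0..1}. 0 < \<bar>z t\<bar>} = (SUP n. emeasure leb01 {t\<in>{0..1}. 1 / real (Suc n) < \<bar>z t\<bar>})"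
      if z: "z \<in> borel_measurable leb01" for z :: "real \<Rightarrow> real"
    proof -
      have un: "{t\<in>{0..1}. 0 < \<bar>z t\<bar>} = (\<Union>n. {t\<in>{0..1}. 1 / real (Suc n) < \<bar>z t\<bar>})"
      proof (intro set_eqI iffI)
        fix t assume "t \<in> {t\<in>{0..1}. 0 < \<bar>z t\<bar>}"
        then show "t \<in> (\<Union>n. {t\<in>{0..1}. 1 / real (Suc n) < \<bar>z t\<bar>})"
          using reals_Archimedean[of "\<bar>z t\<bar>"] by (auto simp: inverse_eq_divide)
      next
        fix t assume "t \<in> (\<Union>n. {t\<in>{0..1}. 1 / real (Suc n) < \<bar>z t\<bar>})"
        then obtain n where "t \<in> {0..1}" "1 / real (Suc n) < \<bar>z t\<bar>" by blast
        moreover have "0 < 1 / real (Suc n)" by simp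
        ultimately show "t \<in> {t\<in>{0..1}. 0 < \<bar>z t\<bar>}" by (auto intro: order.strict_trans)
      qed
      have meas: "{t\<in>{0..1}. 1 / real (Suc n) < \<bar>z t\<bar>} \<in> sets leb01" for n
      proof -
        have "{t\<in>space leb01. 1 / real (Suc n) < \<bar>z t\<bar>} \<in> sets leb01" using z by measurable
        then show ?thesis by simp
      qed
      have "1 / real (Suc n) < a" if "1 / real (Suc m) < a" "m \<le> n" for m n a
      proof -
        have "1 / real (Suc n) \<le> 1 / real (Suc m)" using that by (intro divide_left_mono) auto
        then show ?thesis using that by linarith
      qed
      then have "incseq (\<lambda>n. {t\<in>{0..1}. 1 / real (Suc n) < \<bar>z t\<bar>})"
        unfolding incseq_def by blast
      then show ?thesis unfolding un using meas by (intro SUP_emeasure_incseq[symmetric]) auto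
    qed
    show ?thesis unfolding equal lim[OF x] lim[OF y] by (intro SUP_cong refl pos) simp
  qed
  then show "emeasure (distr leb01 borel (\<lambda>t. \<bar>x t\<bar>)) {\<tau><..} = emeasure (distr leb01 borel (\<lambda>t. \<bar>y t\<bar>)) {\<tau><..}"
    unfolding emeasure_distr_abs[OF x] emeasure_distr_abs[OF y] .
qed auto

lemma density_bounded_AE:
  fixes c :: ennreal
  assumes "finite_measure M" "h \<in> borel_measurable M" "c < \<infinity>"
    and "\<And>A. A \<in> sets M \<Longrightarrow> emeasure (density M h) A \<le> c * emeasure M A"
  shows "AE s in M. h s \<le> c"
proof -
  interpret finite_measure M by fact
  define A where "A = {s \<in> space M. c < h s}"
  have A: "A \<in> sets M" unfolding A_def using assms(2) by measurable
  have "(\<integral>\<^sup>+s. h s * indicator A s \<partial>M) = (\<integral>\<^sup>+s. c * indicator A s + (h s - c) * indicator A s \<partial>M)"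
    by (intro nn_integral_cong)
       (auto simp: A_def indicator_def add_diff_inverse_ennreal dest: less_imp_le)
  also have "\<dots> = c * emeasure M A + (\<integral>\<^sup>+s. (h s - c) * indicator A s \<partial>M)"
    using A assms(2) by (simp add: nn_integral_add nn_integral_cmult_indicator)
  finally have "c * emeasure M A + (\<integral>\<^sup>+s. (h s - c) * indicator A s \<partial>M) \<le> c * emeasure M A"
    using assms(4)[OF A] A assms(2) by (simp add: emeasure_density)
  moreover have "c * emeasure M A < \<infinity>"
  proof -
    have "emeasure M A < top" using emeasure_finite[of A] unfolding infinity_ennreal_def less_top .
    then show ?thesis using assms(3) by (simp add: ennreal_mult_less_top)
  qed
  ultimately have "(\<integral>\<^sup>+s. (h s - c) * indicator A s \<partial>M) = 0"
    using ennreal_add_left_cancel_le[of "c * emeasure M A" "\<integral>\<^sup>+s. (h s - c) * indicator A s \<partial>M" 0] by auto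
  then have "AE s in M. (h s - c) * indicator A s = 0"
    using A assms(2) by (subst (asm) nn_integral_0_iff_AE) auto
  then have "AE s in M. s \<in> space M \<longrightarrow> h s \<le> c"
  proof eventually_elim
    case (elim s)
    show ?case
    proof (intro impI leI notI)
      assume "s \<in> space M" "c < h s"
      then have "h s - c = 0" using elim by (simp add: A_def)
      then show False using diff_gr0_ennreal[OF \<open>c < h s\<close>] by simp
    qed
  qed
  then show ?thesis using AE_space by eventually_elim simp
qed

text \<open>An admissible weight may be replaced by its conditional expectation given \<open>a\<close>, without changing
  its integral against functions of \<open>a\<close>. The result is of the form \<open>h \<circ> a\<close>, and then \<open>h \<circ> b\<close> is admissible
  as well and gives the same integrals, as \<open>a\<close> and \<open>b\<close> have the same distribution.\<close>

lemma rho_distr_le: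
  fixes a b :: "real \<Rightarrow> real" and G :: "real \<Rightarrow> ennreal"
  assumes [measurable]: "a \<in> borel_measurable leb01" "b \<in> borel_measurable leb01" "G \<in> borel_measurable borel"
    and D: "distr leb01 borel a = distr leb01 borel b"
  shows "rho i (\<lambda>t. G (a t)) \<le> rho i (\<lambda>t. G (b t))"
  unfolding rho_def[of i "\<lambda>t. G (a t)"]
proof (rule SUP_least)
  fix v assume v: "v \<in> weights i"
  then have [measurable]: "v \<in> borel_measurable leb01" by (rule weights_measurable)
  define \<mu> where "\<mu> = distr leb01 borel a"
  define \<nu> where "\<nu> = distr (density leb01 v) borel a"
  have fin: "finite_measure \<mu>" unfolding \<mu>_def
    by (intro finite_measure.finite_measure_distr finite_measure_leb01) simp
  then interpret \<mu>: finite_measure \<mu> .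
  have le: "emeasure \<nu> A \<le> ennreal (wt i) * emeasure \<mu> A" if A [measurable]: "A \<in> sets borel" for A
  proof -
    have S: "a -` A \<inter> space leb01 \<in> sets leb01" by (rule measurable_sets[OF assms(1) A])
    have "emeasure \<nu> A = emeasure (density leb01 v) (a -` A \<inter> space leb01)"
      unfolding \<nu>_def by (subst emeasure_distr) simp_all
    also have "\<dots> = (\<integral>\<^sup>+t. v t * indicator (a -` A \<inter> space leb01) t \<partial>leb01)"
      by (rule emeasure_density[OF _ S]) measurable
    also have "\<dots> \<le> (\<integral>\<^sup>+t. ennreal (wt i) * indicator (a -` A \<inter> space leb01) t \<partial>leb01)"
      using v by (intro nn_integral_mono mult_right_mono) (auto simp: weights_def)
    also have "\<dots> = ennreal (wt i) * emeasure leb01 (a -` A \<inter> space leb01)"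
      by (rule nn_integral_cmult_indicator[OF S])
    also have "\<dots> = ennreal (wt i) * emeasure \<mu> A"
      unfolding \<mu>_def by (subst emeasure_distr) simp_all
    finally show ?thesis .
  qed
  have "absolutely_continuous \<mu> \<nu>"
    unfolding absolutely_continuous_def
  proof
    fix A assume "A \<in> null_sets \<mu>"
    then have A: "A \<in> sets borel" "emeasure \<mu> A = 0" by (auto simp: \<mu>_def)
    then have "emeasure \<nu> A = 0" using le[of A] by simp
    then show "A \<in> null_sets \<nu>" using A by (auto simp: \<nu>_def)
  qed
  then obtain h where h [measurable]: "h \<in> borel_measurable \<mu>" and dens: "density \<mu> h = \<nu>"
    using \<mu>.Radon_Nikodym[of \<nu>] by (auto simp: \<mu>_def \<nu>_def)
  have h_borel [measurable]: "h \<in> borel_measurable borel" using h by (simp add: \<mu>_def)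
  have h_le: "AE s in \<mu>. h s \<le> ennreal (wt i)"
  proof (rule density_bounded_AE[OF fin h])
    fix A assume "A \<in> sets \<mu>"
    then have "A \<in> sets borel" by (simp add: \<mu>_def)
    then show "emeasure (density \<mu> h) A \<le> ennreal (wt i) * emeasure \<mu> A"
      unfolding dens by (rule le)
  qed simp
  \<comment> \<open>The density is bounded almost everywhere only, but a weight must be bounded everywhere.\<close>
  define h' where "h' s = min (h s) (ennreal (wt i))" for s
  have [measurable]: "h' \<in> borel_measurable borel" unfolding h'_def by measurable
  have transport: "(\<integral>\<^sup>+t. F (a t) * v t \<partial>leb01) = (\<integral>\<^sup>+t. F (b t) * h' (b t) \<partial>leb01)"
    if [measurable]: "F \<in> borel_measurable borel" for F :: "real \<Rightarrow> ennreal"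
  proof -
    have "(\<integral>\<^sup>+t. F (a t) * v t \<partial>leb01) = (\<integral>\<^sup>+t. v t * F (a t) \<partial>leb01)"
      by (simp add: mult.commute)
    also have "\<dots> = (\<integral>\<^sup>+t. F (a t) \<partial>density leb01 v)"
      by (rule nn_integral_density[symmetric]) measurable
    also have "\<dots> = (\<integral>\<^sup>+s. F s \<partial>\<nu>)"
      unfolding \<nu>_def by (rule nn_integral_distr[symmetric]) measurable
    also have "\<dots> = (\<integral>\<^sup>+s. h s * F s \<partial>\<mu>)"
      unfolding dens[symmetric] by (rule nn_integral_density[OF h]) (simp add: \<mu>_def)
    also have "\<dots> = (\<integral>\<^sup>+s. F s * h' s \<partial>\<mu>)"
      using h_le by (intro nn_integral_cong_AE) (auto elim!: eventually_mono simp: h'_def min_def mult.commute)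
    also have "\<dots> = (\<integral>\<^sup>+t. F (b t) * h' (b t) \<partial>leb01)"
      unfolding \<mu>_def D by (rule nn_integral_distr) measurable
    finally show ?thesis .
  qed
  have "(\<integral>\<^sup>+t. h' (b t) \<partial>leb01) = (\<integral>\<^sup>+t. v t \<partial>leb01)"
    using transport[of "\<lambda>_. 1"] by simp
  then have "(\<lambda>t. h' (b t)) \<in> weights i"
    using v by (auto simp: weights_def h'_def)
  then show "(\<integral>\<^sup>+t. G (a t) * v t \<partial>leb01) \<le> rho i (\<lambda>t. G (b t))"
    unfolding transport[OF assms(3)] rho_def by (rule SUP_upper)
qed

lemma mixed_norm_equimeasurable:
  assumes x: "x \<in> borel_measurable leb01" and y: "y \<in> borel_measurable leb01"
    and xy: "equimeasurable x y"
  shows "mixed_norm (pw p x) = mixed_norm (pw p y)"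
proof -
  have D: "distr leb01 borel (\<lambda>t. \<bar>x t\<bar>) = distr leb01 borel (\<lambda>t. \<bar>y t\<bar>)"
    by (rule distr_abs_equimeasurable[OF x y xy])
  have G: "(\<lambda>s. ennreal (s powr p)) \<in> borel_measurable borel" by measurable
  have m: "(\<lambda>t. \<bar>x t\<bar>) \<in> borel_measurable leb01" "(\<lambda>t. \<bar>y t\<bar>) \<in> borel_measurable leb01"
    using x y by auto
  have "rho i (pw p x) = rho i (pw p y)" for i
    by (rule antisym; rule rho_distr_le[OF _ _ G]) (use m D in auto)
  then show ?thesis unfolding mixed_norm_def row_norm_def row_sum_def by simp
qed

lemma kothe_norm_ge:
  assumes "g \<in> vecs E" "nrm E g \<le> 1"
  shows "(\<integral>\<^sup>+t. ennreal \<bar>f t * g t\<bar> \<partial>leb01) \<le> kothe_norm E f"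
  unfolding kothe_norm_def using assms by (intro SUP_upper) simp

lemma kothe_norm_leI:
  assumes "\<And>g. g \<in> vecs E \<Longrightarrow> nrm E g \<le> 1 \<Longrightarrow> (\<integral>\<^sup>+t. ennreal \<bar>f t * g t\<bar> \<partial>leb01) \<le> c"
  shows "kothe_norm E f \<le> c"
  unfolding kothe_norm_def using assms by (intro SUP_least) simp

lemma vecs_kothe_dual:
  "f \<in> vecs (kothe_dual E) \<longleftrightarrow> f \<in> borel_measurable leb01 \<and> kothe_norm E f < \<infinity>"
  by (simp add: kothe_dual_def)

lemma nrm_kothe_dual: "nrm (kothe_dual E) f = enn2real (kothe_norm E f)"
  by (simp add: kothe_dual_def)

text \<open>Hoelder's inequality for Koethe duality is homogeneity, except for functions of norm zero, where
  the definiteness of the norm is needed.\<close>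

lemma kothe_hoelder:
  assumes E: "banach_function_lattice E" and g: "g \<in> vecs E" and f: "f \<in> borel_measurable leb01"
  shows "(\<integral>\<^sup>+t. ennreal \<bar>f t * g t\<bar> \<partial>leb01) \<le> kothe_norm E f * ennreal (nrm E g)"
proof (cases "nrm E g = 0")
  case True
  then have "AE t in leb01. g t = 0" using E g by (auto simp: banach_function_lattice_def)
  then have "(\<integral>\<^sup>+t. ennreal \<bar>f t * g t\<bar> \<partial>leb01) = (\<integral>\<^sup>+t. 0 \<partial>leb01)"
    by (intro nn_integral_cong_AE) (auto elim: eventually_mono)
  then show ?thesis by simp
next
  case False
  define c where "c = nrm E g"
  have c: "0 < c" using False E g by (auto simp: c_def banach_function_lattice_def less_le)
  have gm: "g \<in> borel_measurable leb01" using E g by (auto simp: banach_function_lattice_def)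
  have sc: "(\<lambda>t. (1 / c) * g t) \<in> vecs E" "nrm E (\<lambda>t. (1 / c) * g t) = \<bar>1 / c\<bar> * nrm E g"
    using E g unfolding banach_function_lattice_def by blast+
  have "nrm E (\<lambda>t. (1 / c) * g t) \<le> 1" using sc(2) c by (simp add: c_def)
  then have 1: "(\<integral>\<^sup>+t. ennreal \<bar>f t * ((1 / c) * g t)\<bar> \<partial>leb01) \<le> kothe_norm E f"
    by (rule kothe_norm_ge[OF sc(1)])
  have "ennreal \<bar>f t * g t\<bar> = ennreal c * ennreal \<bar>f t * ((1 / c) * g t)\<bar>" for t
    using c by (simp add: abs_mult flip: ennreal_mult)
  then have "(\<integral>\<^sup>+t. ennreal \<bar>f t * g t\<bar> \<partial>leb01) = ennreal c * (\<integral>\<^sup>+t. ennreal \<bar>f t * ((1 / c) * g t)\<bar> \<partial>leb01)"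
    using f gm by (simp add: nn_integral_cmult)
  also have "\<dots> \<le> ennreal c * kothe_norm E f" using 1 by (rule mult_left_mono) simp
  finally show ?thesis by (simp add: c_def mult.commute)
qed

lemma kothe_norm_bidual_le:
  assumes E: "banach_function_lattice E" and f: "f \<in> vecs E"
  shows "kothe_norm (kothe_dual E) f \<le> ennreal (nrm E f)"
proof (rule kothe_norm_leI)
  fix g assume g: "g \<in> vecs (kothe_dual E)" "nrm (kothe_dual E) g \<le> 1"
  then have g1: "kothe_norm E g \<le> 1"
    by (auto simp: vecs_kothe_dual nrm_kothe_dual)
  have "(\<integral>\<^sup>+t. ennreal \<bar>f t * g t\<bar> \<partial>leb01) = (\<integral>\<^sup>+t. ennreal \<bar>g t * f t\<bar> \<partial>leb01)"
    by (simp add: mult.commute)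
  also have "\<dots> \<le> kothe_norm E g * ennreal (nrm E f)"
    using g by (intro kothe_hoelder[OF E f]) (simp add: vecs_kothe_dual)
  also have "\<dots> \<le> 1 * ennreal (nrm E f)" using g1 by (rule mult_right_mono) simp
  finally show "(\<integral>\<^sup>+t. ennreal \<bar>f t * g t\<bar> \<partial>leb01) \<le> ennreal (nrm E f)" by simp
qed

text \<open>For a single weight \<open>v\<close> below \<open>mixed_norm\<close> the estimate is duality in \<open>L\<^sub>p v\<close>: the function
  \<open>\<bar>f\<bar> powr (p-1) * v\<close>, suitably scaled, lies in the unit ball of the Koethe dual by Young's inequality
  and norms \<open>f\<close>. Boundedness of \<open>f\<close> makes the integral finite, so that it can be normalized.\<close>

lemma weighted_power_integral_le:
  assumes p: "1 < p" and f: "f \<in> borel_measurable leb01" and v: "v \<in> borel_measurable leb01"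
    and vN: "\<And>u. u \<in> borel_measurable leb01 \<Longrightarrow> (\<integral>\<^sup>+t. u t * v t \<partial>leb01) \<le> mixed_norm u"
    and bd: "\<And>t. \<bar>f t\<bar> \<le> r" and M: "kothe_norm (kothe_dual (mixed_space p)) f \<le> ennreal m" "0 \<le> m"
  shows "(\<integral>\<^sup>+t. pw p f t * v t \<partial>leb01) \<le> ennreal (m powr p)"
proof -
  have r: "0 \<le> r" using bd[of 0] by simp
  have one: "mixed_norm (\<lambda>_. 1) < \<infinity>" using mixed_norm_one by (rule order_le_less_trans) simp
  then have vfin: "(\<integral>\<^sup>+t. v t \<partial>leb01) < \<infinity>"
    using vN[of "\<lambda>_. 1"] by (simp add: order_le_less_trans)
  then have "AE t in leb01. v t \<noteq> \<infinity>" using v by (intro nn_integral_noteq_infinite) auto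
  then have v_eq: "AE t in leb01. v t = ennreal (enn2real (v t))"
    by eventually_elim (simp add: less_top)
  define I where "I = (\<integral>\<^sup>+t. pw p f t * v t \<partial>leb01)"
  have "I \<le> (\<integral>\<^sup>+t. ennreal (r powr p) * v t \<partial>leb01)"
    unfolding I_def using bd p r by (intro nn_integral_mono mult_right_mono ennreal_leI powr_mono2) auto
  also have "\<dots> = ennreal (r powr p) * (\<integral>\<^sup>+t. v t \<partial>leb01)" using v by (simp add: nn_integral_cmult)
  also have "\<dots> < \<infinity>" using vfin by (simp add: ennreal_mult_less_top)
  finally have Ifin: "I < \<infinity>" .
  define J where "J = enn2real I"
  have I_J: "I = ennreal J" using Ifin by (simp add: J_def)
  show ?thesis
  proof (cases "J = 0")
    case True
    then show ?thesis using I_J by (simp add: I_def)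
  next
    case False
    then have J: "0 < J" by (simp add: J_def less_le)
    \<comment> \<open>\<open>c\<close> is the norm of \<open>f\<close> in \<open>L\<^sub>p v\<close>, and \<open>g\<close> is the function at which Hoelder's inequality is sharp.\<close>
    define c where "c = J powr (1 / p)"
    have c: "0 < c" using J by (simp add: c_def)
    have cp: "c powr p = J" using J p by (simp add: c_def powr_powr)
    define g where "g t = (\<bar>f t\<bar> / c) powr (p - 1) * enn2real (v t)" for t
    have gm: "g \<in> borel_measurable leb01" unfolding g_def using f v by measurable
    have "kothe_norm (mixed_space p) g \<le> 1"
    proof (rule kothe_norm_leI)
      fix h assume h: "h \<in> vecs (mixed_space p)" "nrm (mixed_space p) h \<le> 1"
      have hm: "h \<in> borel_measurable leb01" using h by (simp add: vecs_mixed_space)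
      have h1: "mixed_norm (pw p h) \<le> ennreal 1"
        using mixed_norm_le_iff[OF p hm, of 1] h by simp
      have "AE t in leb01. ennreal \<bar>g t * h t\<bar> \<le> ennreal (1 / p) * (pw p h t * v t) + ennreal ((p - 1) / (p * J)) * (pw p f t * v t)"
        using v_eq
      proof eventually_elim
        case (elim t)
        define w where "w = enn2real (v t)"
        have w: "0 \<le> w" "v t = ennreal w" using elim by (auto simp: w_def)
        have "p * \<bar>h t\<bar> * (\<bar>f t\<bar> / c) powr (p - 1) \<le> \<bar>h t\<bar> powr p + (p - 1) * (\<bar>f t\<bar> / c) powr p"
          using p c by (intro powr_tangent) auto
        then have "p * \<bar>h t\<bar> * (\<bar>f t\<bar> / c) powr (p - 1) \<le> \<bar>h t\<bar> powr p + (p - 1) * (\<bar>f t\<bar> powr p / J)"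
          using c cp by (simp add: powr_divide)
        then have "p * (\<bar>h t\<bar> * (\<bar>f t\<bar> / c) powr (p - 1)) * (w / p) \<le> (\<bar>h t\<bar> powr p + (p - 1) * (\<bar>f t\<bar> powr p / J)) * (w / p)"
          using w p by (intro mult_right_mono) (auto simp: mult.assoc)
        then have "\<bar>g t * h t\<bar> \<le> (1 / p) * (\<bar>h t\<bar> powr p * w) + ((p - 1) / (p * J)) * (\<bar>f t\<bar> powr p * w)"
          using p w J by (simp add: g_def abs_mult w_def[symmetric] field_simps)
        then have "ennreal \<bar>g t * h t\<bar> \<le> ennreal ((1 / p) * (\<bar>h t\<bar> powr p * w) + ((p - 1) / (p * J)) * (\<bar>f t\<bar> powr p * w))"
          by (rule ennreal_leI)
        also have "\<dots> = ennreal (1 / p) * (pw p h t * v t) + ennreal ((p - 1) / (p * J)) * (pw p f t * v t)"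
        proof -
          have split: "ennreal (al * (x * w) + be * (y * w)) = ennreal al * (ennreal x * v t) + ennreal be * (ennreal y * v t)"
            if "0 \<le> al" "0 \<le> be" "0 \<le> x" "0 \<le> y" for al be x y
            using that w by (simp add: ennreal_mult ennreal_plus)
          show ?thesis by (rule split) (use p J in auto)
        qed
        finally show ?case .
      qed
      then have "(\<integral>\<^sup>+t. ennreal \<bar>g t * h t\<bar> \<partial>leb01) \<le>
        (\<integral>\<^sup>+t. ennreal (1 / p) * (pw p h t * v t) + ennreal ((p - 1) / (p * J)) * (pw p f t * v t) \<partial>leb01)"
        by (rule nn_integral_mono_AE)
      also have "\<dots> = ennreal (1 / p) * (\<integral>\<^sup>+t. pw p h t * v t \<partial>leb01) + ennreal ((p - 1) / (p * J)) * I"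
        using f v hm by (simp add: nn_integral_add nn_integral_cmult I_def)
      also have "\<dots> \<le> ennreal (1 / p) * ennreal 1 + ennreal ((p - 1) / (p * J)) * ennreal J"
        using vN[of "pw p h"] h1 hm I_J by (intro add_mono mult_left_mono) (auto intro: order_trans)
      also have "\<dots> = ennreal (1 / p + (p - 1) / (p * J) * J)"
        using p J by (simp flip: ennreal_mult ennreal_plus)
      also have "1 / p + (p - 1) / (p * J) * J = 1" using p J by (simp add: field_simps)
      finally show "(\<integral>\<^sup>+t. ennreal \<bar>g t * h t\<bar> \<partial>leb01) \<le> 1" by simp
    qed
    then have g: "g \<in> vecs (kothe_dual (mixed_space p))" "nrm (kothe_dual (mixed_space p)) g \<le> 1"
      using gm by (auto simp: vecs_kothe_dual nrm_kothe_dual intro: order_le_less_trans enn2real_leI)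
    have "AE t in leb01. ennreal c * ennreal \<bar>f t * g t\<bar> = ennreal (c powr (2 - p)) * (pw p f t * v t)"
      using v_eq
    proof eventually_elim
      case (elim t)
      define w where "w = enn2real (v t)"
      have w: "0 \<le> w" "v t = ennreal w" using elim by (auto simp: w_def)
      have "\<bar>f t\<bar> * \<bar>f t\<bar> powr (p - 1) = \<bar>f t\<bar> powr p"
        by (cases "f t = 0") (auto simp: powr_diff)
      then have "c * \<bar>f t * g t\<bar> = c powr (2 - p) * (\<bar>f t\<bar> powr p * w)"
        using c w by (simp add: g_def abs_mult w_def[symmetric] powr_divide powr_diff power2_eq_square field_simps)
      then show ?case using w c by (simp flip: ennreal_mult)
    qed
    then have "(\<integral>\<^sup>+t. ennreal c * ennreal \<bar>f t * g t\<bar> \<partial>leb01) = (\<integral>\<^sup>+t. ennreal (c powr (2 - p)) * (pw p f t * v t) \<partial>leb01)"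
      by (rule nn_integral_cong_AE)
    then have "ennreal c * (\<integral>\<^sup>+t. ennreal \<bar>f t * g t\<bar> \<partial>leb01) = ennreal (c powr (2 - p)) * I"
      using f v gm by (simp add: nn_integral_cmult I_def)
    also have "\<dots> = ennreal (c powr 2)"
      using c J I_J cp[symmetric] by (simp flip: ennreal_mult powr_add)
    finally have "ennreal (c powr 2) \<le> ennreal c * ennreal m"
      using mult_left_mono[OF order_trans[OF kothe_norm_ge[OF g, of f] M(1)], of "ennreal c"] by simp
    then have "c * c \<le> c * m"
      using c M(2) by (simp add: power2_eq_square flip: ennreal_mult)
    then have "c \<le> m" using c by simp
    then have "J \<le> m powr p" using c p cp by (auto intro: powr_mono2)
    then show ?thesis using I_J by (simp add: I_def ennreal_leI)
  qed
qed

text \<open>Truncation reduces the claim to bounded functions, and Fatou's lemma removes the truncation.\<close>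

lemma mixed_norm_le_kothe_bidual:
  assumes p: "1 < p" and f: "f \<in> borel_measurable leb01"
    and M: "kothe_norm (kothe_dual (mixed_space p)) f \<le> ennreal m" "0 \<le> m"
  shows "mixed_norm (pw p f) \<le> ennreal (m powr p)"
proof -
  obtain V where V: "V \<noteq> {}" "V \<subseteq> borel_measurable leb01"
    "\<And>u. u \<in> borel_measurable leb01 \<Longrightarrow> mixed_norm u = (SUP v\<in>V. \<integral>\<^sup>+t. u t * v t \<partial>leb01)"
    by (rule sup_of_integralsE[OF sup_of_integrals_mixed_norm]) blast
  define fr where "fr n t = min \<bar>f t\<bar> (real n)" for n t
  have frm: "fr n \<in> borel_measurable leb01" for n unfolding fr_def using f by measurable
  have "mixed_norm (pw p (fr n)) \<le> ennreal (m powr p)" for n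
  proof -
    have "kothe_norm (kothe_dual (mixed_space p)) (fr n) \<le> kothe_norm (kothe_dual (mixed_space p)) f"
    proof (rule kothe_norm_leI)
      fix g assume "g \<in> vecs (kothe_dual (mixed_space p))" "nrm (kothe_dual (mixed_space p)) g \<le> 1"
      then have "(\<integral>\<^sup>+t. ennreal \<bar>f t * g t\<bar> \<partial>leb01) \<le> kothe_norm (kothe_dual (mixed_space p)) f"
        by (rule kothe_norm_ge)
      moreover have "\<bar>fr n t * g t\<bar> \<le> \<bar>f t * g t\<bar>" for t
        unfolding abs_mult by (rule mult_right_mono) (auto simp: fr_def)
      then have "(\<integral>\<^sup>+t. ennreal \<bar>fr n t * g t\<bar> \<partial>leb01) \<le> (\<integral>\<^sup>+t. ennreal \<bar>f t * g t\<bar> \<partial>leb01)"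
        by (intro nn_integral_mono ennreal_leI)
      ultimately show "(\<integral>\<^sup>+t. ennreal \<bar>fr n t * g t\<bar> \<partial>leb01) \<le> kothe_norm (kothe_dual (mixed_space p)) f"
        by (rule order_trans[rotated])
    qed
    then have le: "kothe_norm (kothe_dual (mixed_space p)) (fr n) \<le> ennreal m"
      using M(1) by (rule order_trans)
    have "(\<integral>\<^sup>+t. pw p (fr n) t * v t \<partial>leb01) \<le> ennreal (m powr p)" if "v \<in> V" for v
    proof (rule weighted_power_integral_le[OF p frm _ _ _ le M(2)])
      show "v \<in> borel_measurable leb01" using that V(2) by blast
      show "(\<integral>\<^sup>+t. u t * v t \<partial>leb01) \<le> mixed_norm u" if "u \<in> borel_measurable leb01" for u
        unfolding V(3)[OF that] using \<open>v \<in> V\<close> by (rule SUP_upper)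
      show "\<bar>fr n t\<bar> \<le> real n" for t by (simp add: fr_def)
    qed
    then show ?thesis using V(3)[of "pw p (fr n)"] frm by (simp add: SUP_least)
  qed
  then have "liminf (\<lambda>n. mixed_norm (pw p (fr n))) \<le> liminf (\<lambda>n. ennreal (m powr p))"
    by (intro Liminf_mono always_eventually allI)
  also have "\<dots> = ennreal (m powr p)" by (simp add: Liminf_const)
  finally have 1: "liminf (\<lambda>n. mixed_norm (pw p (fr n))) \<le> ennreal (m powr p)" .
  have "liminf (\<lambda>n. pw p (fr n) t) = pw p f t" for t
  proof (rule lim_imp_Liminf[OF sequentially_bot])
    obtain k where k: "\<bar>f t\<bar> \<le> real k" using real_arch_simple by blast
    have "eventually (\<lambda>n. pw p (fr n) t = pw p f t) sequentially"
      unfolding eventually_sequentially using k by (intro exI[of _ k]) (auto simp: fr_def min_def)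
    then show "(\<lambda>n. pw p (fr n) t) \<longlonglongrightarrow> pw p f t" by (rule tendsto_eventually)
  qed
  then have "mixed_norm (pw p f) = mixed_norm (\<lambda>t. liminf (\<lambda>n. pw p (fr n) t))" by simp
  also have "\<dots> \<le> liminf (\<lambda>n. mixed_norm (pw p (fr n)))"
    using frm by (intro sup_of_integrals_Fatou[OF sup_of_integrals_mixed_norm]) auto
  finally show ?thesis using 1 by (rule order_trans)
qed

lemma maximal_mixed_space:
  assumes p: "1 < p"
  shows "maximal_space (mixed_space p)"
proof -
  let ?E = "mixed_space p"
  note E = banach_function_lattice_mixed_space[OF p]
  have 1: "f \<in> vecs (kothe_dual (kothe_dual ?E)) \<and> nrm (kothe_dual (kothe_dual ?E)) f \<le> nrm ?E f"
    if f: "f \<in> vecs ?E" for f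
  proof -
    have "kothe_norm (kothe_dual ?E) f \<le> ennreal (nrm ?E f)" by (rule kothe_norm_bidual_le[OF E f])
    then show ?thesis using f nrm_mixed_space_nonneg[of p f]
      by (auto simp: vecs_kothe_dual[of f "kothe_dual ?E"] nrm_kothe_dual[of "kothe_dual ?E"] vecs_mixed_space
          intro: order_le_less_trans enn2real_leI)
  qed
  have 2: "f \<in> vecs ?E \<and> nrm ?E f \<le> nrm (kothe_dual (kothe_dual ?E)) f"
    if f: "f \<in> vecs (kothe_dual (kothe_dual ?E))" for f
  proof -
    have m: "f \<in> borel_measurable leb01" "kothe_norm (kothe_dual ?E) f < \<infinity>"
      using f by (auto simp: vecs_kothe_dual[of f "kothe_dual ?E"])
    have eq: "kothe_norm (kothe_dual ?E) f = ennreal (nrm (kothe_dual (kothe_dual ?E)) f)"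
      using m(2) by (simp add: nrm_kothe_dual[of "kothe_dual ?E"])
    have nn: "0 \<le> nrm (kothe_dual (kothe_dual ?E)) f"
      by (simp add: nrm_kothe_dual[of "kothe_dual ?E"])
    have "mixed_norm (pw p f) \<le> ennreal (nrm (kothe_dual (kothe_dual ?E)) f powr p)"
      using eq nn by (intro mixed_norm_le_kothe_bidual[OF p m(1)]) auto
    then show ?thesis using mixed_norm_le_iff[OF p m(1) nn] by simp
  qed
  show ?thesis unfolding maximal_space_def using 1 2 by (blast intro: antisym)
qed

lemma ri_space_mixed_space:
  assumes p: "1 < p"
  shows "ri_space (mixed_space p)"
  unfolding ri_space_def
proof (intro conjI ballI impI disjI2)
  show "banach_function_lattice (mixed_space p)" by (rule banach_function_lattice_mixed_space[OF p])
  show "maximal_space (mixed_space p)" by (rule maximal_mixed_space[OF p])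
  fix x y assume y: "y \<in> vecs (mixed_space p)" and x: "x \<in> borel_measurable leb01" and xy: "equimeasurable x y"
  have eq: "mixed_norm (pw p x) = mixed_norm (pw p y)"
    using y by (intro mixed_norm_equimeasurable x xy) (simp add: vecs_mixed_space)
  show "x \<in> vecs (mixed_space p)" using y x eq by (simp add: vecs_mixed_space)
  show "nrm (mixed_space p) x = nrm (mixed_space p) y" using eq by (simp add: mixed_space_def)
qed

section \<open>Functionals on order continuous lattices\<close>

text \<open>The properties from which the representation of functionals is derived. Both the space and its
  Koethe dual have them, and the representation is applied to both.\<close>

locale oc_lattice =
  fixes E :: "real blat"
  assumes measurable_vecs: "f \<in> vecs E \<Longrightarrow> f \<in> borel_measurable leb01"
    and add_vecs: "f \<in> vecs E \<Longrightarrow> g \<in> vecs E \<Longrightarrow> (\<lambda>t. f t + g t) \<in> vecs E"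
    and scale_vecs: "f \<in> vecs E \<Longrightarrow> (\<lambda>t. c * f t) \<in> vecs E"
    and nrm_scale: "f \<in> vecs E \<Longrightarrow> nrm E (\<lambda>t. c * f t) = \<bar>c\<bar> * nrm E f"
    and solid_vecs: "g \<in> vecs E \<Longrightarrow> f \<in> borel_measurable leb01 \<Longrightarrow>
          (AE t in leb01. \<bar>f t\<bar> \<le> \<bar>g t\<bar>) \<Longrightarrow> f \<in> vecs E"
    and nrm_mono: "g \<in> vecs E \<Longrightarrow> f \<in> borel_measurable leb01 \<Longrightarrow>
          (AE t in leb01. \<bar>f t\<bar> \<le> \<bar>g t\<bar>) \<Longrightarrow> nrm E f \<le> nrm E g"
    and one_vecs: "(\<lambda>_. 1) \<in> vecs E"
    and order_continuous: "f \<in> vecs E \<Longrightarrow> (\<And>n. A n \<in> sets leb01) \<Longrightarrow> decseq A \<Longrightarrow> (\<Inter>n. A n) = {} \<Longrightarrow>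
          (\<lambda>n. nrm E (\<lambda>t. f t * indicator (A n) t)) \<longlonglongrightarrow> 0"

lemma banach_dual_add:
  "\<phi> \<in> vecs (banach_dual E) \<Longrightarrow> f \<in> vecs E \<Longrightarrow> g \<in> vecs E \<Longrightarrow> \<phi> (\<lambda>i. f i + g i) = \<phi> f + \<phi> g"
  by (simp add: banach_dual_def)

lemma banach_dual_scale:
  "\<phi> \<in> vecs (banach_dual E) \<Longrightarrow> f \<in> vecs E \<Longrightarrow> \<phi> (\<lambda>i. c * f i) = c * \<phi> f"
  by (simp add: banach_dual_def)

lemma banach_dual_outside: "\<phi> \<in> vecs (banach_dual E) \<Longrightarrow> f \<notin> vecs E \<Longrightarrow> \<phi> f = 0"
  by (simp add: banach_dual_def)

lemma banach_dual_bounded: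
  assumes "\<phi> \<in> vecs (banach_dual E)"
  obtains C where "\<And>f. f \<in> vecs E \<Longrightarrow> \<bar>\<phi> f\<bar> \<le> C * nrm E f"
proof -
  obtain C where "\<forall>f\<in>vecs E. \<bar>\<phi> f\<bar> \<le> C * nrm E f"
    using assms by (auto simp: banach_dual_def)
  then show ?thesis using that[of C] by blast
qed

lemma banach_dualI:
  assumes "\<And>f. f \<notin> vecs E \<Longrightarrow> \<phi> f = 0"
    and "\<And>f g. f \<in> vecs E \<Longrightarrow> g \<in> vecs E \<Longrightarrow> \<phi> (\<lambda>i. f i + g i) = \<phi> f + \<phi> g"
    and "\<And>f c. f \<in> vecs E \<Longrightarrow> \<phi> (\<lambda>i. c * f i) = c * \<phi> f"
    and "\<And>f. f \<in> vecs E \<Longrightarrow> \<bar>\<phi> f\<bar> \<le> C * nrm E f"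
  shows "\<phi> \<in> vecs (banach_dual E)"
  using assms unfolding banach_dual_def by (auto intro!: exI[of _ C])

context oc_lattice
begin

lemma nrm_nonneg:
  assumes "f \<in> vecs E" shows "0 \<le> nrm E f"
proof -
  have "nrm E (\<lambda>t. 0 * f t) \<le> nrm E f"
    using scale_vecs[OF assms, of 0] by (intro nrm_mono[OF assms]) (auto dest: measurable_vecs)
  then show ?thesis using nrm_scale[OF assms, of 0] by simp
qed

lemma bounded_vecs:
  assumes "h \<in> borel_measurable leb01" "\<And>t. \<bar>h t\<bar> \<le> K"
  shows "h \<in> vecs E" "nrm E h \<le> \<bar>K\<bar> * nrm E (\<lambda>_. 1)"
proof -
  have le: "AE t in leb01. \<bar>h t\<bar> \<le> \<bar>K * 1\<bar>"
    using assms(2) by (intro always_eventually allI) (metis abs_ge_self mult.right_neutral order_trans)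
  show "h \<in> vecs E" by (rule solid_vecs[OF scale_vecs[OF one_vecs, of K] assms(1) le])
  show "nrm E h \<le> \<bar>K\<bar> * nrm E (\<lambda>_. 1)"
    using nrm_mono[OF scale_vecs[OF one_vecs, of K] assms(1) le] nrm_scale[OF one_vecs, of K] by simp
qed

lemma indicator_vecs: "A \<in> sets leb01 \<Longrightarrow> (indicator A :: real \<Rightarrow> real) \<in> vecs E"
  by (rule bounded_vecs[of _ 1]) (auto simp: indicator_def)

lemma dual_bound:
  assumes "\<phi> \<in> vecs (banach_dual E)"
  obtains C where "0 \<le> C" "\<And>f. f \<in> vecs E \<Longrightarrow> \<bar>\<phi> f\<bar> \<le> C * nrm E f"
proof -
  obtain C where C: "\<And>f. f \<in> vecs E \<Longrightarrow> \<bar>\<phi> f\<bar> \<le> C * nrm E f"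
    by (rule banach_dual_bounded[OF assms]) blast
  have "\<bar>\<phi> f\<bar> \<le> \<bar>C\<bar> * nrm E f" if "f \<in> vecs E" for f
    using C[OF that] mult_right_mono[OF abs_ge_self[of C] nrm_nonneg[OF that]] by linarith
  then show ?thesis by (intro that[of "\<bar>C\<bar>"]) auto
qed

lemma dual_uminus:
  assumes "\<phi> \<in> vecs (banach_dual E)"
  shows "(\<lambda>f. - \<phi> f) \<in> vecs (banach_dual E)"
proof -
  obtain C where C: "\<And>f. f \<in> vecs E \<Longrightarrow> \<bar>\<phi> f\<bar> \<le> C * nrm E f"
    by (rule banach_dual_bounded[OF assms]) blast
  show ?thesis
    by (rule banach_dualI[where C=C])
       (auto simp: banach_dual_outside[OF assms] banach_dual_add[OF assms] banach_dual_scale[OF assms] C)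
qed

lemma dual_diff:
  assumes "\<phi> \<in> vecs (banach_dual E)" "f \<in> vecs E" "g \<in> vecs E"
  shows "\<phi> (\<lambda>t. f t - g t) = \<phi> f - \<phi> g"
  using banach_dual_add[OF assms(1,2) scale_vecs[OF assms(3), of "-1"]] banach_dual_scale[OF assms(1,3), of "-1"]
  by simp

lemma diff_vecs:
  assumes "f \<in> vecs E" "g \<in> vecs E"
  shows "(\<lambda>t. f t - g t) \<in> vecs E"
  using add_vecs[OF assms(1) scale_vecs[OF assms(2), of "-1"]] by simp

lemma dual_order_continuous:
  assumes "\<phi> \<in> vecs (banach_dual E)" and f: "f \<in> vecs E" and A: "\<And>n. A n \<in> sets leb01" "decseq A" "(\<Inter>n. A n) = {}"
  shows "(\<lambda>n. \<phi> (\<lambda>t. f t * indicator (A n) t)) \<longlonglongrightarrow> 0"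
proof -
  obtain C where C: "0 \<le> C" "\<And>f. f \<in> vecs E \<Longrightarrow> \<bar>\<phi> f\<bar> \<le> C * nrm E f"
    by (rule dual_bound[OF assms(1)]) blast
  have v: "(\<lambda>t. f t * indicator (A n) t) \<in> vecs E" for n
    using measurable_vecs[OF f] A(1)[of n]
    by (intro solid_vecs[OF f]) (auto simp: indicator_def)
  show ?thesis
  proof (rule Lim_null_comparison)
    show "\<forall>\<^sub>F n in sequentially. norm (\<phi> (\<lambda>t. f t * indicator (A n) t)) \<le> C * nrm E (\<lambda>t. f t * indicator (A n) t)"
      using C(2)[OF v] by simp
    show "(\<lambda>n. C * nrm E (\<lambda>t. f t * indicator (A n) t)) \<longlonglongrightarrow> 0"
      using tendsto_mult_left[OF order_continuous[OF f A], of C] by simp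
  qed
qed

text \<open>The positive part of the signed measure \<open>A \<mapsto> \<phi> (indicator A)\<close> in its Jordan decomposition.\<close>

definition upper_variation :: "((real \<Rightarrow> real) \<Rightarrow> real) \<Rightarrow> real set \<Rightarrow> real" where
  "upper_variation \<phi> A = (SUP B\<in>{B \<in> sets leb01. B \<subseteq> A}. \<phi> (indicator B))"

lemma dual_indicator_bounded:
  assumes "\<phi> \<in> vecs (banach_dual E)"
  obtains K where "\<And>B. B \<in> sets leb01 \<Longrightarrow> \<bar>\<phi> (indicator B)\<bar> \<le> K"
proof -
  obtain C where C: "0 \<le> C" "\<And>f. f \<in> vecs E \<Longrightarrow> \<bar>\<phi> f\<bar> \<le> C * nrm E f"
    by (rule dual_bound[OF assms(1)]) blast
  have "\<bar>\<phi> (indicator B)\<bar> \<le> C * nrm E (\<lambda>_. 1)" if B: "B \<in> sets leb01" for B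
  proof -
    have "nrm E (indicator B) \<le> \<bar>1\<bar> * nrm E (\<lambda>_. 1)"
      using B by (intro bounded_vecs(2)) (auto simp: indicator_def)
    then show ?thesis
      using C(2)[OF indicator_vecs[OF B]] mult_left_mono[OF _ C(1), of "nrm E (indicator B)" "nrm E (\<lambda>_. 1)"] by simp
  qed
  then show ?thesis by (rule that)
qed

lemma upper_variation_ge:
  assumes "\<phi> \<in> vecs (banach_dual E)" "B \<in> sets leb01" "B \<subseteq> A"
  shows "\<phi> (indicator B) \<le> upper_variation \<phi> A"
proof -
  obtain K where "\<And>B. B \<in> sets leb01 \<Longrightarrow> \<bar>\<phi> (indicator B)\<bar> \<le> K"
    by (rule dual_indicator_bounded[OF assms(1)]) blast
  then have "bdd_above ((\<lambda>B. \<phi> (indicator B)) ` {B \<in> sets leb01. B \<subseteq> A})"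
    by (intro bdd_aboveI[of _ K]) (auto dest: abs_le_D1)
  then show ?thesis unfolding upper_variation_def using assms by (intro cSUP_upper) auto
qed

lemma upper_variation_least:
  assumes "\<And>B. B \<in> sets leb01 \<Longrightarrow> B \<subseteq> A \<Longrightarrow> \<phi> (indicator B) \<le> c"
  shows "upper_variation \<phi> A \<le> c"
  unfolding upper_variation_def by (rule cSUP_least) (use assms in auto)

lemma dual_indicator_Un:
  assumes "\<phi> \<in> vecs (banach_dual E)" "A \<in> sets leb01" "B \<in> sets leb01" "A \<inter> B = {}"
  shows "\<phi> (indicator (A \<union> B)) = \<phi> (indicator A) + \<phi> (indicator B)"
proof -
  have "(indicator (A \<union> B) :: real \<Rightarrow> real) = (\<lambda>t. indicator A t + indicator B t)"
    using assms(4) by (auto simp: indicator_def fun_eq_iff)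
  then show ?thesis using banach_dual_add[OF assms(1) indicator_vecs indicator_vecs] assms by simp
qed

lemma dual_zero:
  assumes "\<phi> \<in> vecs (banach_dual E)"
  shows "\<phi> (\<lambda>_. 0) = 0"
  using banach_dual_scale[OF assms one_vecs, of 0] by simp

lemma dual_indicator_empty:
  assumes "\<phi> \<in> vecs (banach_dual E)"
  shows "\<phi> (indicator {}) = 0"
proof -
  have "(indicator {} :: real \<Rightarrow> real) = (\<lambda>_. 0)" by (simp add: fun_eq_iff)
  then show ?thesis using dual_zero[OF assms] by (simp only:)
qed

lemma upper_variation_nonneg:
  assumes "\<phi> \<in> vecs (banach_dual E)"
  shows "0 \<le> upper_variation \<phi> A"
  using upper_variation_ge[OF assms, of "{}" A] dual_indicator_empty[OF assms] by simp

text \<open>Order continuity enters here: it turns finite into countable additivity.\<close>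

lemma dual_indicator_sums:
  assumes \<phi>: "\<phi> \<in> vecs (banach_dual E)" and A: "range A \<subseteq> sets leb01" "disjoint_family A"
  shows "(\<lambda>i. \<phi> (indicator (A i))) sums \<phi> (indicator (\<Union>i. A i))"
proof -
  let ?U = "\<Union>i. A i"
  have Am: "A i \<in> sets leb01" for i using A by auto
  then have U: "?U \<in> sets leb01" by auto
  define R where "R n = ?U - (\<Union>i<n. A i)" for n
  have fin: "\<phi> (indicator (\<Union>i<n. A i)) = (\<Sum>i<n. \<phi> (indicator (A i)))" for n
  proof (induction n)
    case 0
    then show ?case using dual_zero[OF \<phi>] by simp
  next
    case (Suc n)
    have "(\<Union>i<n. A i) \<inter> A n = {}"
      using A(2) by (auto simp: disjoint_family_on_def) (metis IntI empty_iff less_irrefl)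
    then have "\<phi> (indicator ((\<Union>i<n. A i) \<union> A n)) = \<phi> (indicator (\<Union>i<n. A i)) + \<phi> (indicator (A n))"
      using Am by (intro dual_indicator_Un[OF \<phi>]) auto
    moreover have "(\<Union>i<Suc n. A i) = (\<Union>i<n. A i) \<union> A n" by (auto simp: lessThan_Suc)
    ultimately show ?case using Suc by simp
  qed
  have Rm: "R n \<in> sets leb01" for n unfolding R_def using U Am by auto
  have "(\<lambda>n. \<phi> (\<lambda>t. 1 * indicator (R n) t)) \<longlonglongrightarrow> 0"
  proof (rule dual_order_continuous[OF \<phi> one_vecs Rm])
    show "decseq R" unfolding decseq_def R_def by auto
    show "(\<Inter>n. R n) = {}" unfolding R_def by auto
  qed
  then have R0: "(\<lambda>n. \<phi> (indicator (R n))) \<longlonglongrightarrow> 0" by simp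
  have "\<phi> (indicator ?U) - \<phi> (indicator (R n)) = (\<Sum>i<n. \<phi> (indicator (A i)))" for n
  proof -
    have "(\<Union>i<n. A i) \<union> R n = ?U" "(\<Union>i<n. A i) \<inter> R n = {}" unfolding R_def by auto
    then show ?thesis using dual_indicator_Un[OF \<phi>, of "\<Union>i<n. A i" "R n"] Rm Am fin[of n] by auto
  qed
  then show ?thesis
    using tendsto_diff[OF tendsto_const[of "\<phi> (indicator ?U)"] R0] by (simp add: sums_def)
qed

lemma upper_variation_mono:
  assumes "\<phi> \<in> vecs (banach_dual E)" "A \<subseteq> B"
  shows "upper_variation \<phi> A \<le> upper_variation \<phi> B"
  by (rule upper_variation_least) (use assms upper_variation_ge in blast)

lemma upper_variation_Un:
  assumes \<phi>: "\<phi> \<in> vecs (banach_dual E)" and disj: "A \<inter> B = {}"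
  shows "upper_variation \<phi> A + upper_variation \<phi> B \<le> upper_variation \<phi> (A \<union> B)"
proof -
  have "upper_variation \<phi> A \<le> upper_variation \<phi> (A \<union> B) - upper_variation \<phi> B"
  proof (rule upper_variation_least)
    fix A' assume A': "A' \<in> sets leb01" "A' \<subseteq> A"
    have "upper_variation \<phi> B \<le> upper_variation \<phi> (A \<union> B) - \<phi> (indicator A')"
    proof (rule upper_variation_least)
      fix B' assume B': "B' \<in> sets leb01" "B' \<subseteq> B"
      have "\<phi> (indicator (A' \<union> B')) \<le> upper_variation \<phi> (A \<union> B)"
        using A' B' by (intro upper_variation_ge[OF \<phi>]) auto
      moreover have "A' \<inter> B' = {}" using A' B' disj by blast
      ultimately show "\<phi> (indicator B') \<le> upper_variation \<phi> (A \<union> B) - \<phi> (indicator A')"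
        using dual_indicator_Un[OF \<phi> A'(1) B'(1)] by simp
    qed
    then show "\<phi> (indicator A') \<le> upper_variation \<phi> (A \<union> B) - upper_variation \<phi> B" by simp
  qed
  then show ?thesis by simp
qed

lemma upper_variation_countably_additive:
  assumes \<phi>: "\<phi> \<in> vecs (banach_dual E)"
  shows "countably_additive (sets leb01) (\<lambda>A. ennreal (upper_variation \<phi> A))"
proof (rule countably_additiveI)
  fix A :: "nat \<Rightarrow> real set" assume A: "range A \<subseteq> sets leb01" "disjoint_family A"
  let ?U = "\<Union>i. A i"
  have fin: "(\<Sum>i<n. upper_variation \<phi> (A i)) \<le> upper_variation \<phi> (\<Union>i<n. A i)" for n
  proof (induction n)
    case 0
    then show ?case using upper_variation_nonneg[OF \<phi>] by simp
  next
    case (Suc n)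
    have "(\<Union>i<n. A i) \<inter> A n = {}"
      using A(2) by (auto simp: disjoint_family_on_def) (metis IntI empty_iff less_irrefl)
    then have "upper_variation \<phi> (\<Union>i<n. A i) + upper_variation \<phi> (A n) \<le> upper_variation \<phi> ((\<Union>i<n. A i) \<union> A n)"
      by (rule upper_variation_Un[OF \<phi>])
    moreover have "(\<Union>i<Suc n. A i) = (\<Union>i<n. A i) \<union> A n" by (auto simp: lessThan_Suc)
    ultimately show ?case using Suc by simp
  qed
  have le: "(\<Sum>i<n. upper_variation \<phi> (A i)) \<le> upper_variation \<phi> ?U" for n
    by (rule order_trans[OF fin upper_variation_mono[OF \<phi>]]) auto
  have summ: "summable (\<lambda>i. upper_variation \<phi> (A i))"
    by (rule summableI_nonneg_bounded[OF upper_variation_nonneg[OF \<phi>] le])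
  have "(\<Sum>i. upper_variation \<phi> (A i)) = upper_variation \<phi> ?U"
  proof (rule antisym)
    show "(\<Sum>i. upper_variation \<phi> (A i)) \<le> upper_variation \<phi> ?U"
      by (rule suminf_le_const[OF summ le])
    show "upper_variation \<phi> ?U \<le> (\<Sum>i. upper_variation \<phi> (A i))"
    proof (rule upper_variation_least)
      fix B assume B: "B \<in> sets leb01" "B \<subseteq> ?U"
      have "(\<lambda>i. \<phi> (indicator (B \<inter> A i))) sums \<phi> (indicator (\<Union>i. B \<inter> A i))"
        using A B by (intro dual_indicator_sums[OF \<phi>]) (auto simp: disjoint_family_on_def)
      moreover have "(\<Union>i. B \<inter> A i) = B" using B by auto
      ultimately have s: "(\<lambda>i. \<phi> (indicator (B \<inter> A i))) sums \<phi> (indicator B)" by simp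
      have "\<phi> (indicator (B \<inter> A i)) \<le> upper_variation \<phi> (A i)" for i
        using A B by (intro upper_variation_ge[OF \<phi>]) auto
      then show "\<phi> (indicator B) \<le> (\<Sum>i. upper_variation \<phi> (A i))"
        using sums_le[OF _ s summable_sums[OF summ]] by blast
    qed
  qed
  then show "(\<Sum>i. ennreal (upper_variation \<phi> (A i))) = ennreal (upper_variation \<phi> ?U)"
    using suminf_ennreal2[OF upper_variation_nonneg[OF \<phi>] summ] by simp
qed

lemma upper_variation_density:
  assumes \<phi>: "\<phi> \<in> vecs (banach_dual E)"
  obtains h where "integrable leb01 h"
    "\<And>A. A \<in> sets leb01 \<Longrightarrow> (\<integral>t. h t * indicator A t \<partial>leb01) = upper_variation \<phi> A"
proof -
  interpret L: finite_measure leb01 by (rule finite_measure_leb01)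
  define \<mu> where "\<mu> = measure_of (space leb01) (sets leb01) (\<lambda>A. ennreal (upper_variation \<phi> A))"
  have sp: "sets \<mu> = sets leb01" unfolding \<mu>_def by (rule sets.sets_measure_of_eq)
  have uv_empty: "upper_variation \<phi> {} = 0"
  proof (rule antisym)
    show "upper_variation \<phi> {} \<le> 0"
      by (rule upper_variation_least) (simp add: dual_indicator_empty[OF \<phi>])
  qed (rule upper_variation_nonneg[OF \<phi>])
  have em: "emeasure \<mu> A = ennreal (upper_variation \<phi> A)" if "A \<in> sets leb01" for A
    unfolding \<mu>_def
    by (rule emeasure_measure_of_sigma[OF sets.sigma_algebra_axioms _ upper_variation_countably_additive[OF \<phi>] that])
       (simp add: positive_def uv_empty)
  have "absolutely_continuous leb01 \<mu>"
    unfolding absolutely_continuous_def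
  proof
    fix A assume "A \<in> null_sets leb01"
    then have A: "A \<in> sets leb01" "AE t in leb01. t \<notin> A" by (auto intro: AE_not_in)
    have "upper_variation \<phi> A \<le> 0"
    proof (rule upper_variation_least)
      fix B assume B: "B \<in> sets leb01" "B \<subseteq> A"
      obtain C where C: "0 \<le> C" "\<And>f. f \<in> vecs E \<Longrightarrow> \<bar>\<phi> f\<bar> \<le> C * nrm E f"
        by (rule dual_bound[OF \<phi>]) blast
      have "nrm E (indicator B) \<le> nrm E (\<lambda>t. 0 * 1)"
      proof (rule nrm_mono[OF scale_vecs[OF one_vecs]])
        show "AE t in leb01. \<bar>indicator B t\<bar> \<le> \<bar>0 * 1 :: real\<bar>"
          using A(2) by eventually_elim (use B in \<open>auto simp: indicator_def\<close>)
      qed (use B in auto)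
      also have "\<dots> = 0" using nrm_scale[OF one_vecs, of 0] by simp
      finally have "C * nrm E (indicator B) \<le> 0" using C(1) by (simp add: mult_nonneg_nonpos)
      then show "\<phi> (indicator B) \<le> 0" using C(2)[OF indicator_vecs[OF B(1)]] by linarith
    qed
    then have "emeasure \<mu> A = 0" using em[OF A(1)] by (simp add: ennreal_eq_0_iff)
    then show "A \<in> null_sets \<mu>" using A(1) sp by auto
  qed
  then obtain d where d: "d \<in> borel_measurable leb01" "density leb01 d = \<mu>"
    using L.Radon_Nikodym[OF _ sp] by blast
  have int_d: "(\<integral>\<^sup>+t. d t * indicator A t \<partial>leb01) = ennreal (upper_variation \<phi> A)" if "A \<in> sets leb01" for A
    using em[OF that] emeasure_density[OF d(1) that] d(2) by simp
  have "(\<integral>\<^sup>+t. d t \<partial>leb01) = (\<integral>\<^sup>+t. d t * indicator (space leb01) t \<partial>leb01)"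
    by (rule nn_integral_cong) simp
  also have "\<dots> = ennreal (upper_variation \<phi> (space leb01))" by (rule int_d[OF sets.top])
  finally have "(\<integral>\<^sup>+t. d t \<partial>leb01) \<noteq> \<infinity>" by simp
  then have "AE t in leb01. d t \<noteq> \<infinity>" by (rule nn_integral_noteq_infinite[OF d(1)])
  then have d_eq: "AE t in leb01. d t = ennreal (enn2real (d t))"
    by eventually_elim (simp add: less_top)
  have hm: "(\<lambda>t. enn2real (d t)) \<in> borel_measurable leb01" using d(1) by measurable
  have hA: "(\<integral>\<^sup>+t. ennreal (enn2real (d t) * indicator A t) \<partial>leb01) = ennreal (upper_variation \<phi> A)"
    if A: "A \<in> sets leb01" for A
  proof -
    have "(\<integral>\<^sup>+t. ennreal (enn2real (d t) * indicator A t) \<partial>leb01) = (\<integral>\<^sup>+t. d t * indicator A t \<partial>leb01)"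
      using d_eq by (intro nn_integral_cong_AE) (auto elim!: eventually_mono simp: indicator_def)
    then show ?thesis using int_d[OF A] by simp
  qed
  have intA: "has_bochner_integral leb01 (\<lambda>t. enn2real (d t) * indicator A t) (upper_variation \<phi> A)"
    if A: "A \<in> sets leb01" for A
    using hA[OF A] hm A upper_variation_nonneg[OF \<phi>]
    by (intro has_bochner_integral_nn_integral) auto
  have "integrable leb01 (\<lambda>t. enn2real (d t) * indicator (space leb01) t)"
    using intA[OF sets.top] by (rule integrable.intros)
  moreover have "integrable leb01 (\<lambda>t. enn2real (d t) * indicator (space leb01) t) \<longleftrightarrow> integrable leb01 (\<lambda>t. enn2real (d t))"
    by (rule Bochner_Integration.integrable_cong) auto
  ultimately show ?thesis
    using intA by (intro that[of "\<lambda>t. enn2real (d t)"]) (auto dest: has_bochner_integral_integral_eq)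
qed

text \<open>The positive parts of \<open>\<phi>\<close> and \<open>-\<phi>\<close> have densities; their difference represents \<open>\<phi>\<close> since passing
  from \<open>B \<subseteq> A\<close> to \<open>A - B\<close> exchanges the two suprema up to the value \<open>\<phi> (indicator A)\<close>.\<close>

lemma dual_indicator_density:
  assumes \<phi>: "\<phi> \<in> vecs (banach_dual E)"
  obtains g where "integrable leb01 g"
    "\<And>A. A \<in> sets leb01 \<Longrightarrow> \<phi> (indicator A) = (\<integral>t. indicator A t * g t \<partial>leb01)"
proof -
  have le: "upper_variation (\<lambda>f. - \<psi> f) A \<le> upper_variation \<psi> A - \<psi> (indicator A)"
    if \<psi>: "\<psi> \<in> vecs (banach_dual E)" and A: "A \<in> sets leb01" for \<psi> A
  proof (rule upper_variation_least)
    fix B assume B: "B \<in> sets leb01" "B \<subseteq> A"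
    then have "\<psi> (indicator A) = \<psi> (indicator B) + \<psi> (indicator (A - B))"
      using dual_indicator_Un[OF \<psi>, of B "A - B"] A by (auto simp: Un_absorb1)
    moreover have "\<psi> (indicator (A - B)) \<le> upper_variation \<psi> A"
      using A B by (intro upper_variation_ge[OF \<psi>]) auto
    ultimately show "- \<psi> (indicator B) \<le> upper_variation \<psi> A - \<psi> (indicator A)" by simp
  qed
  have eq: "upper_variation \<phi> A - upper_variation (\<lambda>f. - \<phi> f) A = \<phi> (indicator A)" if A: "A \<in> sets leb01" for A
    using le[OF \<phi> A] le[OF dual_uminus[OF \<phi>] A] by simp
  obtain h1 where h1: "integrable leb01 h1"
    "\<And>A. A \<in> sets leb01 \<Longrightarrow> (\<integral>t. h1 t * indicator A t \<partial>leb01) = upper_variation \<phi> A"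
    by (rule upper_variation_density[OF \<phi>]) blast
  obtain h2 where h2: "integrable leb01 h2"
    "\<And>A. A \<in> sets leb01 \<Longrightarrow> (\<integral>t. h2 t * indicator A t \<partial>leb01) = upper_variation (\<lambda>f. - \<phi> f) A"
    by (rule upper_variation_density[OF dual_uminus[OF \<phi>]]) blast
  show ?thesis
  proof (rule that[of "\<lambda>t. h1 t - h2 t"])
    show "integrable leb01 (\<lambda>t. h1 t - h2 t)" using h1 h2 by simp
    fix A assume A: "A \<in> sets leb01"
    have "(\<integral>t. indicator A t * (h1 t - h2 t) \<partial>leb01) = (\<integral>t. h1 t * indicator A t - h2 t * indicator A t \<partial>leb01)"
      by (simp add: algebra_simps)
    also have "\<dots> = (\<integral>t. h1 t * indicator A t \<partial>leb01) - (\<integral>t. h2 t * indicator A t \<partial>leb01)"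
      using h1(1) h2(1) A by (intro Bochner_Integration.integral_diff integrable_real_mult_indicator)
    also have "\<dots> = \<phi> (indicator A)" using h1(2)[OF A] h2(2)[OF A] eq[OF A] by simp
    finally show "\<phi> (indicator A) = (\<integral>t. indicator A t * (h1 t - h2 t) \<partial>leb01)" by simp
  qed
qed

lemma dual_sum:
  assumes \<phi>: "\<phi> \<in> vecs (banach_dual E)" and "finite S" and f: "\<And>s. s \<in> S \<Longrightarrow> f s \<in> vecs E"
  shows "(\<lambda>t. \<Sum>s\<in>S. c s * f s t) \<in> vecs E \<and> \<phi> (\<lambda>t. \<Sum>s\<in>S. c s * f s t) = (\<Sum>s\<in>S. c s * \<phi> (f s))"
  using assms(2) f
proof (induction S rule: finite_induct)
  case empty
  then show ?case using scale_vecs[OF one_vecs, of 0] banach_dual_scale[OF \<phi> one_vecs, of 0] by simp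
next
  case (insert s S)
  then have "(\<lambda>t. \<Sum>s\<in>S. c s * f s t) \<in> vecs E" "\<phi> (\<lambda>t. \<Sum>s\<in>S. c s * f s t) = (\<Sum>s\<in>S. c s * \<phi> (f s))"
    "(\<lambda>t. c s * f s t) \<in> vecs E" "\<phi> (\<lambda>t. c s * f s t) = c s * \<phi> (f s)"
    using scale_vecs banach_dual_scale[OF \<phi>] by auto
  then show ?case using insert(1,2) add_vecs banach_dual_add[OF \<phi>] by simp
qed

text \<open>Bounded functions are uniform limits of step functions \<open>\<lfloor>n * h\<rfloor> / n\<close>, and uniform convergence is
  stronger than convergence in norm, because constants belong to the lattice.\<close>

lemma dual_bounded_function:
  assumes \<phi>: "\<phi> \<in> vecs (banach_dual E)" and g: "integrable leb01 g"
    and ind: "\<And>A. A \<in> sets leb01 \<Longrightarrow> \<phi> (indicator A) = (\<integral>t. indicator A t * g t \<partial>leb01)"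
    and h: "h \<in> borel_measurable leb01" and K: "\<And>t. \<bar>h t\<bar> \<le> K"
  shows "integrable leb01 (\<lambda>t. h t * g t) \<and> \<phi> h = (\<integral>t. h t * g t \<partial>leb01)"
proof -
  have bint: "integrable leb01 (\<lambda>t. k t * g t)" if "k \<in> borel_measurable leb01" "\<And>t. \<bar>k t\<bar> \<le> K'" for k K'
  proof (rule Bochner_Integration.integrable_bound[where f="\<lambda>t. K' * g t"])
    have "\<bar>k t * g t\<bar> \<le> \<bar>K' * g t\<bar>" for t
      unfolding abs_mult using that(2)[of t] by (intro mult_right_mono) auto
    then show "AE t in leb01. norm (k t * g t) \<le> norm (K' * g t)" by simp
  qed (use g that(1) in auto)
  obtain C where C: "0 \<le> C" "\<And>f. f \<in> vecs E \<Longrightarrow> \<bar>\<phi> f\<bar> \<le> C * nrm E f"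
    by (rule dual_bound[OF \<phi>]) blast
  \<comment> \<open>Both the functional and the integral change by at most \<open>D / n\<close> in total when \<open>h\<close> is replaced by its step function.\<close>
  define D where "D = C * nrm E (\<lambda>_. 1) + (\<integral>t. \<bar>g t\<bar> \<partial>leb01)"
  have key: "\<bar>\<phi> h - (\<integral>t. h t * g t \<partial>leb01)\<bar> \<le> D / real n" if n: "0 < n" for n :: nat
  proof -
    define hn where "hn t = of_int \<lfloor>real n * h t\<rfloor> / real n" for t
    define S where "S = {\<lfloor>- (real n * K)\<rfloor>..\<lfloor>real n * K\<rfloor>}"
    define Q where "Q j = {t \<in> space leb01. \<lfloor>real n * h t\<rfloor> = j}" for j
    have Qm: "Q j \<in> sets leb01" for j unfolding Q_def using h by measurable
    have diff: "\<bar>h t - hn t\<bar> \<le> 1 / real n" for t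
    proof -
      have "0 \<le> real n * h t - of_int \<lfloor>real n * h t\<rfloor>" "real n * h t - of_int \<lfloor>real n * h t\<rfloor> \<le> 1" by linarith+
      moreover have "h t - hn t = (real n * h t - of_int \<lfloor>real n * h t\<rfloor>) / real n"
        using n by (simp add: hn_def field_simps)
      ultimately show ?thesis using n by (simp add: divide_right_mono)
    qed
    have "\<lfloor>real n * h t\<rfloor> \<in> S" for t
    proof -
      have "\<bar>real n * h t\<bar> \<le> real n * K" unfolding abs_mult using K[of t] by (simp add: mult_left_mono)
      then have "- (real n * K) \<le> real n * h t" "real n * h t \<le> real n * K" by linarith+
      then show ?thesis unfolding S_def by (auto intro: floor_mono)
    qed
    then have hn_eq: "hn t = (\<Sum>j\<in>S. (of_int j / real n) * indicator (Q j) t)" if "t \<in> space leb01" for t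
      using that unfolding S_def
      by (subst sum.remove[of _ "\<lfloor>real n * h t\<rfloor>"]) (auto simp: hn_def Q_def indicator_def)
    define hs where "hs t = (\<Sum>j\<in>S. (of_int j / real n) * indicator (Q j) t)" for t
    have fS: "finite S" by (simp add: S_def)
    have hs: "hs \<in> vecs E" "\<phi> hs = (\<Sum>j\<in>S. (of_int j / real n) * \<phi> (indicator (Q j)))"
      using dual_sum[OF \<phi> fS, of "\<lambda>j. indicator (Q j)" "\<lambda>j. of_int j / real n"] indicator_vecs[OF Qm]
      unfolding hs_def by blast+
    have "(\<integral>t. hs t * g t \<partial>leb01) = (\<integral>t. (\<Sum>j\<in>S. (of_int j / real n) * (indicator (Q j) t * g t)) \<partial>leb01)"
      by (simp add: hs_def sum_distrib_right mult.assoc)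
    also have "\<dots> = (\<Sum>j\<in>S. \<integral>t. (of_int j / real n) * (indicator (Q j) t * g t) \<partial>leb01)"
      using Qm by (intro Bochner_Integration.integral_sum integrable_mult_right bint[of _ 1]) (auto simp: indicator_def)
    also have "\<dots> = \<phi> hs" unfolding hs(2) ind[OF Qm] by simp
    finally have hs_int: "\<phi> hs = (\<integral>t. hs t * g t \<partial>leb01)" by simp
    have hv: "h \<in> vecs E" by (rule bounded_vecs(1)[OF h K])
    have dAE: "AE t in leb01. \<bar>h t - hs t\<bar> \<le> \<bar>1 / real n * 1\<bar>"
    proof (rule AE_I2)
      fix t assume t: "t \<in> space leb01"
      have "hs t = hn t" unfolding hs_def hn_eq[OF t] by (rule refl)
      then show "\<bar>h t - hs t\<bar> \<le> \<bar>1 / real n * 1\<bar>" using diff[of t] by simp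
    qed
    have "nrm E (\<lambda>t. h t - hs t) \<le> nrm E (\<lambda>t. 1 / real n * 1)"
      by (rule nrm_mono[OF scale_vecs[OF one_vecs] measurable_vecs[OF diff_vecs[OF hv hs(1)]] dAE])
    then have "nrm E (\<lambda>t. h t - hs t) \<le> (1 / real n) * nrm E (\<lambda>_. 1)"
      using nrm_scale[OF one_vecs, of "1 / real n"] by simp
    then have "C * nrm E (\<lambda>t. h t - hs t) \<le> C * ((1 / real n) * nrm E (\<lambda>_. 1))"
      using C(1) by (rule mult_left_mono)
    then have 1: "\<bar>\<phi> h - \<phi> hs\<bar> \<le> C * nrm E (\<lambda>_. 1) / real n"
      using C(2)[OF diff_vecs[OF hv hs(1)]] dual_diff[OF \<phi> hv hs(1)] by simp
    have hsb: "integrable leb01 (\<lambda>t. hs t * g t)"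
    proof -
      have "integrable leb01 (\<lambda>t. \<Sum>j\<in>S. (of_int j / real n) * (indicator (Q j) t * g t))"
        using Qm by (intro Bochner_Integration.integrable_sum integrable_mult_right bint[of _ 1]) (auto simp: indicator_def)
      then show ?thesis by (simp add: hs_def sum_distrib_right mult.assoc)
    qed
    have "(\<integral>t. h t * g t \<partial>leb01) - (\<integral>t. hs t * g t \<partial>leb01) = (\<integral>t. h t * g t - hs t * g t \<partial>leb01)"
      by (rule Bochner_Integration.integral_diff[OF bint[OF h K] hsb, symmetric])
    also have "\<bar>\<dots>\<bar> \<le> (\<integral>t. \<bar>h t * g t - hs t * g t\<bar> \<partial>leb01)" by (rule integral_abs_bound)
    also have "\<dots> \<le> (\<integral>t. (1 / real n) * \<bar>g t\<bar> \<partial>leb01)"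
    proof (rule integral_mono_AE)
      show "AE t in leb01. \<bar>h t * g t - hs t * g t\<bar> \<le> (1 / real n) * \<bar>g t\<bar>"
        using dAE
      proof eventually_elim
        case (elim t)
        have "\<bar>h t * g t - hs t * g t\<bar> = \<bar>h t - hs t\<bar> * \<bar>g t\<bar>"
          by (simp add: abs_mult[symmetric] left_diff_distrib)
        also have "\<dots> \<le> (1 / real n) * \<bar>g t\<bar>" using elim by (intro mult_right_mono) auto
        finally show ?case .
      qed
    qed (use bint[OF h K] hsb g in auto)
    also have "\<dots> = (\<integral>t. \<bar>g t\<bar> \<partial>leb01) / real n" by simp
    finally have "\<bar>(\<integral>t. h t * g t \<partial>leb01) - (\<integral>t. hs t * g t \<partial>leb01)\<bar> \<le> (\<integral>t. \<bar>g t\<bar> \<partial>leb01) / real n" .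
    moreover have "D / real n = C * nrm E (\<lambda>_. 1) / real n + (\<integral>t. \<bar>g t\<bar> \<partial>leb01) / real n"
      by (simp add: D_def add_divide_distrib)
    ultimately show ?thesis using 1 hs_int by linarith
  qed
  have "(\<lambda>n. D / real n) \<longlonglongrightarrow> 0" by (rule lim_const_over_n)
  then have "\<bar>\<phi> h - (\<integral>t. h t * g t \<partial>leb01)\<bar> \<le> 0"
    by (rule tendsto_lowerbound) (use key in \<open>auto intro!: eventually_sequentiallyI[of 1]\<close>)
  then show ?thesis using bint[OF h K] by simp
qed

text \<open>Truncations of \<open>f\<close> converge in norm by order continuity. The integral bound, which puts \<open>g\<close> into
  the Koethe dual, comes from applying \<open>\<phi>\<close> to \<open>\<bar>f\<bar> * sgn g\<close>.\<close>

lemma dual_representation: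
  assumes \<phi>: "\<phi> \<in> vecs (banach_dual E)"
  obtains g C where "g \<in> borel_measurable leb01" "0 \<le> C"
    "\<And>f. f \<in> vecs E \<Longrightarrow> (\<integral>\<^sup>+t. ennreal \<bar>g t * f t\<bar> \<partial>leb01) \<le> ennreal (C * nrm E f)"
    "\<And>f. f \<in> vecs E \<Longrightarrow> \<phi> f = (\<integral>t. f t * g t \<partial>leb01)"
proof -
  obtain g where g: "integrable leb01 g"
    "\<And>A. A \<in> sets leb01 \<Longrightarrow> \<phi> (indicator A) = (\<integral>t. indicator A t * g t \<partial>leb01)"
    by (rule dual_indicator_density[OF \<phi>]) blast
  have gm: "g \<in> borel_measurable leb01" using g(1) by auto
  obtain C where C: "0 \<le> C" "\<And>f. f \<in> vecs E \<Longrightarrow> \<bar>\<phi> f\<bar> \<le> C * nrm E f"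
    by (rule dual_bound[OF \<phi>]) blast
  define T where "T f n = {t \<in> space leb01. real n < \<bar>f t\<bar>}" for f :: "real \<Rightarrow> real" and n
  define tr where "tr f n t = (if real n < \<bar>f t\<bar> then 0 else f t)" for f :: "real \<Rightarrow> real" and n t
  have trm: "tr f n \<in> borel_measurable leb01" if "f \<in> borel_measurable leb01" for f n
    unfolding tr_def using that by measurable
  have trb: "\<bar>tr f n t\<bar> \<le> real n" for f n t by (auto simp: tr_def)
  have tr_lim: "(\<lambda>n. tr f n t) \<longlonglongrightarrow> f t" for f t
  proof (rule tendsto_eventually)
    obtain k where "\<bar>f t\<bar> \<le> real k" using real_arch_simple by blast
    then show "\<forall>\<^sub>F n in sequentially. tr f n t = f t"
      unfolding eventually_sequentially by (intro exI[of _ k]) (auto simp: tr_def)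
  qed
  have tr_rep: "integrable leb01 (\<lambda>t. tr f n t * g t) \<and> \<phi> (tr f n) = (\<integral>t. tr f n t * g t \<partial>leb01)"
    if "f \<in> vecs E" for f n
    using dual_bounded_function[OF \<phi> g trm[OF measurable_vecs[OF that]] trb] .
  have bound: "(\<integral>\<^sup>+t. ennreal \<bar>g t * f t\<bar> \<partial>leb01) \<le> ennreal (C * nrm E f)" if f: "f \<in> vecs E" for f
  proof -
    have fm: "f \<in> borel_measurable leb01" by (rule measurable_vecs[OF f])
    \<comment> \<open>With this choice the integrand \<open>k * g\<close> is nonnegative.\<close>
    define k where "k t = \<bar>f t\<bar> * sgn (g t)" for t
    have km: "k \<in> borel_measurable leb01" unfolding k_def using fm gm by measurable
    have kf: "\<bar>k t\<bar> \<le> \<bar>f t\<bar>" for t by (auto simp: k_def abs_mult sgn_if)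
    have k: "k \<in> vecs E" by (rule solid_vecs[OF f km]) (simp add: kf)
    have kg: "k t * g t = \<bar>g t * f t\<bar>" for t by (simp add: k_def abs_mult sgn_if)
    have trk: "0 \<le> tr k n t * g t" for n t using kg[of t] by (auto simp: tr_def)
    have le: "(\<integral>\<^sup>+t. ennreal (tr k n t * g t) \<partial>leb01) \<le> ennreal (C * nrm E f)" for n
    proof -
      have trv: "tr k n \<in> vecs E" by (rule bounded_vecs(1)[OF trm[OF km] trb])
      have "(\<integral>\<^sup>+t. ennreal (tr k n t * g t) \<partial>leb01) = ennreal (\<phi> (tr k n))"
        using tr_rep[OF k, of n] trk by (simp add: nn_integral_eq_integral)
      also have "\<phi> (tr k n) \<le> C * nrm E (tr k n)" using C(2)[OF trv] by linarith
      also have "\<dots> \<le> C * nrm E f"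
      proof (intro mult_left_mono nrm_mono[OF f trm[OF km]] C(1) AE_I2)
        fix t show "\<bar>tr k n t\<bar> \<le> \<bar>f t\<bar>" using kf[of t] by (auto simp: tr_def)
      qed
      finally show ?thesis by (simp add: ennreal_leI)
    qed
    have "(\<integral>\<^sup>+t. ennreal \<bar>g t * f t\<bar> \<partial>leb01) = (\<integral>\<^sup>+t. liminf (\<lambda>n. ennreal (tr k n t * g t)) \<partial>leb01)"
    proof (rule nn_integral_cong)
      fix t
      have "(\<lambda>n. ennreal (tr k n t * g t)) \<longlonglongrightarrow> ennreal (k t * g t)"
        by (intro tendsto_intros tr_lim)
      then show "ennreal \<bar>g t * f t\<bar> = liminf (\<lambda>n. ennreal (tr k n t * g t))"
        using lim_imp_Liminf[OF sequentially_bot] kg[of t] by force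
    qed
    also have "\<dots> \<le> liminf (\<lambda>n. \<integral>\<^sup>+t. ennreal (tr k n t * g t) \<partial>leb01)"
      using trm[OF km] gm by (intro nn_integral_liminf) auto
    also have "\<dots> \<le> liminf (\<lambda>n. ennreal (C * nrm E f))"
      by (intro Liminf_mono always_eventually allI le)
    also have "\<dots> = ennreal (C * nrm E f)" by (simp add: Liminf_const)
    finally show ?thesis .
  qed
  have rep: "\<phi> f = (\<integral>t. f t * g t \<partial>leb01)" if f: "f \<in> vecs E" for f
  proof -
    have fm: "f \<in> borel_measurable leb01" by (rule measurable_vecs[OF f])
    have fg: "integrable leb01 (\<lambda>t. f t * g t)"
    proof (rule integrableI_bounded)
      have "(\<integral>\<^sup>+t. ennreal (norm (f t * g t)) \<partial>leb01) = (\<integral>\<^sup>+t. ennreal \<bar>g t * f t\<bar> \<partial>leb01)"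
        by (simp add: mult.commute)
      also have "\<dots> < \<infinity>" using bound[OF f] by (rule order_le_less_trans) simp
      finally show "(\<integral>\<^sup>+t. ennreal (norm (f t * g t)) \<partial>leb01) < \<infinity>" .
    qed (use fm gm in auto)
    have "(\<lambda>n. \<integral>t. tr f n t * g t \<partial>leb01) \<longlonglongrightarrow> (\<integral>t. f t * g t \<partial>leb01)"
    proof (rule integral_dominated_convergence[where w="\<lambda>t. \<bar>f t * g t\<bar>"])
      show "AE t in leb01. (\<lambda>n. tr f n t * g t) \<longlonglongrightarrow> f t * g t"
        by (intro AE_I2 tendsto_intros tr_lim)
      show "AE t in leb01. norm (tr f n t * g t) \<le> \<bar>f t * g t\<bar>" for n by (auto simp: tr_def)
    qed (use fm gm trm[OF fm] fg in auto)
    then have lim1: "(\<lambda>n. \<phi> (tr f n)) \<longlonglongrightarrow> (\<integral>t. f t * g t \<partial>leb01)"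
      using tr_rep[OF f] by simp
    have Tm: "T f n \<in> sets leb01" for n unfolding T_def using fm by measurable
    have "(\<lambda>n. \<phi> (\<lambda>t. f t * indicator (T f n) t)) \<longlonglongrightarrow> 0"
    proof (rule dual_order_continuous[OF \<phi> f Tm])
      show "decseq (T f)" unfolding decseq_def T_def by (auto intro: le_less_trans)
      show "(\<Inter>n. T f n) = {}"
      proof (rule equals0I)
        fix t assume "t \<in> (\<Inter>n. T f n)"
        then have "real n < \<bar>f t\<bar>" for n by (auto simp: T_def)
        then show False using real_arch_simple[of "\<bar>f t\<bar>"] by (meson not_le)
      qed
    qed
    moreover have "\<phi> (\<lambda>t. f t * indicator (T f n) t) = \<phi> f - \<phi> (tr f n)" for n
    proof -
      have trv: "tr f n \<in> vecs E" by (rule bounded_vecs(1)[OF trm[OF fm] trb])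
      have iv: "(\<lambda>t. f t * indicator (T f n) t) \<in> vecs E"
        using Tm fm by (intro solid_vecs[OF f]) (auto simp: indicator_def)
      have ae: "AE t in leb01. f t * indicator (T f n) t = f t - tr f n t"
        by (intro AE_I2) (auto simp: T_def tr_def indicator_def)
      have dv: "(\<lambda>t. f t - tr f n t) \<in> vecs E" by (rule diff_vecs[OF f trv])
      have "\<phi> (\<lambda>t. f t * indicator (T f n) t - (f t - tr f n t)) = 0"
      proof -
        have v: "(\<lambda>t. f t * indicator (T f n) t - (f t - tr f n t)) \<in> vecs E"
          by (rule diff_vecs[OF iv dv])
        have "nrm E (\<lambda>t. f t * indicator (T f n) t - (f t - tr f n t)) \<le> nrm E (\<lambda>t. 0 * 1)"
          by (rule nrm_mono[OF scale_vecs[OF one_vecs] measurable_vecs[OF v]])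
             (use ae in \<open>eventually_elim, simp\<close>)
        then have "nrm E (\<lambda>t. f t * indicator (T f n) t - (f t - tr f n t)) \<le> 0"
          using nrm_scale[OF one_vecs, of 0] by simp
        then have "C * nrm E (\<lambda>t. f t * indicator (T f n) t - (f t - tr f n t)) \<le> 0"
          using C(1) by (simp add: mult_nonneg_nonpos)
        then show ?thesis using C(2)[OF v] by linarith
      qed
      then have "\<phi> (\<lambda>t. f t * indicator (T f n) t) = \<phi> (\<lambda>t. f t - tr f n t)"
        using dual_diff[OF \<phi> iv dv] by simp
      then show ?thesis using dual_diff[OF \<phi> f trv] by simp
    qed
    ultimately have "(\<lambda>n. \<phi> f - \<phi> (tr f n)) \<longlonglongrightarrow> 0" by simp
    then have "(\<lambda>n. \<phi> f - (\<phi> f - \<phi> (tr f n))) \<longlonglongrightarrow> \<phi> f - 0" by (intro tendsto_intros)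
    then have "(\<lambda>n. \<phi> (tr f n)) \<longlonglongrightarrow> \<phi> f" by simp
    then show ?thesis using lim1 by (rule LIMSEQ_unique)
  qed
  show ?thesis by (rule that[OF gm C(1) bound rep])
qed

end

section \<open>Order continuity and reflexivity\<close>

lemma powr_abs_sum_disjoint:
  fixes x :: "'i \<Rightarrow> real"
  assumes "finite K" "\<And>i j. i \<in> K \<Longrightarrow> j \<in> K \<Longrightarrow> i \<noteq> j \<Longrightarrow> x i = 0 \<or> x j = 0"
  shows "\<bar>\<Sum>k\<in>K. x k\<bar> powr p = (\<Sum>k\<in>K. \<bar>x k\<bar> powr p)"
proof (cases "\<exists>k\<in>K. x k \<noteq> 0")
  case True
  then obtain k where k: "k \<in> K" "x k \<noteq> 0" by blast
  then have z: "x j = 0" if "j \<in> K - {k}" for j using assms(2)[of j k] that by auto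
  show ?thesis using z by (simp add: sum.remove[OF assms(1) k(1)])
next
  case False
  then show ?thesis by simp
qed

lemma decseq_indicator_integral_tendsto_0:
  assumes u: "u \<in> borel_measurable M" "(\<integral>\<^sup>+t. u t \<partial>M) < \<infinity>"
    and A: "\<And>n. A n \<in> sets M" "decseq A" "(\<Inter>n. A n) = {}"
  shows "(\<lambda>n. \<integral>\<^sup>+t. u t * indicator (A n) t \<partial>M) \<longlonglongrightarrow> 0"
proof -
  have "(\<lambda>n. \<integral>\<^sup>+t. u t * indicator (A n) t \<partial>M) \<longlonglongrightarrow> (\<integral>\<^sup>+t. 0 \<partial>M)"
  proof (rule nn_integral_dominated_convergence[where w=u])
    show "AE t in M. u t * indicator (A n) t \<le> u t" for n by (auto simp: indicator_def)
    show "AE t in M. (\<lambda>n. u t * indicator (A n) t) \<longlonglongrightarrow> 0"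
    proof (rule AE_I2, rule tendsto_eventually)
      fix t
      obtain k where "t \<notin> A k" using A(3) by blast
      then have "t \<notin> A n" if "k \<le> n" for n using A(2) that by (auto simp: decseq_def)
      then show "\<forall>\<^sub>F n in sequentially. u t * indicator (A n) t = 0"
        unfolding eventually_sequentially by (intro exI[of _ k]) simp
    qed
  qed (use u A(1) in auto)
  then show ?thesis by simp
qed

lemma mixed_space_order_continuous:
  assumes p: "1 < p" and f: "f \<in> vecs (mixed_space p)"
    and A: "\<And>n. A n \<in> sets leb01" "decseq A" "(\<Inter>n. A n) = {}"
  shows "(\<lambda>n. nrm (mixed_space p) (\<lambda>t. f t * indicator (A n) t)) \<longlonglongrightarrow> 0"
proof -
  have m: "f \<in> borel_measurable leb01" and fin: "mixed_norm (pw p f) < \<infinity>"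
    using f by (auto simp: vecs_mixed_space)
  have pm: "pw p f \<in> borel_measurable leb01" using m by measurable
  have "(\<integral>\<^sup>+t. pw p f t \<partial>leb01) < \<infinity>"
    using integral_le_mixed_norm[OF pm] fin
    by (auto intro: order_le_less_trans simp: ennreal_mult_less_top)
  then have int0: "(\<lambda>n. \<integral>\<^sup>+t. pw p f t * indicator (A n) t \<partial>leb01) \<longlonglongrightarrow> 0"
    by (rule decseq_indicator_integral_tendsto_0[OF pm _ A])
  have "(\<lambda>n. mixed_norm (\<lambda>t. pw p f t * indicator (A n) t)) \<longlonglongrightarrow> 0"
    using pm A(1) by (intro mixed_norm_order_continuous[OF pm fin _ _ int0]) (auto simp: indicator_def)
  moreover have "(\<lambda>t. pw p f t * indicator (A n) t) = pw p (\<lambda>t. f t * indicator (A n) t)" for n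
    using p by (auto simp: indicator_def fun_eq_iff)
  ultimately have "(\<lambda>n. mixed_norm (pw p (\<lambda>t. f t * indicator (A n) t))) \<longlonglongrightarrow> 0" by simp
  then have "(\<lambda>n. enn2real (mixed_norm (pw p (\<lambda>t. f t * indicator (A n) t)))) \<longlonglongrightarrow> enn2real 0"
    by (intro tendsto_enn2real) auto
  then have "(\<lambda>n. enn2real (mixed_norm (pw p (\<lambda>t. f t * indicator (A n) t))) powr (1 / p)) \<longlonglongrightarrow> 0 powr (1 / p)"
    using p by (intro tendsto_powr') auto
  then show ?thesis by (simp add: mixed_space_def)
qed

lemma oc_lattice_mixed_space:
  assumes p: "1 < p"
  shows "oc_lattice (mixed_space p)"
  by unfold_locales
     (fact mixed_space_measurable mixed_space_add(1)[OF p] mixed_space_scale[OF p]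
        mixed_space_solid[OF p] mixed_space_one[OF p] mixed_space_order_continuous[OF p])+

lemma kothe_norm_mono:
  assumes "AE t in leb01. \<bar>f t\<bar> \<le> \<bar>g t\<bar>"
  shows "kothe_norm E f \<le> kothe_norm E g"
proof (rule kothe_norm_leI)
  fix h assume h: "h \<in> vecs E" "nrm E h \<le> 1"
  have "(\<integral>\<^sup>+t. ennreal \<bar>f t * h t\<bar> \<partial>leb01) \<le> (\<integral>\<^sup>+t. ennreal \<bar>g t * h t\<bar> \<partial>leb01)"
  proof (rule nn_integral_mono_AE)
    show "AE t in leb01. ennreal \<bar>f t * h t\<bar> \<le> ennreal \<bar>g t * h t\<bar>"
      using assms by eventually_elim (auto intro!: ennreal_leI mult_right_mono simp: abs_mult)
  qed
  also have "\<dots> \<le> kothe_norm E g" by (rule kothe_norm_ge[OF h])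
  finally show "(\<integral>\<^sup>+t. ennreal \<bar>f t * h t\<bar> \<partial>leb01) \<le> kothe_norm E g" .
qed

lemma kothe_norm_add:
  assumes "vecs E \<subseteq> borel_measurable leb01"
    and f: "f \<in> borel_measurable leb01" and g: "g \<in> borel_measurable leb01"
  shows "kothe_norm E (\<lambda>t. f t + g t) \<le> kothe_norm E f + kothe_norm E g"
proof (rule kothe_norm_leI)
  fix h assume h: "h \<in> vecs E" "nrm E h \<le> 1"
  have hm: "h \<in> borel_measurable leb01" using assms(1) h(1) by blast
  have "(\<integral>\<^sup>+t. ennreal \<bar>(f t + g t) * h t\<bar> \<partial>leb01) \<le> (\<integral>\<^sup>+t. ennreal \<bar>f t * h t\<bar> + ennreal \<bar>g t * h t\<bar> \<partial>leb01)"
    by (intro nn_integral_mono) (simp add: distrib_right abs_triangle_ineq ennreal_leI flip: ennreal_plus)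
  also have "\<dots> = (\<integral>\<^sup>+t. ennreal \<bar>f t * h t\<bar> \<partial>leb01) + (\<integral>\<^sup>+t. ennreal \<bar>g t * h t\<bar> \<partial>leb01)"
    using f g hm by (intro nn_integral_add) auto
  also have "\<dots> \<le> kothe_norm E f + kothe_norm E g" by (intro add_mono kothe_norm_ge h)
  finally show "(\<integral>\<^sup>+t. ennreal \<bar>(f t + g t) * h t\<bar> \<partial>leb01) \<le> kothe_norm E f + kothe_norm E g" .
qed

lemma kothe_norm_scale:
  assumes "vecs E \<subseteq> borel_measurable leb01" "vecs E \<noteq> {}" and f: "f \<in> borel_measurable leb01"
  shows "kothe_norm E (\<lambda>t. c * f t) = ennreal \<bar>c\<bar> * kothe_norm E f"
proof -
  have "(\<integral>\<^sup>+t. ennreal \<bar>c * f t * h t\<bar> \<partial>leb01) = ennreal \<bar>c\<bar> * (\<integral>\<^sup>+t. ennreal \<bar>f t * h t\<bar> \<partial>leb01)"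
    if h: "h \<in> vecs E" for h
  proof -
    have hm: "h \<in> borel_measurable leb01" using assms(1) h(1) by blast
    have "(\<integral>\<^sup>+t. ennreal \<bar>c * f t * h t\<bar> \<partial>leb01) = (\<integral>\<^sup>+t. ennreal \<bar>c\<bar> * ennreal \<bar>f t * h t\<bar> \<partial>leb01)"
      by (intro nn_integral_cong) (simp add: abs_mult mult.assoc flip: ennreal_mult)
    then show ?thesis using f hm by (simp add: nn_integral_cmult)
  qed
  then show ?thesis unfolding kothe_norm_def SUP_mult_left_ennreal
    by (intro SUP_cong) auto
qed

text \<open>If the norm of \<open>h\<close> restricted to \<open>A n\<close> stays above \<open>\<delta>\<close>, then there are infinitely many
  disjoint sets on which functions of norm at most one pair with \<open>h\<close> to more than \<open>\<delta>\<close>. By the upper \<open>p\<close>-estimate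
  the sum of \<open>K\<close> such functions has norm at most \<open>K powr (1/p)\<close>, while it pairs with \<open>h\<close> to at least
  \<open>K * \<delta>\<close>. As \<open>p > 1\<close>, this is impossible for large \<open>K\<close>.\<close>

lemma kothe_dual_order_continuous:
  assumes p: "1 < p" and h: "h \<in> vecs (kothe_dual (mixed_space p))"
    and A: "\<And>n. A n \<in> sets leb01" "decseq A" "(\<Inter>n. A n) = {}"
  shows "(\<lambda>n. nrm (kothe_dual (mixed_space p)) (\<lambda>t. h t * indicator (A n) t)) \<longlonglongrightarrow> 0"
proof -
  let ?X = "mixed_space p"
  note E = banach_function_lattice_mixed_space[OF p]
  have hm: "h \<in> borel_measurable leb01" and hfin: "kothe_norm ?X h < \<infinity>"
    using h by (auto simp: vecs_kothe_dual)
  define a where "a n = kothe_norm ?X (\<lambda>t. h t * indicator (A n) t)" for n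
  have "decseq a"
    unfolding decseq_def a_def
  proof (intro allI impI kothe_norm_mono AE_I2)
    fix m n :: nat and t assume "m \<le> n"
    then have "A n \<subseteq> A m" using A(2) by (auto simp: decseq_def)
    then show "\<bar>h t * indicator (A n) t\<bar> \<le> \<bar>h t * indicator (A m) t\<bar>"
      by (auto simp: indicator_def)
  qed
  then have lim: "a \<longlonglongrightarrow> (INF n. a n)" by (rule LIMSEQ_INF)
  have "(INF n. a n) = 0"
  proof (rule ccontr)
    assume "(INF n. a n) \<noteq> 0"
    then obtain d' where d': "0 < d'" "d' < (INF n. a n)" using dense[of 0 "INF n. a n"] by (auto simp: zero_less_iff_neq_zero)
    define \<delta> where "\<delta> = enn2real d'"
    have "d' < top" by (rule less_le_trans[OF d'(2) top_greatest])
    then have d'_eq: "d' = ennreal \<delta>" by (simp add: \<delta>_def)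
    then have \<delta>: "0 < \<delta>" using d'(1) by simp
    have a_gt: "ennreal \<delta> < a n" for n
      using d'(2) INF_lower[of n UNIV a] d'_eq by (auto intro: less_le_trans)
    have step: "\<exists>m f. n < m \<and> f \<in> vecs ?X \<and> nrm ?X f \<le> 1 \<and>
        ennreal \<delta> < (\<integral>\<^sup>+t. ennreal \<bar>h t * f t\<bar> * indicator (A n - A m) t \<partial>leb01)" for n
    proof -
      obtain f where f: "f \<in> vecs ?X" "nrm ?X f \<le> 1"
        and gt: "ennreal \<delta> < (\<integral>\<^sup>+t. ennreal \<bar>h t * indicator (A n) t * f t\<bar> \<partial>leb01)"
        using a_gt[of n] unfolding a_def kothe_norm_def less_SUP_iff by auto
      have fm: "f \<in> borel_measurable leb01" by (rule mixed_space_measurable[OF f(1)])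
      have "(\<integral>\<^sup>+t. ennreal \<bar>h t * indicator (A n) t * f t\<bar> \<partial>leb01)
        = (\<integral>\<^sup>+t. liminf (\<lambda>m. ennreal \<bar>h t * f t\<bar> * indicator (A n - A m) t) \<partial>leb01)"
      proof (rule nn_integral_cong)
        fix t
        obtain k where "t \<notin> A k" using A(3) by blast
        then have "t \<notin> A m" if "k \<le> m" for m using A(2) that by (auto simp: decseq_def)
        then have "\<forall>\<^sub>F m in sequentially. ennreal \<bar>h t * f t\<bar> * indicator (A n - A m) t = ennreal \<bar>h t * indicator (A n) t * f t\<bar>"
          unfolding eventually_sequentially by (intro exI[of _ k]) (auto simp: indicator_def)
        then have "(\<lambda>m. ennreal \<bar>h t * f t\<bar> * indicator (A n - A m) t) \<longlonglongrightarrow> ennreal \<bar>h t * indicator (A n) t * f t\<bar>"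
          by (rule tendsto_eventually)
        then show "ennreal \<bar>h t * indicator (A n) t * f t\<bar> = liminf (\<lambda>m. ennreal \<bar>h t * f t\<bar> * indicator (A n - A m) t)"
          using lim_imp_Liminf[OF sequentially_bot] by force
      qed
      also have "\<dots> \<le> liminf (\<lambda>m. \<integral>\<^sup>+t. ennreal \<bar>h t * f t\<bar> * indicator (A n - A m) t \<partial>leb01)"
        using hm fm A(1) by (intro nn_integral_liminf) auto
      finally have "ennreal \<delta> < liminf (\<lambda>m. \<integral>\<^sup>+t. ennreal \<bar>h t * f t\<bar> * indicator (A n - A m) t \<partial>leb01)"
        using gt by (rule less_le_trans[rotated])
      then have "\<forall>\<^sub>F m in sequentially. ennreal \<delta> < (\<integral>\<^sup>+t. ennreal \<bar>h t * f t\<bar> * indicator (A n - A m) t \<partial>leb01)"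
        by (rule less_LiminfD)
      then have "\<forall>\<^sub>F m in sequentially. n < m \<and> ennreal \<delta> < (\<integral>\<^sup>+t. ennreal \<bar>h t * f t\<bar> * indicator (A n - A m) t \<partial>leb01)"
        using eventually_gt_at_top[of n] by eventually_elim simp
      then obtain m where "n < m" "ennreal \<delta> < (\<integral>\<^sup>+t. ennreal \<bar>h t * f t\<bar> * indicator (A n - A m) t \<partial>leb01)"
        using eventually_happens'[OF sequentially_bot] by blast
      then show ?thesis using f by blast
    qed
    define good where "good n z \<longleftrightarrow> n < fst z \<and> snd z \<in> vecs ?X \<and> nrm ?X (snd z) \<le> 1 \<and>
        ennreal \<delta> < (\<integral>\<^sup>+t. ennreal \<bar>h t * snd z t\<bar> * indicator (A n - A (fst z)) t \<partial>leb01)" for n z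
    have "\<forall>n. \<exists>z. good n z"
    proof
      fix n
      obtain m f where "n < m \<and> f \<in> vecs ?X \<and> nrm ?X f \<le> 1 \<and>
        ennreal \<delta> < (\<integral>\<^sup>+t. ennreal \<bar>h t * f t\<bar> * indicator (A n - A m) t \<partial>leb01)"
        using step by blast
      then have "good n (m, f)" by (simp add: good_def)
      then show "\<exists>z. good n z" by blast
    qed
    then obtain z where "\<forall>n. good n (z n)" using choice[of good] by blast
    then have z: "good n (z n)" for n by blast
    define nx where "nx n = fst (z n)" for n
    define fx where "fx n = snd (z n)" for n
    have nx: "n < nx n" and fx: "fx n \<in> vecs ?X" "nrm ?X (fx n) \<le> 1"
      and gt: "ennreal \<delta> < (\<integral>\<^sup>+t. ennreal \<bar>h t * fx n t\<bar> * indicator (A n - A (nx n)) t \<partial>leb01)" for n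
      using z[of n] by (auto simp: good_def nx_def fx_def)
    define nk where "nk k = (nx ^^ k) 0" for k
    have nk_Suc: "nk (Suc k) = nx (nk k)" for k by (simp add: nk_def)
    have nk_mono: "strict_mono nk" by (rule strict_monoI_Suc) (simp add: nk_Suc nx)
    define S where "S k = A (nk k) - A (nk (Suc k))" for k
    define F where "F k t = fx (nk k) t * indicator (S k) t" for k t
    have Sm: "S k \<in> sets leb01" for k unfolding S_def using A(1) by auto
    have Fm: "F k \<in> borel_measurable leb01" for k
      unfolding F_def using Sm mixed_space_measurable[OF fx(1)] by measurable
    have S_disj: "S i \<inter> S j = {}" if "i < j" for i j
    proof -
      have "nk (Suc i) \<le> nk j" using that strict_mono_leD[OF nk_mono, of "Suc i" j] by simp
      then have "A (nk j) \<subseteq> A (nk (Suc i))" using A(2) by (auto simp: decseq_def)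
      then show ?thesis by (auto simp: S_def)
    qed
    have F_disj: "F i t = 0 \<or> F j t = 0" if "i \<noteq> j" for i j t
      using S_disj[of i j] S_disj[of j i] that by (cases "i < j") (auto simp: F_def indicator_def)
    have Fpw: "mixed_norm (pw p (F k)) \<le> 1" for k
    proof -
      have "mixed_norm (pw p (F k)) \<le> mixed_norm (pw p (fx (nk k)))"
        by (rule sup_of_integrals_mono[OF sup_of_integrals_mixed_norm pw_measurable[OF Fm]
              pw_measurable[OF mixed_space_measurable[OF fx(1)]]], rule AE_I2)
           (auto simp: F_def indicator_def)
      also have "\<dots> \<le> ennreal (1 powr p)"
        using mixed_norm_le_iff[OF p mixed_space_measurable[OF fx(1)], of 1] fx by simp
      finally show ?thesis by simp
    qed
    have main: "real K * \<delta> \<le> enn2real (kothe_norm ?X h) * real K powr (1 / p)" for K :: nat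
    proof -
      define G where "G t = (\<Sum>k<K. F k t)" for t
      have Gm: "G \<in> borel_measurable leb01" unfolding G_def using Fm by measurable
      have "\<bar>G t\<bar> powr p = (\<Sum>k<K. \<bar>F k t\<bar> powr p)" for t
        unfolding G_def by (rule powr_abs_sum_disjoint) (use F_disj in auto)
      then have "mixed_norm (pw p G) = mixed_norm (\<lambda>t. \<Sum>k<K. pw p (F k) t)"
        by (simp add: sum_ennreal)
      also have "\<dots> \<le> (\<Sum>k<K. mixed_norm (pw p (F k)))"
        using Fm by (intro sup_of_integrals_sum[OF sup_of_integrals_mixed_norm]) auto
      also have "\<dots> \<le> (\<Sum>k<K. 1)" by (intro sum_mono Fpw)
      also have "\<dots> = ennreal ((real K powr (1 / p)) powr p)"
        using p by (simp add: powr_powr ennreal_of_nat_eq_real_of_nat)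
      finally have G: "G \<in> vecs ?X" "nrm ?X G \<le> real K powr (1 / p)"
        using mixed_norm_le_iff[OF p Gm, of "real K powr (1/p)"] by auto
      have "(\<Sum>k<K. ennreal \<delta>) \<le> (\<Sum>k<K. \<integral>\<^sup>+t. ennreal \<bar>h t * fx (nk k) t\<bar> * indicator (S k) t \<partial>leb01)"
        using gt[of "nk _"] by (intro sum_mono) (simp add: S_def nk_Suc less_imp_le)
      also have "\<dots> = (\<integral>\<^sup>+t. (\<Sum>k<K. ennreal \<bar>h t * fx (nk k) t\<bar> * indicator (S k) t) \<partial>leb01)"
        using hm Sm mixed_space_measurable[OF fx(1)] by (intro nn_integral_sum[symmetric]) auto
      also have "\<dots> = (\<integral>\<^sup>+t. ennreal \<bar>h t * G t\<bar> \<partial>leb01)"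
      proof (rule nn_integral_cong)
        fix t
        have "(\<Sum>k<K. ennreal \<bar>h t * fx (nk k) t\<bar> * indicator (S k) t) = (\<Sum>k<K. ennreal (\<bar>h t\<bar> * \<bar>F k t\<bar>))"
          by (intro sum.cong) (auto simp: F_def indicator_def abs_mult)
        also have "\<dots> = ennreal (\<bar>h t\<bar> * (\<Sum>k<K. \<bar>F k t\<bar>))"
          by (simp add: sum_ennreal sum_distrib_left)
        also have "(\<Sum>k<K. \<bar>F k t\<bar>) = \<bar>G t\<bar>"
          using powr_abs_sum_disjoint[of "{..<K}" "\<lambda>k. F k t" 1] F_disj by (simp add: G_def)
        finally show "(\<Sum>k<K. ennreal \<bar>h t * fx (nk k) t\<bar> * indicator (S k) t) = ennreal \<bar>h t * G t\<bar>"
          by (simp add: abs_mult)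
      qed
      also have "\<dots> \<le> kothe_norm ?X h * ennreal (nrm ?X G)"
        by (rule kothe_hoelder[OF E G(1) hm])
      also have "\<dots> \<le> ennreal (enn2real (kothe_norm ?X h)) * ennreal (real K powr (1 / p))"
        using hfin G(2) by (intro mult_mono) (auto simp: ennreal_leI)
      finally have "ennreal (real K * \<delta>) \<le> ennreal (enn2real (kothe_norm ?X h) * real K powr (1 / p))"
        using \<delta> by (simp add: ennreal_mult ennreal_of_nat_eq_real_of_nat)
      then show ?thesis by (subst (asm) ennreal_le_iff) auto
    qed
    define H where "H = enn2real (kothe_norm ?X h) / \<delta> + 1"
    have H: "1 \<le> H" using \<delta> by (simp add: H_def)
    \<comment> \<open>\<open>K\<close> is so large that \<open>K powr (1 - 1/p)\<close> exceeds the quotient of the norm of \<open>h\<close> and \<open>\<delta>\<close>.\<close>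
    obtain K :: nat where K: "H powr (1 / (1 - 1 / p)) \<le> real K" using real_arch_simple by blast
    have q: "0 < 1 - 1 / p" using p by simp
    have "1 \<le> H powr (1 / (1 - 1 / p))" using H q by (intro ge_one_powr_ge_zero) auto
    then have K1: "1 \<le> real K" using K by simp
    have "(H powr (1 / (1 - 1 / p))) powr (1 - 1 / p) \<le> real K powr (1 - 1 / p)"
      using K q by (intro powr_mono2) auto
    moreover have "(H powr (1 / (1 - 1 / p))) powr (1 - 1 / p) = H"
      unfolding powr_powr using q H p by auto
    ultimately have HK: "H \<le> real K powr (1 - 1 / p)" by simp
    have "real K powr (1 - 1 / p) * real K powr (1 / p) = real K" using K1 by (simp flip: powr_add)
    then have "(real K powr (1 - 1 / p) * \<delta>) * real K powr (1 / p) \<le> enn2real (kothe_norm ?X h) * real K powr (1 / p)"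
      using main[of K] by (simp add: mult_ac)
    then have "real K powr (1 - 1 / p) * \<delta> \<le> enn2real (kothe_norm ?X h)"
      using K1 by (subst (asm) mult_le_cancel_right) auto
    moreover have "H * \<delta> \<le> real K powr (1 - 1 / p) * \<delta>" using HK \<delta> by (intro mult_right_mono) auto
    moreover have "H * \<delta> = enn2real (kothe_norm ?X h) + \<delta>" using \<delta> by (simp add: H_def field_simps)
    ultimately show False using \<delta> by linarith
  qed
  then have "a \<longlonglongrightarrow> 0" using lim by simp
  then have "(\<lambda>n. enn2real (a n)) \<longlonglongrightarrow> enn2real 0" by (intro tendsto_enn2real) auto
  then show ?thesis by (simp add: nrm_kothe_dual a_def)
qed

lemma oc_lattice_kothe_dual:
  assumes p: "1 < p"
  shows "oc_lattice (kothe_dual (mixed_space p))"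
proof
  let ?X = "mixed_space p"
  have sub: "vecs ?X \<subseteq> borel_measurable leb01" using mixed_space_measurable by blast
  have ne: "vecs ?X \<noteq> {}" using mixed_space_one[OF p] by blast
  show "f \<in> borel_measurable leb01" if "f \<in> vecs (kothe_dual ?X)" for f
    using that by (simp add: vecs_kothe_dual)
  show "(\<lambda>t. f t + g t) \<in> vecs (kothe_dual ?X)" if "f \<in> vecs (kothe_dual ?X)" "g \<in> vecs (kothe_dual ?X)" for f g
  proof -
    have m: "f \<in> borel_measurable leb01" "g \<in> borel_measurable leb01"
      "kothe_norm ?X f < \<infinity>" "kothe_norm ?X g < \<infinity>" using that by (auto simp: vecs_kothe_dual)
    have "kothe_norm ?X (\<lambda>t. f t + g t) < \<infinity>"
      by (rule order_le_less_trans[OF kothe_norm_add[OF sub m(1,2)]]) (use m in auto)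
    then show ?thesis using m by (simp add: vecs_kothe_dual)
  qed
  show "(\<lambda>t. c * f t) \<in> vecs (kothe_dual ?X)" if "f \<in> vecs (kothe_dual ?X)" for f c
    using that borel_measurable_times[OF borel_measurable_const, of f leb01 c]
    by (simp add: vecs_kothe_dual kothe_norm_scale[OF sub ne] ennreal_mult_less_top)
  show "nrm (kothe_dual ?X) (\<lambda>t. c * f t) = \<bar>c\<bar> * nrm (kothe_dual ?X) f" if "f \<in> vecs (kothe_dual ?X)" for f c
    using that by (simp add: nrm_kothe_dual vecs_kothe_dual kothe_norm_scale[OF sub ne] enn2real_mult)
  fix f g :: "real \<Rightarrow> real"
  assume g: "g \<in> vecs (kothe_dual ?X)" and f: "f \<in> borel_measurable leb01"
    and le: "AE t in leb01. \<bar>f t\<bar> \<le> \<bar>g t\<bar>"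
  have k: "kothe_norm ?X f \<le> kothe_norm ?X g" by (rule kothe_norm_mono[OF le])
  have gf: "kothe_norm ?X g < \<infinity>" using g by (simp add: vecs_kothe_dual)
  show "f \<in> vecs (kothe_dual ?X)" using order_le_less_trans[OF k gf] f by (simp add: vecs_kothe_dual)
  show "nrm (kothe_dual ?X) f \<le> nrm (kothe_dual ?X) g"
    using k gf by (simp add: nrm_kothe_dual enn2real_mono)
next
  let ?X = "mixed_space p"
  have "kothe_norm ?X (\<lambda>_. 1) \<le> ennreal (3 * 1)"
  proof (rule kothe_norm_leI)
    fix g assume g: "g \<in> vecs ?X" "nrm ?X g \<le> 1"
    show "(\<integral>\<^sup>+t. ennreal \<bar>1 * g t\<bar> \<partial>leb01) \<le> ennreal (3 * 1)"
      using integral_abs_le[OF p g(1) _ g(2)] by simp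
  qed
  then have "kothe_norm ?X (\<lambda>_. 1) < \<infinity>" by (rule order_le_less_trans) simp
  then show "(\<lambda>_. 1) \<in> vecs (kothe_dual ?X)" by (simp add: vecs_kothe_dual)
next
  let ?X = "mixed_space p"
  fix f A assume "f \<in> vecs (kothe_dual ?X)" "\<And>n. A n \<in> sets leb01" "decseq A" "(\<Inter>n. A n) = {}"
  then show "(\<lambda>n. nrm (kothe_dual ?X) (\<lambda>t. f t * indicator (A n) t)) \<longlonglongrightarrow> 0"
    by (rule kothe_dual_order_continuous[OF p])
qed

text \<open>The value \<open>0\<close> outside the lattice matches the convention for elements of \<open>banach_dual\<close>.\<close>

definition pairing :: "real blat \<Rightarrow> (real \<Rightarrow> real) \<Rightarrow> (real \<Rightarrow> real) \<Rightarrow> real" where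
  "pairing E g f = (if f \<in> vecs E then \<integral>t. f t * g t \<partial>leb01 else 0)"

lemma pairing_integrable:
  assumes E: "banach_function_lattice E" and g: "g \<in> vecs (kothe_dual E)" and f: "f \<in> vecs E"
  shows "integrable leb01 (\<lambda>t. f t * g t)" "\<bar>pairing E g f\<bar> \<le> nrm (kothe_dual E) g * nrm E f"
proof -
  have m: "f \<in> borel_measurable leb01" "g \<in> borel_measurable leb01"
    using E f g by (auto simp: banach_function_lattice_def vecs_kothe_dual)
  have nn: "0 \<le> nrm E f" using E f by (auto simp: banach_function_lattice_def)
  have "(\<integral>\<^sup>+t. ennreal (norm (f t * g t)) \<partial>leb01) = (\<integral>\<^sup>+t. ennreal \<bar>g t * f t\<bar> \<partial>leb01)"
    by (simp add: mult.commute)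
  also have "\<dots> \<le> kothe_norm E g * ennreal (nrm E f)" by (rule kothe_hoelder[OF E f m(2)])
  also have "kothe_norm E g = ennreal (nrm (kothe_dual E) g)"
    using g by (simp add: vecs_kothe_dual nrm_kothe_dual)
  also have "ennreal (nrm (kothe_dual E) g) * ennreal (nrm E f) = ennreal (nrm (kothe_dual E) g * nrm E f)"
    using nn by (simp add: ennreal_mult nrm_kothe_dual)
  finally have le: "(\<integral>\<^sup>+t. ennreal (norm (f t * g t)) \<partial>leb01) \<le> ennreal (nrm (kothe_dual E) g * nrm E f)" .
  show int: "integrable leb01 (\<lambda>t. f t * g t)"
    by (rule integrableI_bounded) (use m le in \<open>auto intro: order_le_less_trans\<close>)
  have "ennreal (\<integral>t. norm (f t * g t) \<partial>leb01) \<le> ennreal (nrm (kothe_dual E) g * nrm E f)"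
    using le int by (simp add: nn_integral_eq_integral)
  then have "(\<integral>t. norm (f t * g t) \<partial>leb01) \<le> nrm (kothe_dual E) g * nrm E f"
    using nn by (subst (asm) ennreal_le_iff) (auto simp: nrm_kothe_dual)
  then show "\<bar>pairing E g f\<bar> \<le> nrm (kothe_dual E) g * nrm E f"
    using order_trans[OF integral_abs_bound[of leb01 "\<lambda>t. f t * g t"]] f by (simp add: pairing_def)
qed

lemma pairing_in_dual:
  assumes E: "banach_function_lattice E" and g: "g \<in> vecs (kothe_dual E)"
  shows "pairing E g \<in> vecs (banach_dual E)"
proof (rule banach_dualI)
  show "pairing E g f = 0" if "f \<notin> vecs E" for f using that by (simp add: pairing_def)
  show "\<bar>pairing E g f\<bar> \<le> nrm (kothe_dual E) g * nrm E f" if "f \<in> vecs E" for f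
    by (rule pairing_integrable(2)[OF E g that])
  show "pairing E g (\<lambda>t. f t + k t) = pairing E g f + pairing E g k" if f: "f \<in> vecs E" and k: "k \<in> vecs E" for f k
  proof -
    have "(\<lambda>t. f t + k t) \<in> vecs E" using E f k by (auto simp: banach_function_lattice_def)
    then show ?thesis using f k pairing_integrable(1)[OF E g] by (simp add: pairing_def distrib_right)
  qed
  show "pairing E g (\<lambda>t. c * f t) = c * pairing E g f" if f: "f \<in> vecs E" for f c
  proof -
    have "(\<lambda>t. c * f t) \<in> vecs E" using E f by (auto simp: banach_function_lattice_def)
    then show ?thesis using f by (simp add: pairing_def mult.assoc)
  qed
qed

lemma nrm_banach_dual_le:
  assumes ne: "(\<lambda>_. 0) \<in> vecs E" "nrm E (\<lambda>_. 0) \<le> 1"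
    and le: "\<And>f. f \<in> vecs E \<Longrightarrow> nrm E f \<le> 1 \<Longrightarrow> \<bar>\<phi> f\<bar> \<le> C"
  shows "nrm (banach_dual E) \<phi> \<le> C"
  unfolding banach_dual_def using ne le by (auto intro!: cSUP_least)

lemma nrm_banach_dual_ge:
  assumes \<phi>: "\<phi> \<in> vecs (banach_dual E)" and nn: "\<And>f. f \<in> vecs E \<Longrightarrow> 0 \<le> nrm E f"
    and f: "f \<in> vecs E" "nrm E f \<le> 1"
  shows "\<bar>\<phi> f\<bar> \<le> nrm (banach_dual E) \<phi>"
proof -
  obtain C where C: "\<And>f. f \<in> vecs E \<Longrightarrow> \<bar>\<phi> f\<bar> \<le> C * nrm E f"
    by (rule banach_dual_bounded[OF \<phi>]) blast
  have "\<bar>\<phi> k\<bar> \<le> \<bar>C\<bar>" if "k \<in> vecs E" "nrm E k \<le> 1" for k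
  proof -
    have "C * nrm E k \<le> \<bar>C\<bar> * nrm E k" using nn[OF that(1)] by (intro mult_right_mono) auto
    also have "\<dots> \<le> \<bar>C\<bar> * 1" using that by (intro mult_left_mono) auto
    finally show ?thesis using C[OF that(1)] by simp
  qed
  then have "bdd_above ((\<lambda>f. \<bar>\<phi> f\<bar>) ` {f \<in> vecs E. nrm E f \<le> 1})"
    by (intro bdd_aboveI[of _ "\<bar>C\<bar>"]) auto
  then show ?thesis unfolding banach_dual_def using f by (auto intro!: cSUP_upper)
qed

lemma zero_in_lattice:
  assumes "banach_function_lattice E"
  shows "(\<lambda>_. 0) \<in> vecs E" "nrm E (\<lambda>_. 0) = 0"
proof -
  have sc: "\<forall>f\<in>vecs E. \<forall>c. (\<lambda>t. c * f t) \<in> vecs E \<and> nrm E (\<lambda>t. c * f t) = \<bar>c\<bar> * nrm E f"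
    using assms unfolding banach_function_lattice_def by blast
  obtain f where "f \<in> vecs E" using assms unfolding banach_function_lattice_def by blast
  with sc have "(\<lambda>t. 0 * f t) \<in> vecs E \<and> nrm E (\<lambda>t. 0 * f t) = \<bar>0\<bar> * nrm E f" by blast
  then show "(\<lambda>_. 0) \<in> vecs E" "nrm E (\<lambda>_. 0) = 0" by auto
qed

text \<open>A bidual functional restricts to the Koethe dual, where it is integration against some
  \<open>f\<close> in the second Koethe dual, which is \<open>E\<close>. As all functionals on \<open>E\<close> are integrals too, the bidual
  functional is evaluation at \<open>f\<close>.\<close>

lemma reflexive_order_continuous:
  assumes E: "banach_function_lattice E" and ocE: "oc_lattice E" and ocK: "oc_lattice (kothe_dual E)"
    and max: "maximal_space E"
  shows "reflexive_space E"
  unfolding reflexive_space_def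
proof
  fix \<Psi> assume \<Psi>: "\<Psi> \<in> vecs (banach_dual (banach_dual E))"
  interpret E: oc_lattice E by fact
  interpret K: oc_lattice "kothe_dual E" by fact
  note pd = pairing_in_dual[OF E]
  have pairing_add: "pairing E (\<lambda>t. g t + k t) = (\<lambda>f. pairing E g f + pairing E k f)"
    if g: "g \<in> vecs (kothe_dual E)" and k: "k \<in> vecs (kothe_dual E)" for g k
    using pairing_integrable(1)[OF E g] pairing_integrable(1)[OF E k]
    by (auto simp: pairing_def fun_eq_iff distrib_left)
  have pairing_scale: "pairing E (\<lambda>t. c * g t) = (\<lambda>f. c * pairing E g f)" for g c
    by (auto simp: pairing_def fun_eq_iff mult.left_commute)
  obtain C where C: "\<And>\<phi>. \<phi> \<in> vecs (banach_dual E) \<Longrightarrow> \<bar>\<Psi> \<phi>\<bar> \<le> C * nrm (banach_dual E) \<phi>"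
    by (rule banach_dual_bounded[OF \<Psi>]) blast
  have nrm_pairing: "nrm (banach_dual E) (pairing E g) \<le> nrm (kothe_dual E) g" if g: "g \<in> vecs (kothe_dual E)" for g
  proof (rule nrm_banach_dual_le)
    fix f assume f: "f \<in> vecs E" "nrm E f \<le> 1"
    have "nrm (kothe_dual E) g * nrm E f \<le> nrm (kothe_dual E) g * 1"
      using f(2) K.nrm_nonneg[OF g] by (rule mult_left_mono)
    then show "\<bar>pairing E g f\<bar> \<le> nrm (kothe_dual E) g"
      using pairing_integrable(2)[OF E g f(1)] by simp
  qed (use zero_in_lattice[OF E] in auto)
  have nrm_pairing_nonneg: "0 \<le> nrm (banach_dual E) (pairing E g)" if g: "g \<in> vecs (kothe_dual E)" for g
    using nrm_banach_dual_ge[OF pd[OF g] E.nrm_nonneg, of "\<lambda>_. 0"] zero_in_lattice[OF E] by simp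
  define \<Phi> where "\<Phi> g = (if g \<in> vecs (kothe_dual E) then \<Psi> (pairing E g) else 0)" for g
  have "\<Phi> \<in> vecs (banach_dual (kothe_dual E))"
  proof (rule banach_dualI[where C="\<bar>C\<bar>"])
    show "\<Phi> g = 0" if "g \<notin> vecs (kothe_dual E)" for g using that by (simp add: \<Phi>_def)
    show "\<Phi> (\<lambda>t. g t + k t) = \<Phi> g + \<Phi> k" if "g \<in> vecs (kothe_dual E)" "k \<in> vecs (kothe_dual E)" for g k
      using that K.add_vecs[OF that] banach_dual_add[OF \<Psi> pd[OF that(1)] pd[OF that(2)]] pairing_add[OF that]
      by (simp add: \<Phi>_def)
    show "\<Phi> (\<lambda>t. c * g t) = c * \<Phi> g" if "g \<in> vecs (kothe_dual E)" for g c
      using that K.scale_vecs[OF that] banach_dual_scale[OF \<Psi> pd[OF that]] pairing_scale[of c g]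
      by (simp add: \<Phi>_def)
    fix g assume g: "g \<in> vecs (kothe_dual E)"
    have "\<bar>\<Psi> (pairing E g)\<bar> \<le> C * nrm (banach_dual E) (pairing E g)" by (rule C[OF pd[OF g]])
    also have "\<dots> \<le> \<bar>C\<bar> * nrm (banach_dual E) (pairing E g)"
      using nrm_pairing_nonneg[OF g] by (intro mult_right_mono) auto
    also have "\<dots> \<le> \<bar>C\<bar> * nrm (kothe_dual E) g" using nrm_pairing[OF g] by (intro mult_left_mono) auto
    finally show "\<bar>\<Phi> g\<bar> \<le> \<bar>C\<bar> * nrm (kothe_dual E) g" using g by (simp add: \<Phi>_def)
  qed
  then obtain f D where f: "f \<in> borel_measurable leb01" "0 \<le> D"
    "\<And>g. g \<in> vecs (kothe_dual E) \<Longrightarrow> (\<integral>\<^sup>+t. ennreal \<bar>f t * g t\<bar> \<partial>leb01) \<le> ennreal (D * nrm (kothe_dual E) g)"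
    "\<And>g. g \<in> vecs (kothe_dual E) \<Longrightarrow> \<Phi> g = (\<integral>t. g t * f t \<partial>leb01)"
    by (rule K.dual_representation) blast
  have "kothe_norm (kothe_dual E) f \<le> ennreal D"
  proof (rule kothe_norm_leI)
    fix g assume g: "g \<in> vecs (kothe_dual E)" "nrm (kothe_dual E) g \<le> 1"
    have "D * nrm (kothe_dual E) g \<le> D * 1" using g(2) f(2) by (rule mult_left_mono)
    then show "(\<integral>\<^sup>+t. ennreal \<bar>f t * g t\<bar> \<partial>leb01) \<le> ennreal D"
      using order_trans[OF f(3)[OF g(1)] ennreal_leI] by simp
  qed
  then have "kothe_norm (kothe_dual E) f < \<infinity>" by (rule order_le_less_trans) simp
  then have "f \<in> vecs (kothe_dual (kothe_dual E))" using f(1) by (simp add: vecs_kothe_dual[of f "kothe_dual E"])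
  then have fE: "f \<in> vecs E" using max by (simp add: maximal_space_def)
  have "\<Psi> \<phi> = \<phi> f" if \<phi>: "\<phi> \<in> vecs (banach_dual E)" for \<phi>
  proof -
    obtain g D' where g: "g \<in> borel_measurable leb01" "0 \<le> D'"
      "\<And>f. f \<in> vecs E \<Longrightarrow> (\<integral>\<^sup>+t. ennreal \<bar>g t * f t\<bar> \<partial>leb01) \<le> ennreal (D' * nrm E f)"
      "\<And>f. f \<in> vecs E \<Longrightarrow> \<phi> f = (\<integral>t. f t * g t \<partial>leb01)"
      by (rule E.dual_representation[OF \<phi>]) blast
    have "kothe_norm E g \<le> ennreal D'"
    proof (rule kothe_norm_leI)
      fix k assume k: "k \<in> vecs E" "nrm E k \<le> 1"
      have "D' * nrm E k \<le> D' * 1" using k(2) g(2) by (rule mult_left_mono)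
      then show "(\<integral>\<^sup>+t. ennreal \<bar>g t * k t\<bar> \<partial>leb01) \<le> ennreal D'"
        using order_trans[OF g(3)[OF k(1)] ennreal_leI] by simp
    qed
    then have "kothe_norm E g < \<infinity>" by (rule order_le_less_trans) simp
    then have gK: "g \<in> vecs (kothe_dual E)" using g(1) by (simp add: vecs_kothe_dual)
    have "\<phi> = pairing E g"
    proof
      fix k show "\<phi> k = pairing E g k"
        using g(4)[of k] banach_dual_outside[OF \<phi>, of k] by (cases "k \<in> vecs E") (auto simp: pairing_def)
    qed
    then have "\<Psi> \<phi> = \<Phi> g" using gK by (simp add: \<Phi>_def)
    also have "\<dots> = (\<integral>t. f t * g t \<partial>leb01)" using f(4)[OF gK] by (simp add: mult.commute)
    also have "\<dots> = \<phi> f" using g(4)[OF fE] by simp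
    finally show ?thesis .
  qed
  then show "\<exists>f\<in>vecs E. \<forall>\<phi>\<in>vecs (banach_dual E). \<Psi> \<phi> = \<phi> f" using fE by blast
qed

lemma reflexive_mixed_space:
  assumes "1 < p"
  shows "reflexive_space (mixed_space p)"
  by (rule reflexive_order_continuous)
     (use assms in \<open>auto intro: banach_function_lattice_mixed_space oc_lattice_mixed_space
        oc_lattice_kothe_dual maximal_mixed_space\<close>)

section \<open>Disjoint sequences in the space\<close>

text \<open>Once the row \<open>k\<close> is so far out that its mass before \<open>M\<close> is less than \<open>\<delta>/2\<close>, a block starting at \<open>M\<close>
  carries mass \<open>\<delta>/2\<close>; the construction is then repeated behind that block.\<close>

lemma gliding_hump:
  fixes a :: "nat \<Rightarrow> nat \<Rightarrow> ennreal" and \<delta> :: real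
  assumes \<delta>: "0 < \<delta>" and large: "\<And>k. ennreal \<delta> < (\<Sum>i. a k i)" and null: "\<And>i. (\<lambda>k. a k i) \<longlonglongrightarrow> 0"
  obtains r l :: "nat \<Rightarrow> nat" where "strict_mono r" "strict_mono l"
    "\<And>k. ennreal (\<delta> / 2) \<le> (\<Sum>i\<in>{l k..<l (Suc k)}. a (r k) i)"
proof -
  define good where "good s s' \<longleftrightarrow> fst s < fst s' \<and> snd s < snd s' \<and>
      ennreal (\<delta> / 2) \<le> (\<Sum>i\<in>{snd s..<snd s'}. a (fst s') i)" for s s' :: "nat \<times> nat"
  have "\<forall>s. \<exists>s'. good s s'"
  proof
    fix s :: "nat \<times> nat"
    obtain k0 M where s: "s = (k0, M)" by (cases s)
    have "(\<lambda>k. \<Sum>i<M. a k i) \<longlonglongrightarrow> (\<Sum>i<M. 0)" by (intro tendsto_sum null)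
    then have "(\<lambda>k. \<Sum>i<M. a k i) \<longlonglongrightarrow> 0" by simp
    then have "\<forall>\<^sub>F k in sequentially. (\<Sum>i<M. a k i) < ennreal (\<delta> / 2)"
      by (rule order_tendstoD(2)) (use \<delta> in simp)
    then have "\<forall>\<^sub>F k in sequentially. k0 < k \<and> (\<Sum>i<M. a k i) < ennreal (\<delta> / 2)"
      using eventually_gt_at_top[of k0] by eventually_elim simp
    then obtain k where k: "k0 < k" "(\<Sum>i<M. a k i) < ennreal (\<delta> / 2)"
      using eventually_happens'[OF sequentially_bot] by blast
    have "ennreal \<delta> < (SUP n. \<Sum>i<n. a k i)" using large[of k] by (simp add: suminf_eq_SUP)
    then obtain n where n: "ennreal \<delta> < (\<Sum>i<n. a k i)" by (auto simp: less_SUP_iff)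
    define M' where "M' = max n (Suc M)"
    have M': "M < M'" by (simp add: M'_def)
    have "(\<Sum>i<n. a k i) \<le> (\<Sum>i<M'. a k i)" by (rule sum_mono2) (auto simp: M'_def)
    also have "\<dots> = (\<Sum>i<M. a k i) + (\<Sum>i\<in>{M..<M'}. a k i)"
    proof -
      have "{..<M'} = {..<M} \<union> {M..<M'}" using M' by auto
      then show ?thesis by (simp add: sum.union_disjoint ivl_disj_int)
    qed
    finally have gt: "ennreal \<delta> < (\<Sum>i<M. a k i) + (\<Sum>i\<in>{M..<M'}. a k i)"
      using n by (rule less_le_trans[rotated])
    have "ennreal (\<delta> / 2) \<le> (\<Sum>i\<in>{M..<M'}. a k i)"
    proof (rule ccontr)
      assume "\<not> ennreal (\<delta> / 2) \<le> (\<Sum>i\<in>{M..<M'}. a k i)"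
      then have "(\<Sum>i\<in>{M..<M'}. a k i) \<le> ennreal (\<delta> / 2)" by simp
      then have "(\<Sum>i<M. a k i) + (\<Sum>i\<in>{M..<M'}. a k i) \<le> ennreal (\<delta> / 2) + ennreal (\<delta> / 2)"
        using k(2) by (intro add_mono) auto
      also have "\<dots> = ennreal \<delta>" using \<delta> by (simp flip: ennreal_plus)
      finally show False using gt by simp
    qed
    then have "good s (k, M')" using s k M' by (simp add: good_def)
    then show "\<exists>s'. good s s'" by blast
  qed
  then obtain nxt where "\<forall>s. good s (nxt s)" using choice[of good] by blast
  then have nxt: "good s (nxt s)" for s by blast
  define st where "st n = (nxt ^^ n) (0, 0)" for n
  have st_Suc: "st (Suc n) = nxt (st n)" for n by (simp add: st_def)
  have g: "good (st n) (st (Suc n))" for n unfolding st_Suc by (rule nxt)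
  show ?thesis
  proof (rule that[of "\<lambda>n. fst (st (Suc n))" "\<lambda>n. snd (st n)"])
    show "strict_mono (\<lambda>n. fst (st (Suc n)))" by (rule strict_monoI_Suc) (use g in \<open>simp add: good_def\<close>)
    show "strict_mono (\<lambda>n. snd (st n))" by (rule strict_monoI_Suc) (use g in \<open>simp add: good_def\<close>)
    show "ennreal (\<delta> / 2) \<le> (\<Sum>i\<in>{snd (st k)..<snd (st (Suc k))}. a (fst (st (Suc k))) i)" for k
      using g[of k] by (simp add: good_def)
  qed
qed

text \<open>On the block that belongs to \<open>k\<close> the coordinates of the sum dominate those of its \<open>k\<close>-th term, and
  the blocks are disjoint.\<close>

lemma lower_l1_estimate_subsequence:
  fixes \<gamma> :: "nat \<Rightarrow> ('a \<Rightarrow> ennreal) \<Rightarrow> ennreal" and \<delta> :: real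
  assumes \<gamma>: "\<And>i. sup_of_integrals M (\<gamma> i)" and g: "\<And>k. g k \<in> borel_measurable M"
    and \<delta>: "0 < \<delta>" and large: "\<And>k. ennreal \<delta> < (\<Sum>i. \<gamma> i (g k))" and null: "\<And>i. (\<lambda>k. \<gamma> i (g k)) \<longlonglongrightarrow> 0"
  obtains r :: "nat \<Rightarrow> nat" where "strict_mono r"
    "\<And>K b. finite K \<Longrightarrow> ennreal (\<delta> / 2) * (\<Sum>k\<in>K. b k) \<le> (\<Sum>i. \<gamma> i (\<lambda>t. \<Sum>k\<in>K. b k * g (r k) t))"
proof -
  obtain r l :: "nat \<Rightarrow> nat" where r: "strict_mono r" and l: "strict_mono l"
    and hump: "\<And>k. ennreal (\<delta> / 2) \<le> (\<Sum>i\<in>{l k..<l (Suc k)}. \<gamma> i (g (r k)))"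
    using gliding_hump[of \<delta> "\<lambda>k i. \<gamma> i (g k)", OF \<delta> large null] by blast
  show ?thesis
  proof (rule that[OF r])
    fix K :: "nat set" and b :: "nat \<Rightarrow> ennreal" assume K: "finite K"
    define u where "u t = (\<Sum>k\<in>K. b k * g (r k) t)" for t
    have um: "u \<in> borel_measurable M" unfolding u_def using g by measurable
    have bg: "(\<lambda>t. b k * g (r k) t) \<in> borel_measurable M" for k using g by measurable
    have le: "b k * \<gamma> i (g (r k)) \<le> \<gamma> i u" if "k \<in> K" for k i
    proof -
      have "b k * \<gamma> i (g (r k)) = \<gamma> i (\<lambda>t. b k * g (r k) t)"
        by (rule sup_of_integrals_scale[OF \<gamma> g, symmetric])
      also have "\<dots> \<le> \<gamma> i u"
      proof (rule sup_of_integrals_mono[OF \<gamma> bg um], rule AE_I2)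
        show "b k * g (r k) t \<le> u t" for t
          unfolding u_def using that K by (intro member_le_sum) auto
      qed
      finally show ?thesis .
    qed
    have disj: "{l j..<l (Suc j)} \<inter> {l k..<l (Suc k)} = {}" if "j \<noteq> k" for j k
    proof -
      have *: "l (Suc j) \<le> l k" if "j < k" for j k using that strict_mono_leD[OF l, of "Suc j" k] by simp
      show ?thesis using *[of j k] *[of k j] that by (cases "j < k") auto
    qed
    have "ennreal (\<delta> / 2) * (\<Sum>k\<in>K. b k) = (\<Sum>k\<in>K. b k * ennreal (\<delta> / 2))"
      by (subst mult.commute) (rule sum_distrib_right)
    also have "\<dots> \<le> (\<Sum>k\<in>K. b k * (\<Sum>i\<in>{l k..<l (Suc k)}. \<gamma> i (g (r k))))"
      by (intro sum_mono mult_left_mono hump) auto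
    also have "\<dots> \<le> (\<Sum>k\<in>K. \<Sum>i\<in>{l k..<l (Suc k)}. \<gamma> i u)"
      unfolding sum_distrib_left by (intro sum_mono le)
    also have "\<dots> = (\<Sum>i\<in>(\<Union>k\<in>K. {l k..<l (Suc k)}). \<gamma> i u)"
      using K disj by (intro sum.UNION_disjoint[symmetric]) auto
    also have "\<dots> \<le> (\<Sum>i. \<gamma> i u)"
      using K by (intro sum_le_suminf) auto
    finally show "ennreal (\<delta> / 2) * (\<Sum>k\<in>K. b k) \<le> (\<Sum>i. \<gamma> i (\<lambda>t. \<Sum>k\<in>K. b k * g (r k) t))"
      unfolding u_def .
  qed
qed

lemma not_null_subsequence:
  fixes a :: "nat \<Rightarrow> ennreal"
  assumes "\<not> a \<longlonglongrightarrow> 0"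
  obtains \<delta> :: real and r :: "nat \<Rightarrow> nat" where "0 < \<delta>" "strict_mono r" "\<And>k. ennreal \<delta> < a (r k)"
proof -
  have "\<exists>e>0. \<not> (\<forall>\<^sub>F k in sequentially. a k < e)"
  proof (rule ccontr)
    assume "\<not> (\<exists>e>0. \<not> (\<forall>\<^sub>F k in sequentially. a k < e))"
    then have ev: "\<forall>\<^sub>F k in sequentially. a k < e" if "0 < e" for e using that by blast
    have "a \<longlonglongrightarrow> 0"
    proof (rule order_tendstoI)
      show "\<forall>\<^sub>F k in sequentially. y < a k" if "y < 0" for y using that by simp
      show "\<forall>\<^sub>F k in sequentially. a k < y" if "0 < y" for y using that by (rule ev)
    qed
    with assms show False by simp
  qed
  then obtain e where e: "0 < e" "\<not> (\<forall>\<^sub>F k in sequentially. a k < e)" by blast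
  obtain d where d: "0 < d" "d < e" using dense[OF e(1)] by blast
  have "d < top" by (rule less_le_trans[OF d(2) top_greatest])
  then have d_eq: "d = ennreal (enn2real d)" by simp
  have "infinite {k. d < a k}"
  proof
    assume "finite {k. d < a k}"
    then obtain n where n: "\<forall>k\<in>{k. d < a k}. k \<le> n" using finite_nat_set_iff_bounded_le by blast
    have "a k < e" if "Suc n \<le> k" for k
    proof -
      have "\<not> d < a k" using n that by auto
      then show ?thesis using d(2) by simp
    qed
    then have "\<forall>\<^sub>F k in sequentially. a k < e" unfolding eventually_sequentially by blast
    with e(2) show False by simp
  qed
  then obtain r :: "nat \<Rightarrow> nat" where r: "strict_mono r" "\<And>k. r k \<in> {k. d < a k}"
    using infinite_enumerate[of "{k. d < a k}"] by blast
  have "ennreal (enn2real d) < a (r k)" for k using r(2)[of k] d_eq by simp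
  moreover have "0 < enn2real d" using d(1) \<open>d < top\<close> by (simp add: enn2real_positive_iff)
  ultimately show ?thesis using r(1) that by blast
qed

text \<open>Three ways in which a normalized sequence can behave: its \<open>L\<^sub>1\<close> norms stay away from zero along
  a subsequence, and the \<open>L\<^sub>1\<close> norm is additive; or one row keeps mass while its single
  coordinates vanish; or every row vanishes. The last two are gliding humps, inside a row with
  constant \<open>eps n\<close> and across the rows. That the constant depends on the row is harmless here, but it is
  what spoils the dual.\<close>

lemma mixed_norm_lower_estimate:
  assumes g: "\<And>k. g k \<in> borel_measurable leb01" and norm1: "\<And>k. mixed_norm (g k) = 1"
  obtains r :: "nat \<Rightarrow> nat" and c :: real where "strict_mono r" "0 < c"
    "\<And>K b. finite K \<Longrightarrow> ennreal c * (\<Sum>k\<in>K. b k) \<le> mixed_norm (\<lambda>t. \<Sum>k\<in>K. b k * g (r k) t)"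
proof -
  consider (L1) "\<not> (\<lambda>k. \<integral>\<^sup>+t. g k t \<partial>leb01) \<longlonglongrightarrow> 0"
    | (row) n where "(\<lambda>k. \<integral>\<^sup>+t. g k t \<partial>leb01) \<longlonglongrightarrow> 0" "\<not> (\<lambda>k. row_sum n (g k)) \<longlonglongrightarrow> 0"
    | (rows) "\<And>n. (\<lambda>k. row_sum n (g k)) \<longlonglongrightarrow> 0"
    by blast
  then show ?thesis
  proof cases
    case L1
    obtain \<delta> and r :: "nat \<Rightarrow> nat" where \<delta>: "0 < \<delta>" and r: "strict_mono r"
      and gt: "\<And>k. ennreal \<delta> < (\<integral>\<^sup>+t. g (r k) t \<partial>leb01)"
      by (rule not_null_subsequence[OF L1]) blast
    show ?thesis
    proof (rule that[OF r, of "\<delta> / 2"])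
      show "0 < \<delta> / 2" using \<delta> by simp
      fix K :: "nat set" and b :: "nat \<Rightarrow> ennreal" assume K: "finite K"
      have "ennreal \<delta> * (\<Sum>k\<in>K. b k) = (\<Sum>k\<in>K. b k * ennreal \<delta>)"
        by (subst mult.commute) (rule sum_distrib_right)
      also have "\<dots> \<le> (\<Sum>k\<in>K. b k * (\<integral>\<^sup>+t. g (r k) t \<partial>leb01))"
        by (intro sum_mono mult_left_mono less_imp_le[OF gt]) auto
      also have "\<dots> = (\<integral>\<^sup>+t. (\<Sum>k\<in>K. b k * g (r k) t) \<partial>leb01)"
        using g by (simp add: nn_integral_sum nn_integral_cmult)
      also have "\<dots> \<le> 2 * mixed_norm (\<lambda>t. \<Sum>k\<in>K. b k * g (r k) t)"
        by (rule integral_le_mixed_norm) (use g in measurable)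
      finally have le: "ennreal \<delta> * (\<Sum>k\<in>K. b k) \<le> 2 * mixed_norm (\<lambda>t. \<Sum>k\<in>K. b k * g (r k) t)" .
      have half: "ennreal (1/2) * 2 = 1"
        using ennreal_mult[of "1/2" 2] by simp
      have "ennreal (\<delta> / 2) * (\<Sum>k\<in>K. b k) = ennreal (1/2) * (ennreal \<delta> * (\<Sum>k\<in>K. b k))"
        using \<delta> ennreal_mult[of "1/2" \<delta>] by (simp add: mult.assoc[symmetric])
      also have "\<dots> \<le> ennreal (1/2) * (2 * mixed_norm (\<lambda>t. \<Sum>k\<in>K. b k * g (r k) t))"
        by (rule mult_left_mono[OF le]) simp
      also have "\<dots> = mixed_norm (\<lambda>t. \<Sum>k\<in>K. b k * g (r k) t)"
        unfolding mult.assoc[symmetric] half by simp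
      finally show "ennreal (\<delta> / 2) * (\<Sum>k\<in>K. b k) \<le> mixed_norm (\<lambda>t. \<Sum>k\<in>K. b k * g (r k) t)" .
    qed
  next
    case (row n)
    obtain \<delta> and r1 :: "nat \<Rightarrow> nat" where \<delta>: "0 < \<delta>" and r1: "strict_mono r1"
      and gt: "\<And>k. ennreal \<delta> < row_sum n (g (r1 k))"
      by (rule not_null_subsequence[OF row(2)]) blast
    have null: "(\<lambda>k. rho (prod_encode (n, i)) (g (r1 k))) \<longlonglongrightarrow> 0" for i
      using LIMSEQ_subseq_LIMSEQ[OF rho_tendsto_0[OF g row(1)] r1] by (simp add: o_def)
    obtain r2 :: "nat \<Rightarrow> nat" where r2: "strict_mono r2"
      and low: "\<And>K b. finite K \<Longrightarrow> ennreal (\<delta> / 2) * (\<Sum>k\<in>K. b k)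
        \<le> (\<Sum>i. rho (prod_encode (n, i)) (\<lambda>t. \<Sum>k\<in>K. b k * g (r1 (r2 k)) t))"
      using lower_l1_estimate_subsequence[of leb01 "\<lambda>i. rho (prod_encode (n, i))" "\<lambda>k. g (r1 k)" \<delta>,
          OF sup_of_integrals_rho g \<delta> gt[unfolded row_sum_def] null] by blast
    show ?thesis
    proof (rule that[of "r1 \<circ> r2" "eps n * (\<delta> / 2)"])
      show "strict_mono (r1 \<circ> r2)" using r1 r2 by (rule strict_mono_o)
      show "0 < eps n * (\<delta> / 2)" using \<delta> by simp
      fix K :: "nat set" and b :: "nat \<Rightarrow> ennreal" assume K: "finite K"
      have "ennreal (eps n * (\<delta> / 2)) * (\<Sum>k\<in>K. b k) = ennreal (eps n) * (ennreal (\<delta> / 2) * (\<Sum>k\<in>K. b k))"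
        using \<delta> ennreal_mult[of "eps n" "\<delta> / 2"] by (simp add: mult.assoc)
      also have "\<dots> \<le> ennreal (eps n) * row_sum n (\<lambda>t. \<Sum>k\<in>K. b k * g (r1 (r2 k)) t)"
        unfolding row_sum_def by (rule mult_left_mono[OF low[OF K]]) simp
      also have "\<dots> \<le> mixed_norm (\<lambda>t. \<Sum>k\<in>K. b k * g (r1 (r2 k)) t)"
        by (rule order_trans[OF eps_row_sum_le_row_norm row_norm_le_mixed_norm])
      finally show "ennreal (eps n * (\<delta> / 2)) * (\<Sum>k\<in>K. b k) \<le> mixed_norm (\<lambda>t. \<Sum>k\<in>K. b k * g ((r1 \<circ> r2) k) t)"
        by simp
    qed
  next
    case rows
    have null: "(\<lambda>k. row_norm n (g k)) \<longlonglongrightarrow> 0" for n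
      by (rule tendsto_sandwich[OF _ _ tendsto_const rows[of n]]) (auto simp: row_norm_le_row_sum)
    have large: "ennreal (1/2) < (\<Sum>n. row_norm n (g k))" for k
    proof -
      have "ennreal (1/2) < ennreal 1" by (subst ennreal_less_iff) auto
      then show ?thesis using norm1[of k] by (simp add: mixed_norm_def)
    qed
    obtain r :: "nat \<Rightarrow> nat" where r: "strict_mono r"
      and low: "\<And>K b. finite K \<Longrightarrow> ennreal (1/2 / 2) * (\<Sum>k\<in>K. b k)
        \<le> (\<Sum>n. row_norm n (\<lambda>t. \<Sum>k\<in>K. b k * g (r k) t))"
      using lower_l1_estimate_subsequence[of leb01 row_norm g "1/2",
          OF sup_of_integrals_row_norm g _ large null] by auto
    show ?thesis
      by (rule that[OF r, of "1/2/2"]) (use low in \<open>auto simp: mixed_norm_def\<close>)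
  qed
qed

lemma lp_norm_lin_comb_unit_seq:
  assumes "finite {n. a n \<noteq> 0}"
  shows "lp_norm p (lin_comb a unit_seq) = (\<Sum>n | a n \<noteq> 0. \<bar>a n\<bar> powr p) powr (1 / p)"
proof -
  have "lin_comb a unit_seq k = a k" for k
  proof -
    have "lin_comb a unit_seq k = (\<Sum>n | a n \<noteq> 0. if n = k then a n else 0)"
      unfolding lin_comb_def unit_seq_def by (intro sum.cong) auto
    then show ?thesis using assms by (simp add: sum.delta')
  qed
  then have "lp_norm p (lin_comb a unit_seq) = (\<Sum>k. \<bar>a k\<bar> powr p) powr (1 / p)"
    unfolding lp_norm_def by simp
  also have "(\<Sum>k. \<bar>a k\<bar> powr p) = (\<Sum>n | a n \<noteq> 0. \<bar>a n\<bar> powr p)"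
    by (rule suminf_finite[OF assms]) auto
  finally show ?thesis .
qed

text \<open>For disjoint functions \<open>pw p\<close> turns linear combinations into nonnegative combinations, so that
  subadditivity gives the upper \<open>l\<^sub>p\<close> estimate and \<open>mixed_norm_lower_estimate\<close> the lower one.\<close>

lemma p_disjointly_homogeneous_mixed_space:
  assumes p: "1 < p"
  shows "p_disjointly_homogeneous p (mixed_space p)"
  unfolding p_disjointly_homogeneous_def
proof (intro allI impI)
  let ?X = "mixed_space p"
  fix x assume x: "normalized_disjoint_seq ?X x"
  have xv: "x n \<in> vecs ?X" and x1: "nrm ?X (x n) = 1" for n
    using x by (auto simp: normalized_disjoint_seq_def)
  have xm: "x n \<in> borel_measurable leb01" for n by (rule mixed_space_measurable[OF xv])
  have "AE t in leb01. m \<noteq> n \<longrightarrow> x m t = 0 \<or> x n t = 0" for m n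
  proof (cases "m = n")
    case False
    then have "lat_disjoint ?X (x m) (x n)" using x by (simp add: normalized_disjoint_seq_def)
    then show ?thesis
      using lat_disjoint_function_lattice[OF banach_function_lattice_mixed_space[OF p] xv xv] by simp
  qed simp
  then have disj: "AE t in leb01. \<forall>m n. m \<noteq> n \<longrightarrow> x m t = 0 \<or> x n t = 0"
    by (simp add: AE_all_countable)
  define g where "g k = pw p (x k)" for k
  have gm: "g k \<in> borel_measurable leb01" for k unfolding g_def by (rule pw_measurable[OF xm])
  have g1: "mixed_norm (g k) = 1" for k
    using nrm_powr_mixed_space[OF p xv[of k]] x1[of k] by (simp add: g_def)
  obtain r :: "nat \<Rightarrow> nat" and c where r: "strict_mono r" and c: "0 < c"
    and low: "\<And>K b. finite K \<Longrightarrow> ennreal c * (\<Sum>k\<in>K. b k) \<le> mixed_norm (\<lambda>t. \<Sum>k\<in>K. b k * g (r k) t)"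
    by (rule mixed_norm_lower_estimate[of g, OF gm g1]) blast
  have est: "c powr (1 / p) * lp_norm p (lin_comb a unit_seq) \<le> nrm ?X (lin_comb a (x \<circ> r)) \<and>
      nrm ?X (lin_comb a (x \<circ> r)) \<le> lp_norm p (lin_comb a unit_seq)"
    if fin: "finite {n. a n \<noteq> 0}" for a
  proof -
    define K where "K = {n. a n \<noteq> 0}"
    have K: "finite K" using fin by (simp add: K_def)
    define L where "L = lin_comb a (x \<circ> r)"
    have L_eq: "L t = (\<Sum>k\<in>K. a k * x (r k) t)" for t by (simp add: L_def lin_comb_def K_def)
    have Lm: "L \<in> borel_measurable leb01" unfolding L_eq[abs_def] using xm by measurable
    define A where "A = (\<Sum>k\<in>K. \<bar>a k\<bar> powr p)"
    have A: "0 \<le> A" by (simp add: A_def sum_nonneg)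
    define u where "u t = (\<Sum>k\<in>K. ennreal (\<bar>a k\<bar> powr p) * g (r k) t)" for t
    have um: "u \<in> borel_measurable leb01" unfolding u_def using gm by measurable
    have "AE t in leb01. pw p L t = u t"
      using disj
    proof eventually_elim
      case (elim t)
      have "\<bar>L t\<bar> powr p = (\<Sum>k\<in>K. \<bar>a k * x (r k) t\<bar> powr p)"
        unfolding L_eq
      proof (rule powr_abs_sum_disjoint[OF K])
        fix i j :: nat assume "i \<noteq> j"
        then have "r i \<noteq> r j" using strict_mono_eq[OF r] by simp
        then show "a i * x (r i) t = 0 \<or> a j * x (r j) t = 0" using elim by auto
      qed
      then show ?case
        by (simp add: u_def g_def abs_mult powr_mult ennreal_mult flip: sum_ennreal)
    qed
    then have NL: "mixed_norm (pw p L) = mixed_norm u"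
      by (intro sup_of_integrals_cong_AE[OF sup_of_integrals_mixed_norm] um pw_measurable Lm)
    have "mixed_norm u \<le> (\<Sum>k\<in>K. mixed_norm (\<lambda>t. ennreal (\<bar>a k\<bar> powr p) * g (r k) t))"
      unfolding u_def using gm by (intro sup_of_integrals_sum[OF sup_of_integrals_mixed_norm] K) auto
    also have "\<dots> = (\<Sum>k\<in>K. ennreal (\<bar>a k\<bar> powr p))"
      by (simp add: sup_of_integrals_scale[OF sup_of_integrals_mixed_norm gm] g1)
    also have "\<dots> = ennreal A" by (simp add: A_def sum_ennreal)
    finally have up: "mixed_norm (pw p L) \<le> ennreal ((A powr (1 / p)) powr p)"
      using NL p A by (simp add: powr_powr)
    have Lv: "L \<in> vecs ?X" "nrm ?X L \<le> A powr (1 / p)"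
      using mixed_norm_le_iff[OF p Lm, of "A powr (1 / p)"] up by auto
    have "ennreal (c * A) = ennreal c * (\<Sum>k\<in>K. ennreal (\<bar>a k\<bar> powr p))"
      using c A by (simp add: A_def sum_ennreal ennreal_mult)
    also have "\<dots> \<le> mixed_norm u" unfolding u_def by (rule low[OF K])
    also have "\<dots> = ennreal (nrm ?X L powr p)"
      using NL nrm_powr_mixed_space[OF p Lv(1)] by simp
    finally have "c * A \<le> nrm ?X L powr p" by (subst (asm) ennreal_le_iff) auto
    then have "(c * A) powr (1 / p) \<le> (nrm ?X L powr p) powr (1 / p)"
      using c A p by (intro powr_mono2) auto
    then have "c powr (1 / p) * A powr (1 / p) \<le> nrm ?X L"
      using c A p nrm_mixed_space_nonneg[of p L] by (simp add: powr_mult powr_powr)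
    then show ?thesis using Lv(2) lp_norm_lin_comb_unit_seq[OF fin, of p] by (simp add: L_def A_def K_def)
  qed
  have cp: "0 < c powr (1 / p)" using c by simp
  have "equivalent_seqs (nrm ?X) (x \<circ> r) (lp_norm p) unit_seq"
    unfolding equivalent_seqs_def
  proof (intro exI conjI allI impI)
    show "(0::real) < 1" "0 < 1 / c powr (1 / p)" using cp by auto
    fix a :: "nat \<Rightarrow> real" assume fin: "finite {n. a n \<noteq> 0}"
    show "1 * nrm ?X (lin_comb a (x \<circ> r)) \<le> lp_norm p (lin_comb a unit_seq)"
      using est[OF fin] by simp
    show "lp_norm p (lin_comb a unit_seq) \<le> 1 / c powr (1 / p) * nrm ?X (lin_comb a (x \<circ> r))"
      using est[OF fin] cp by (simp add: pos_le_divide_eq mult.commute)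
  qed
  then show "\<exists>r. strict_mono r \<and> equivalent_seqs (nrm ?X) (x \<circ> r) (lp_norm p) unit_seq"
    using r by blast
qed

section \<open>Disjoint sequences in the dual\<close>

lemma banach_dual_closed_add:
  assumes \<phi>: "\<phi> \<in> vecs (banach_dual E)" and \<psi>: "\<psi> \<in> vecs (banach_dual E)"
  shows "(\<lambda>f. \<phi> f + \<psi> f) \<in> vecs (banach_dual E)"
proof -
  obtain C where C: "\<And>f. f \<in> vecs E \<Longrightarrow> \<bar>\<phi> f\<bar> \<le> C * nrm E f"
    by (rule banach_dual_bounded[OF \<phi>]) blast
  obtain D where D: "\<And>f. f \<in> vecs E \<Longrightarrow> \<bar>\<psi> f\<bar> \<le> D * nrm E f"
    by (rule banach_dual_bounded[OF \<psi>]) blast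
  show ?thesis
  proof (rule banach_dualI[where C="C + D"])
    show "\<bar>\<phi> f + \<psi> f\<bar> \<le> (C + D) * nrm E f" if "f \<in> vecs E" for f
      using C[OF that] D[OF that] by (simp add: distrib_right)
  qed (simp_all add: banach_dual_outside[OF \<phi>] banach_dual_outside[OF \<psi>] banach_dual_add[OF \<phi>]
      banach_dual_add[OF \<psi>] banach_dual_scale[OF \<phi>] banach_dual_scale[OF \<psi>] distrib_left)
qed

lemma banach_dual_closed_scale:
  assumes \<phi>: "\<phi> \<in> vecs (banach_dual E)"
  shows "(\<lambda>f. c * \<phi> f) \<in> vecs (banach_dual E)"
proof -
  obtain C where C: "\<And>f. f \<in> vecs E \<Longrightarrow> \<bar>\<phi> f\<bar> \<le> C * nrm E f"
    by (rule banach_dual_bounded[OF \<phi>]) blast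
  show ?thesis
  proof (rule banach_dualI[where C="\<bar>c\<bar> * C"])
    show "\<bar>c * \<phi> f\<bar> \<le> (\<bar>c\<bar> * C) * nrm E f" if "f \<in> vecs E" for f
      using mult_left_mono[OF C[OF that] abs_ge_zero[of c]] by (simp add: abs_mult mult.assoc)
  qed (simp_all add: banach_dual_outside[OF \<phi>] banach_dual_add[OF \<phi>] banach_dual_scale[OF \<phi>] distrib_left)
qed

lemma banach_dual_closed_sum:
  assumes "finite K" "\<And>k. k \<in> K \<Longrightarrow> \<phi> k \<in> vecs (banach_dual E)"
  shows "(\<lambda>f. \<Sum>k\<in>K. \<phi> k f) \<in> vecs (banach_dual E)"
  using assms
proof (induction K rule: finite_induct)
  case empty
  show ?case by (simp, rule banach_dualI[where C=0]) auto
next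
  case (insert k K)
  then show ?case using banach_dual_closed_add[of "\<phi> k" E "\<lambda>f. \<Sum>k\<in>K. \<phi> k f"] by simp
qed

lemma nrm_banach_dual_scale:
  assumes E: "banach_function_lattice E" and \<phi>: "\<phi> \<in> vecs (banach_dual E)" and c: "0 < c"
  shows "nrm (banach_dual E) (\<lambda>f. c * \<phi> f) = c * nrm (banach_dual E) \<phi>"
proof -
  have nn: "0 \<le> nrm E f" if "f \<in> vecs E" for f
    using E that by (auto simp: banach_function_lattice_def)
  have le: "nrm (banach_dual E) (\<lambda>f. c * \<psi> f) \<le> c * nrm (banach_dual E) \<psi>"
    if c: "0 < c" and \<psi>: "\<psi> \<in> vecs (banach_dual E)" for c \<psi>
  proof (rule nrm_banach_dual_le)
    fix f assume f: "f \<in> vecs E" "nrm E f \<le> 1"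
    show "\<bar>c * \<psi> f\<bar> \<le> c * nrm (banach_dual E) \<psi>"
      using mult_left_mono[OF nrm_banach_dual_ge[OF \<psi> nn f], of c] c by (simp add: abs_mult)
  qed (use zero_in_lattice[OF E] in auto)
  have "nrm (banach_dual E) \<phi> \<le> (1 / c) * nrm (banach_dual E) (\<lambda>f. c * \<phi> f)"
    using le[of "1 / c" "\<lambda>f. c * \<phi> f"] banach_dual_closed_scale[OF \<phi>, of c] c by simp
  then have "c * nrm (banach_dual E) \<phi> \<le> nrm (banach_dual E) (\<lambda>f. c * \<phi> f)"
    using c by (simp add: pos_le_divide_eq mult.commute)
  then show ?thesis using le[OF c \<phi>] by simp
qed

lemma leq_banach_dual:
  "leq (banach_dual E) \<phi> \<psi> \<longleftrightarrow> (\<forall>f\<in>vecs E. leq E (\<lambda>i. 0) f \<longrightarrow> \<phi> f \<le> \<psi> f)"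
  by (simp add: banach_dual_def)

lemma is_modulus_positive_functional:
  assumes \<phi>: "\<phi> \<in> vecs (banach_dual E)"
    and pos: "\<And>f. f \<in> vecs E \<Longrightarrow> leq E (\<lambda>i. 0) f \<Longrightarrow> 0 \<le> \<phi> f"
  shows "is_modulus (banach_dual E) \<phi> \<phi>"
  using \<phi> pos unfolding is_modulus_def leq_banach_dual by fastforce

text \<open>A positive functional is its own modulus. Splitting a nonnegative \<open>f\<close> along \<open>A\<close> shows that a common
  lower bound of the two functionals is at most zero.\<close>

lemma lat_disjoint_functionals:
  assumes E: "banach_function_lattice E"
    and \<phi>: "\<phi> \<in> vecs (banach_dual E)" "\<And>f. f \<in> vecs E \<Longrightarrow> leq E (\<lambda>i. 0) f \<Longrightarrow> 0 \<le> \<phi> f"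
    and \<psi>: "\<psi> \<in> vecs (banach_dual E)" "\<And>f. f \<in> vecs E \<Longrightarrow> leq E (\<lambda>i. 0) f \<Longrightarrow> 0 \<le> \<psi> f"
    and A: "A \<in> sets leb01"
    and \<phi>0: "\<And>f. f \<in> vecs E \<Longrightarrow> (\<And>t. t \<in> A \<Longrightarrow> f t = 0) \<Longrightarrow> \<phi> f = 0"
    and \<psi>0: "\<And>f. f \<in> vecs E \<Longrightarrow> (\<And>t. t \<notin> A \<Longrightarrow> f t = 0) \<Longrightarrow> \<psi> f = 0"
  shows "lat_disjoint (banach_dual E) \<phi> \<psi>"
proof -
  have meas: "\<And>f. f \<in> vecs E \<Longrightarrow> f \<in> borel_measurable leb01"
    and le: "\<And>f g. f \<in> vecs E \<Longrightarrow> g \<in> vecs E \<Longrightarrow> leq E f g \<longleftrightarrow> (AE t in leb01. f t \<le> g t)"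
    and solid: "\<And>f g. g \<in> vecs E \<Longrightarrow> f \<in> borel_measurable leb01 \<Longrightarrow> (AE t in leb01. \<bar>f t\<bar> \<le> \<bar>g t\<bar>) \<Longrightarrow> f \<in> vecs E"
    using E unfolding banach_function_lattice_def by blast+
  have zero: "(\<lambda>i. 0) \<in> vecs E" by (rule zero_in_lattice(1)[OF E])
  have "is_meet (banach_dual E) \<phi> \<psi> (\<lambda>f. 0)"
    unfolding is_meet_def
  proof (intro conjI ballI impI)
    show "(\<lambda>f. 0) \<in> vecs (banach_dual E)" by (rule banach_dualI[where C=0]) auto
    show "leq (banach_dual E) (\<lambda>f. 0) \<phi>" "leq (banach_dual E) (\<lambda>f. 0) \<psi>"
      using \<phi>(2) \<psi>(2) by (auto simp: leq_banach_dual)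
    fix d assume d: "d \<in> vecs (banach_dual E)" and "leq (banach_dual E) d \<phi> \<and> leq (banach_dual E) d \<psi>"
    then have dle: "\<And>f. f \<in> vecs E \<Longrightarrow> leq E (\<lambda>i. 0) f \<Longrightarrow> d f \<le> \<phi> f"
      "\<And>f. f \<in> vecs E \<Longrightarrow> leq E (\<lambda>i. 0) f \<Longrightarrow> d f \<le> \<psi> f" by (auto simp: leq_banach_dual)
    show "leq (banach_dual E) d (\<lambda>f. 0)"
      unfolding leq_banach_dual
    proof (intro ballI impI)
      fix f assume f: "f \<in> vecs E" and f0: "leq E (\<lambda>i. 0) f"
      have fpos: "AE t in leb01. 0 \<le> f t" using f0 le[OF zero f] by simp
      have in_E: "(\<lambda>t. f t * indicator B t) \<in> vecs E" "leq E (\<lambda>i. 0) (\<lambda>t. f t * indicator B t)"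
        if Bm: "(\<lambda>t. f t * indicator B t) \<in> borel_measurable leb01" for B
      proof -
        show v: "(\<lambda>t. f t * indicator B t) \<in> vecs E"
          by (rule solid[OF f Bm]) (auto simp: indicator_def)
        show "leq E (\<lambda>i. 0) (\<lambda>t. f t * indicator B t)"
          unfolding le[OF zero v] using fpos by eventually_elim (auto simp: indicator_def)
      qed
      have m1: "(\<lambda>t. f t * indicator A t) \<in> borel_measurable leb01"
        using meas[OF f] A by (intro borel_measurable_times borel_measurable_indicator)
      have "(\<lambda>t. f t - f t * indicator A t) \<in> borel_measurable leb01"
        using meas[OF f] m1 by (intro borel_measurable_diff)
      moreover have eq: "(\<lambda>t. f t - f t * indicator A t) = (\<lambda>t. f t * indicator (- A) t)"
        by (auto simp: indicator_def)
      ultimately have m2: "(\<lambda>t. f t * indicator (- A) t) \<in> borel_measurable leb01" by simp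
      have v1: "(\<lambda>t. f t * indicator A t) \<in> vecs E" "leq E (\<lambda>i. 0) (\<lambda>t. f t * indicator A t)"
        using in_E[OF m1] by auto
      have v2: "(\<lambda>t. f t * indicator (- A) t) \<in> vecs E" "leq E (\<lambda>i. 0) (\<lambda>t. f t * indicator (- A) t)"
        using in_E[OF m2] by auto
      have "f = (\<lambda>t. f t * indicator A t + f t * indicator (- A) t)" by (auto simp: indicator_def)
      then have "d f = d (\<lambda>t. f t * indicator A t) + d (\<lambda>t. f t * indicator (- A) t)"
        using banach_dual_add[OF d v1(1) v2(1)] by simp
      also have "\<dots> \<le> \<psi> (\<lambda>t. f t * indicator A t) + \<phi> (\<lambda>t. f t * indicator (- A) t)"
        by (intro add_mono dle v1 v2)
      also have "\<dots> = 0" using \<psi>0[OF v1(1)] \<phi>0[OF v2(1)] by simp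
      finally show "d f \<le> 0" .
    qed
  qed
  then show ?thesis
    unfolding lat_disjoint_def
    using is_modulus_positive_functional[OF \<phi>] is_modulus_positive_functional[OF \<psi>] by blast
qed

text \<open>For finite \<open>J\<close> its \<open>p\<close>-th power is the sum of the unit functions with indices in \<open>J\<close>; \<open>cobump p j\<close> is biorthogonal to
  the bumps.\<close>

definition bump :: "real \<Rightarrow> nat set \<Rightarrow> real \<Rightarrow> real" where
  "bump p J t = (\<Sum>j\<in>J. wt j powr (1 / p) * indicator (cell j) t)"

definition cobump :: "real \<Rightarrow> nat \<Rightarrow> real \<Rightarrow> real" where
  "cobump p j t = wt j powr (2 - 1 / p) * indicator (cell j) t"

abbreviation coord :: "real \<Rightarrow> nat \<Rightarrow> (real \<Rightarrow> real) \<Rightarrow> real" where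
  "coord p j \<equiv> pairing (mixed_space p) (cobump p j)"

lemma cobump_measurable: "cobump p j \<in> borel_measurable leb01"
  unfolding cobump_def by measurable

lemma cobump_nonneg: "0 \<le> cobump p j t" by (simp add: cobump_def)

lemma cobump_in_kothe_dual:
  assumes "1 < p" shows "cobump p j \<in> vecs (kothe_dual (mixed_space p))"
proof -
  interpret oc_lattice "kothe_dual (mixed_space p)" by (rule oc_lattice_kothe_dual[OF assms])
  show ?thesis
    by (rule bounded_vecs(1)[OF cobump_measurable, of _ _ "wt j powr (2 - 1 / p)"])
       (auto simp: cobump_def indicator_def)
qed

lemma coord_in_dual: "1 < p \<Longrightarrow> coord p j \<in> vecs (banach_dual (mixed_space p))"
  by (intro pairing_in_dual banach_function_lattice_mixed_space cobump_in_kothe_dual)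

lemma coord_nonneg:
  assumes p: "1 < p" and f: "f \<in> vecs (mixed_space p)" "leq (mixed_space p) (\<lambda>_. 0) f"
  shows "0 \<le> coord p j f"
proof -
  have "AE t in leb01. 0 \<le> f t" using f(2) by (simp add: leq_mixed_space)
  then have "0 \<le> (\<integral>t. f t * cobump p j t \<partial>leb01)"
    by (intro integral_nonneg_AE) (auto elim!: eventually_mono simp: cobump_nonneg)
  then show ?thesis using f by (simp add: pairing_def)
qed

lemma coord_eq_0:
  assumes "\<And>t. t \<in> cell j \<Longrightarrow> f t = 0"
  shows "coord p j f = 0"
proof -
  have "(\<lambda>t. f t * cobump p j t) = (\<lambda>_. 0)"
    using assms by (auto simp: cobump_def indicator_def fun_eq_iff)
  then show ?thesis unfolding pairing_def by simp
qed

text \<open>On \<open>cell j\<close> the integrand is \<open>(wt j)\<^sup>2\<close> times \<open>\<bar>f\<bar> / wt j powr (1/p)\<close>, to which \<open>le_add_powr\<close> applies; the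
  cell has measure \<open>1/(wt j)\<^sup>2\<close> and is seen in full by \<open>rho j\<close>.\<close>

lemma coord_le_rho:
  assumes p: "1 < p" and f: "f \<in> vecs (mixed_space p)" and d: "0 < d"
  shows "ennreal \<bar>coord p j f\<bar> \<le> ennreal d + ennreal (d powr (1 - p)) * rho j (pw p f)"
proof -
  have fm: "f \<in> borel_measurable leb01" by (rule mixed_space_measurable[OF f])
  have pt: "\<bar>f t * cobump p j t\<bar> \<le> (wt j ^ 2 * d) * indicator (cell j) t
      + (d powr (1 - p) * wt j) * (\<bar>f t\<bar> powr p * indicator (cell j) t)" for t
  proof (cases "t \<in> cell j")
    case True
    define z where "z = \<bar>f t\<bar> * wt j powr (- (1 / p))"
    have "z \<le> d + d powr (1 - p) * z powr p" by (rule le_add_powr[OF p _ d]) (simp add: z_def)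
    also have "z powr p = \<bar>f t\<bar> powr p / wt j"
      using p by (simp add: z_def powr_mult powr_powr powr_minus_divide powr_divide)
    finally have "wt j ^ 2 * z \<le> wt j ^ 2 * (d + d powr (1 - p) * (\<bar>f t\<bar> powr p / wt j))"
      by (rule mult_left_mono) simp
    also have "\<dots> = wt j ^ 2 * d + d powr (1 - p) * wt j * \<bar>f t\<bar> powr p"
      by (simp add: field_simps power2_eq_square)
    finally have "wt j ^ 2 * z \<le> wt j ^ 2 * d + d powr (1 - p) * wt j * \<bar>f t\<bar> powr p" .
    moreover have "\<bar>f t * cobump p j t\<bar> = wt j ^ 2 * z"
    proof -
      have "wt j powr (2 - 1 / p) = wt j powr (2 + - (1 / p))" by simp
      also have "\<dots> = wt j powr 2 * wt j powr (- (1 / p))" by (rule powr_add)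
      finally have "wt j powr (2 - 1 / p) = wt j ^ 2 * wt j powr (- (1 / p))"
        by (simp add: powr_numeral)
      then show ?thesis using True by (simp add: cobump_def z_def abs_mult)
    qed
    ultimately show ?thesis using True by simp
  qed (simp add: cobump_def)
  have "\<bar>coord p j f\<bar> \<le> (\<integral>t. \<bar>f t * cobump p j t\<bar> \<partial>leb01)"
    using f by (simp add: pairing_def integral_abs_bound)
  then have "ennreal \<bar>coord p j f\<bar> \<le> ennreal (\<integral>t. \<bar>f t * cobump p j t\<bar> \<partial>leb01)" by (rule ennreal_leI)
  also have "\<dots> = (\<integral>\<^sup>+t. ennreal \<bar>f t * cobump p j t\<bar> \<partial>leb01)"
    using pairing_integrable(1)[OF banach_function_lattice_mixed_space[OF p] cobump_in_kothe_dual[OF p] f]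
    by (intro nn_integral_eq_integral[symmetric] integrable_abs) auto
  also have "\<dots> \<le> (\<integral>\<^sup>+t. ennreal (wt j ^ 2 * d) * indicator (cell j) t
      + ennreal (d powr (1 - p) * wt j) * (pw p f t * indicator (cell j) t) \<partial>leb01)"
  proof (rule nn_integral_mono)
    fix t
    have "ennreal \<bar>f t * cobump p j t\<bar> \<le> ennreal ((wt j ^ 2 * d) * indicator (cell j) t
      + (d powr (1 - p) * wt j) * (\<bar>f t\<bar> powr p * indicator (cell j) t))"
      by (rule ennreal_leI[OF pt])
    also have "\<dots> = ennreal (wt j ^ 2 * d) * indicator (cell j) t
      + ennreal (d powr (1 - p) * wt j) * (pw p f t * indicator (cell j) t)"
      using d by (cases "t \<in> cell j") (simp_all add: ennreal_mult ennreal_plus)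
    finally show "ennreal \<bar>f t * cobump p j t\<bar> \<le> ennreal (wt j ^ 2 * d) * indicator (cell j) t
      + ennreal (d powr (1 - p) * wt j) * (pw p f t * indicator (cell j) t)" .
  qed
  also have "\<dots> = ennreal (wt j ^ 2 * d) * emeasure leb01 (cell j)
      + ennreal (d powr (1 - p) * wt j) * (\<integral>\<^sup>+t. pw p f t * indicator (cell j) t \<partial>leb01)"
    using fm by (simp add: nn_integral_add nn_integral_cmult nn_integral_cmult_indicator)
  also have "ennreal (wt j ^ 2 * d) * emeasure leb01 (cell j) = ennreal d"
    using d by (simp add: emeasure_cell flip: ennreal_mult)
  also have "ennreal (d powr (1 - p) * wt j) * (\<integral>\<^sup>+t. pw p f t * indicator (cell j) t \<partial>leb01)
      = ennreal (d powr (1 - p)) * (ennreal (wt j) * (\<integral>\<^sup>+t. pw p f t * indicator (cell j) t \<partial>leb01))"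
    by (simp add: ennreal_mult mult.assoc)
  also have "ennreal d + \<dots> \<le> ennreal d + ennreal (d powr (1 - p)) * rho j (pw p f)"
    using fm by (intro add_left_mono mult_left_mono rho_ge_set_integral) (auto simp: emeasure_cell)
  finally show ?thesis .
qed

lemma rho_le_mixed_norm: "rho j u \<le> mixed_norm u"
  using order_trans[OF rho_le_row_norm[of "fst (prod_decode j)" "snd (prod_decode j)" u] row_norm_le_mixed_norm]
  by simp

lemma coord_le_nrm:
  assumes p: "1 < p" and f: "f \<in> vecs (mixed_space p)"
  shows "\<bar>coord p j f\<bar> \<le> 2 * nrm (mixed_space p) f"
proof (rule field_le_epsilon)
  fix e :: real assume e: "0 < e"
  define d where "d = nrm (mixed_space p) f + e / 2"
  have d: "0 < d" "nrm (mixed_space p) f \<le> d" using e nrm_mixed_space_nonneg[of p f] by (auto simp: d_def)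
  have "mixed_norm (pw p f) \<le> ennreal (d powr p)"
    using mixed_norm_le_iff[OF p mixed_space_measurable[OF f], of d] d f by simp
  then have r: "rho j (pw p f) \<le> ennreal (d powr p)" by (rule order_trans[OF rho_le_mixed_norm])
  have "ennreal \<bar>coord p j f\<bar> \<le> ennreal d + ennreal (d powr (1 - p)) * ennreal (d powr p)"
    by (rule order_trans[OF coord_le_rho[OF p f d(1)] add_left_mono[OF mult_left_mono[OF r]]]) simp
  also have "\<dots> = ennreal (d + d powr (1 - p) * d powr p)"
    using d by (simp flip: ennreal_mult ennreal_plus)
  also have "d + d powr (1 - p) * d powr p = 2 * d" using d by (simp flip: powr_add)
  finally have "\<bar>coord p j f\<bar> \<le> 2 * d" using d by (subst (asm) ennreal_le_iff) auto
  then show "\<bar>coord p j f\<bar> \<le> 2 * nrm (mixed_space p) f + e" by (simp add: d_def)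
qed

lemma bump_measurable: "bump p J \<in> borel_measurable leb01"
  unfolding bump_def by measurable

lemma pw_bump:
  assumes p: "1 < p" and J: "finite J"
  shows "pw p (bump p J) t = (\<Sum>j\<in>J. unit_fun j t)"
proof -
  have "\<bar>bump p J t\<bar> powr p = (\<Sum>j\<in>J. \<bar>wt j powr (1 / p) * indicator (cell j) t\<bar> powr p)"
    unfolding bump_def
  proof (rule powr_abs_sum_disjoint[OF J])
    fix i j :: nat assume "i \<noteq> j"
    then show "wt i powr (1 / p) * indicator (cell i) t = 0 \<or> wt j powr (1 / p) * indicator (cell j) t = 0"
      using cell_disjoint[of i j] by (auto simp: indicator_def)
  qed
  also have "\<dots> = (\<Sum>j\<in>J. wt j * indicator (cell j) t)"
    using p by (intro sum.cong) (auto simp: indicator_def powr_powr)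
  finally have "pw p (bump p J) t = ennreal (\<Sum>j\<in>J. wt j * indicator (cell j) t)" by simp
  also have "\<dots> = (\<Sum>j\<in>J. ennreal (wt j * indicator (cell j) t))" by (rule sum_ennreal[symmetric]) simp
  also have "\<dots> = (\<Sum>j\<in>J. unit_fun j t)" by (intro sum.cong) (auto simp: unit_fun_def indicator_def)
  finally show ?thesis .
qed

text \<open>The constant is \<open>9 + 1\<close> from \<open>mixed_norm_row_of_unit_funs\<close>, and \<open>10 \<le> 10 powr p\<close>.\<close>

lemma bump_row:
  assumes p: "1 < p" and K: "finite K" and m: "eps n * card K \<le> 1"
  shows "bump p ((\<lambda>k. prod_encode (n, k)) ` K) \<in> vecs (mixed_space p)"
    "nrm (mixed_space p) (bump p ((\<lambda>k. prod_encode (n, k)) ` K)) \<le> 10"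
proof -
  let ?f = "bump p ((\<lambda>k. prod_encode (n, k)) ` K)"
  have inj: "inj_on (\<lambda>k. prod_encode (n, k)) K" by (auto simp: inj_on_def)
  have "pw p ?f = (\<lambda>t. \<Sum>k\<in>K. unit_fun (prod_encode (n, k)) t)"
    using pw_bump[OF p, of "(\<lambda>k. prod_encode (n, k)) ` K"] K by (simp add: sum.reindex[OF inj])
  then have "mixed_norm (pw p ?f) \<le> ennreal (9 + eps n * card K)"
    using mixed_norm_row_of_unit_funs[OF K, of n] by simp
  also have "\<dots> \<le> ennreal (10 powr p)"
  proof (rule ennreal_leI)
    have "(10::real) powr 1 \<le> 10 powr p" using p by (intro powr_mono) auto
    then show "9 + eps n * card K \<le> 10 powr p" using m by simp
  qed
  finally show "?f \<in> vecs (mixed_space p)" "nrm (mixed_space p) ?f \<le> 10"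
    using mixed_norm_le_iff[OF p bump_measurable[of p "(\<lambda>k. prod_encode (n, k)) ` K"], of 10] by auto
qed

lemma coord_bump:
  assumes p: "1 < p" and J: "finite J" and v: "bump p J \<in> vecs (mixed_space p)"
  shows "coord p i (bump p J) = of_bool (i \<in> J)"
proof -
  have "bump p J t * cobump p i t = of_bool (i \<in> J) * (wt i ^ 2 * indicator (cell i) t)" for t
  proof (cases "t \<in> cell i")
    case True
    have "bump p J t = (\<Sum>j\<in>J. if j = i then wt i powr (1 / p) else 0)"
      unfolding bump_def
    proof (rule sum.cong[OF refl])
      fix j
      show "wt j powr (1 / p) * indicator (cell j) t = (if j = i then wt i powr (1 / p) else 0)"
        using True cell_disjoint[of i j] by (auto simp: indicator_def)
    qed
    also have "\<dots> = of_bool (i \<in> J) * wt i powr (1 / p)" using J by simp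
    finally have b: "bump p J t = of_bool (i \<in> J) * wt i powr (1 / p)" .
    have "wt i powr (1 / p) * wt i powr (2 - 1 / p) = wt i ^ 2" by (simp flip: powr_add)
    then show ?thesis unfolding b cobump_def using True by simp
  qed (simp add: cobump_def)
  then have "coord p i (bump p J) = of_bool (i \<in> J) * (wt i ^ 2 * measure leb01 (cell i))"
    using v cell_subset[of i] by (simp add: pairing_def Int_absorb2)
  also have "wt i ^ 2 * measure leb01 (cell i) = 1"
    by (simp add: measure_def emeasure_cell)
  finally show ?thesis by simp
qed

text \<open>One coordinate functional from every row. The geometric weights keep the series bounded; they
  decay more slowly than any power of \<open>eps n\<close>.\<close>

definition column_functional :: "real \<Rightarrow> nat \<Rightarrow> (real \<Rightarrow> real) \<Rightarrow> real" where
  "column_functional p k f = (\<Sum>n. (1/2) ^ n * coord p (prod_encode (n, k)) f)"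

lemma column_summable:
  assumes p: "1 < p" and f: "f \<in> vecs (mixed_space p)"
  shows "summable (\<lambda>n. (1/2) ^ n * coord p (prod_encode (n, k)) f)"
    "\<bar>column_functional p k f\<bar> \<le> 4 * nrm (mixed_space p) f"
proof -
  define B where "B = 2 * nrm (mixed_space p) f"
  have gs: "(\<lambda>n. (1/2::real) ^ n * B) sums (2 * B)"
    using sums_mult2[OF geometric_sums[of "1/2::real"], of B] by simp
  have bd: "norm ((1/2) ^ n * coord p (prod_encode (n, k)) f) \<le> (1/2) ^ n * B" for n
    unfolding real_norm_def abs_mult B_def using coord_le_nrm[OF p f]
    by (simp add: mult_left_mono del: power_divide)
  have sn: "summable (\<lambda>n. norm ((1/2) ^ n * coord p (prod_encode (n, k)) f))"
    by (rule summable_comparison_test'[OF sums_summable[OF gs], of 0]) (use bd in simp)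
  then show "summable (\<lambda>n. (1/2) ^ n * coord p (prod_encode (n, k)) f)"
    by (rule summable_norm_cancel)
  have "\<bar>column_functional p k f\<bar> \<le> (\<Sum>n. norm ((1/2) ^ n * coord p (prod_encode (n, k)) f))"
    unfolding column_functional_def using summable_norm[OF sn] by (simp only: real_norm_def)
  also have "\<dots> \<le> (\<Sum>n. (1/2::real) ^ n * B)"
    by (rule suminf_le[OF bd sn sums_summable[OF gs]])
  also have "\<dots> = 2 * B" using gs by (rule sums_unique[symmetric])
  finally show "\<bar>column_functional p k f\<bar> \<le> 4 * nrm (mixed_space p) f" by (simp add: B_def)
qed

lemma column_in_dual:
  assumes p: "1 < p"
  shows "column_functional p k \<in> vecs (banach_dual (mixed_space p))"
proof (rule banach_dualI)
  show "column_functional p k f = 0" if "f \<notin> vecs (mixed_space p)" for f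
    using that by (simp add: column_functional_def pairing_def)
  show "\<bar>column_functional p k f\<bar> \<le> 4 * nrm (mixed_space p) f" if "f \<in> vecs (mixed_space p)" for f
    by (rule column_summable(2)[OF p that])
  show "column_functional p k (\<lambda>t. f t + g t) = column_functional p k f + column_functional p k g"
    if f: "f \<in> vecs (mixed_space p)" and g: "g \<in> vecs (mixed_space p)" for f g
    unfolding column_functional_def banach_dual_add[OF coord_in_dual[OF p] f g] distrib_left
    by (rule suminf_add[OF column_summable(1)[OF p f] column_summable(1)[OF p g], symmetric])
  show "column_functional p k (\<lambda>t. c * f t) = c * column_functional p k f" if f: "f \<in> vecs (mixed_space p)" for f c
    unfolding column_functional_def banach_dual_scale[OF coord_in_dual[OF p] f] mult.left_commute[of _ c]
    by (rule suminf_mult[OF column_summable(1)[OF p f]])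
qed

lemma column_nonneg:
  assumes p: "1 < p" and f: "f \<in> vecs (mixed_space p)" "leq (mixed_space p) (\<lambda>_. 0) f"
  shows "0 \<le> column_functional p k f"
  unfolding column_functional_def
  by (rule suminf_nonneg[OF column_summable(1)[OF p f(1)]]) (simp add: coord_nonneg[OF p f])

lemma column_eq_0:
  assumes "\<And>t n. t \<in> cell (prod_encode (n, k)) \<Longrightarrow> f t = 0"
  shows "column_functional p k f = 0"
proof -
  have "coord p (prod_encode (n, k)) f = 0" for n by (rule coord_eq_0) (rule assms)
  then show ?thesis by (simp add: column_functional_def)
qed

lemma column_bump_row:
  assumes p: "1 < p" and K: "finite K" and v: "bump p ((\<lambda>k. prod_encode (n, k)) ` K) \<in> vecs (mixed_space p)"
    and k: "k \<in> K"
  shows "column_functional p k (bump p ((\<lambda>k. prod_encode (n, k)) ` K)) = (1/2) ^ n"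
proof -
  let ?f = "bump p ((\<lambda>k. prod_encode (n, k)) ` K)"
  have c: "coord p (prod_encode (n', k)) ?f = of_bool (n' = n)" for n'
    using coord_bump[OF p _ v] K k by (auto simp: of_bool_def)
  have "column_functional p k ?f = (\<Sum>n'\<in>{n}. (1/2) ^ n' * coord p (prod_encode (n', k)) ?f)"
    unfolding column_functional_def by (rule suminf_finite) (auto simp: c)
  then show ?thesis by (simp add: c)
qed

definition unit_functional :: "real \<Rightarrow> ((real \<Rightarrow> real) \<Rightarrow> real) \<Rightarrow> (real \<Rightarrow> real) \<Rightarrow> real" where
  "unit_functional p \<phi> f = 1 / nrm (banach_dual (mixed_space p)) \<phi> * \<phi> f"

lemma normalized_disjoint_functionals:
  assumes p: "1 < p"
    and \<phi>: "\<And>k. \<phi> k \<in> vecs (banach_dual (mixed_space p))"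
    and pos: "\<And>k f. f \<in> vecs (mixed_space p) \<Longrightarrow> leq (mixed_space p) (\<lambda>_. 0) f \<Longrightarrow> 0 \<le> \<phi> k f"
    and nz: "\<And>k. 0 < nrm (banach_dual (mixed_space p)) (\<phi> k)"
    and A: "\<And>k. A k \<in> sets leb01" "\<And>j k. j \<noteq> k \<Longrightarrow> A j \<inter> A k = {}"
    and supp: "\<And>k f. (\<And>t. t \<in> A k \<Longrightarrow> f t = 0) \<Longrightarrow> \<phi> k f = 0"
  shows "normalized_disjoint_seq (banach_dual (mixed_space p)) (\<lambda>k. unit_functional p (\<phi> k))"
proof -
  note E = banach_function_lattice_mixed_space[OF p]
  have n: "unit_functional p (\<phi> k) = (\<lambda>f. 1 / nrm (banach_dual (mixed_space p)) (\<phi> k) * \<phi> k f)" for k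
    by (simp add: unit_functional_def fun_eq_iff)
  have v: "unit_functional p (\<phi> k) \<in> vecs (banach_dual (mixed_space p))" for k
    unfolding n by (rule banach_dual_closed_scale[OF \<phi>])
  have one: "nrm (banach_dual (mixed_space p)) (unit_functional p (\<phi> k)) = 1" for k
    unfolding n using nrm_banach_dual_scale[OF E \<phi>[of k], of "1 / nrm (banach_dual (mixed_space p)) (\<phi> k)"] nz[of k]
    by simp
  have "lat_disjoint (banach_dual (mixed_space p)) (unit_functional p (\<phi> j)) (unit_functional p (\<phi> k))" if jk: "j \<noteq> k" for j k
  proof (rule lat_disjoint_functionals[OF E v _ v _ A(1)[of j]])
    show "0 \<le> unit_functional p (\<phi> j) f" "0 \<le> unit_functional p (\<phi> k) f"
      if "f \<in> vecs (mixed_space p)" "leq (mixed_space p) (\<lambda>_. 0) f" for f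
      unfolding unit_functional_def using pos[OF that, of j] nz[of j] pos[OF that, of k] nz[of k] by simp_all
    show "unit_functional p (\<phi> j) f = 0" if "\<And>t. t \<in> A j \<Longrightarrow> f t = 0" for f
      using supp[of j f] that by (simp add: unit_functional_def)
    show "unit_functional p (\<phi> k) f = 0" if "\<And>t. t \<notin> A j \<Longrightarrow> f t = 0" for f
    proof -
      have "f t = 0" if "t \<in> A k" for t using \<open>\<And>t. t \<notin> A j \<Longrightarrow> f t = 0\<close>[of t] A(2)[OF jk] that by blast
      then show ?thesis using supp[of k f] by (simp add: unit_functional_def)
    qed
  qed
  then show ?thesis unfolding normalized_disjoint_seq_def using v one by blast
qed

lemma nrm_functional_ge:
  assumes p: "1 < p" and \<phi>: "\<phi> \<in> vecs (banach_dual (mixed_space p))"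
    and f: "f \<in> vecs (mixed_space p)" "nrm (mixed_space p) f \<le> 10"
  shows "\<phi> f / 10 \<le> nrm (banach_dual (mixed_space p)) \<phi>"
proof -
  have "nrm (mixed_space p) (\<lambda>t. (1/10) * f t) \<le> 1"
    using mixed_space_scale(2)[OF p f(1), of "1/10"] f(2) by simp
  then have "\<bar>\<phi> (\<lambda>t. (1/10) * f t)\<bar> \<le> nrm (banach_dual (mixed_space p)) \<phi>"
    by (rule nrm_banach_dual_ge[OF \<phi> nrm_mixed_space_nonneg mixed_space_scale(1)[OF p f(1)]])
  moreover have "\<phi> (\<lambda>t. (1/10) * f t) = (1/10) * \<phi> f" by (rule banach_dual_scale[OF \<phi> f(1)])
  ultimately show ?thesis by simp
qed

lemma first_row_bump:
  assumes p: "1 < p"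
  shows "bump p ((\<lambda>k. prod_encode (0, k)) ` {k}) \<in> vecs (mixed_space p)"
    "nrm (mixed_space p) (bump p ((\<lambda>k. prod_encode (0, k)) ` {k})) \<le> 10"
  using bump_row[OF p, of "{k}" 0] by (simp_all add: eps_def)

lemma nrm_coord_ge: 
  assumes p: "1 < p"
  shows "1 / 10 \<le> nrm (banach_dual (mixed_space p)) (coord p (prod_encode (0, k)))"
  using nrm_functional_ge[OF p coord_in_dual[OF p] first_row_bump[OF p, of k], of "prod_encode (0, k)"]
    coord_bump[OF p _ first_row_bump(1)[OF p, of k], of "prod_encode (0, k)"] by simp

lemma nrm_column_bounds:
  assumes p: "1 < p"
  shows "0 < nrm (banach_dual (mixed_space p)) (column_functional p k)"
    "nrm (banach_dual (mixed_space p)) (column_functional p k) \<le> 4"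
proof -
  have "1 / 10 \<le> nrm (banach_dual (mixed_space p)) (column_functional p k)"
    using nrm_functional_ge[OF p column_in_dual[OF p] first_row_bump[OF p, of k], of k]
      column_bump_row[OF p _ first_row_bump(1)[OF p, of k], of k] by simp
  then show "0 < nrm (banach_dual (mixed_space p)) (column_functional p k)" by simp
  show "nrm (banach_dual (mixed_space p)) (column_functional p k) \<le> 4"
  proof (rule nrm_banach_dual_le)
    fix f assume f: "f \<in> vecs (mixed_space p)" "nrm (mixed_space p) f \<le> 1"
    then show "\<bar>column_functional p k f\<bar> \<le> 4" using column_summable(2)[OF p f(1), of k] by simp
  qed (use zero_in_lattice[OF banach_function_lattice_mixed_space[OF p]] in auto)
qed

text \<open>In row \<open>0\<close> the lower \<open>l\<^sub>p\<close> estimate of the space holds with constant \<open>eps 0 = 1\<close>, and this is its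
  dual form.\<close>

lemma coord_sum_upper:
  assumes p: "1 < p" and K: "finite K" "K \<noteq> {}"
  shows "nrm (banach_dual (mixed_space p)) (\<lambda>f. \<Sum>k\<in>K. unit_functional p (coord p (prod_encode (0, k))) f)
    \<le> 20 * card K powr (1 - 1 / p)"
proof (rule nrm_banach_dual_le)
  fix f assume f: "f \<in> vecs (mixed_space p)" "nrm (mixed_space p) f \<le> 1"
  define m where "m = real (card K)"
  have m: "0 < m" using K by (simp add: m_def card_gt_0_iff)
  \<comment> \<open>This value balances the two terms of \<open>coord_le_rho\<close> after summation over \<open>K\<close>.\<close>
  define d where "d = m powr (- (1 / p))"
  have d: "0 < d" using m by (simp add: d_def)
  have "(\<Sum>k\<in>K. rho (prod_encode (0, k)) (pw p f)) \<le> row_sum 0 (pw p f)"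
    unfolding row_sum_def using K(1) by (intro sum_le_suminf) auto
  also have "\<dots> = ennreal (eps 0) * row_sum 0 (pw p f)" by (simp add: eps_def)
  also have "\<dots> \<le> mixed_norm (pw p f)" by (rule order_trans[OF eps_row_sum_le_row_norm row_norm_le_mixed_norm])
  also have "\<dots> \<le> ennreal 1"
    using mixed_norm_le_iff[OF p mixed_space_measurable[OF f(1)], of 1] f by simp
  finally have rs: "(\<Sum>k\<in>K. rho (prod_encode (0, k)) (pw p f)) \<le> ennreal 1" .
  have "ennreal (\<Sum>k\<in>K. \<bar>coord p (prod_encode (0, k)) f\<bar>) = (\<Sum>k\<in>K. ennreal \<bar>coord p (prod_encode (0, k)) f\<bar>)"
    by (rule sum_ennreal[symmetric]) simp
  also have "\<dots> \<le> (\<Sum>k\<in>K. ennreal d + ennreal (d powr (1 - p)) * rho (prod_encode (0, k)) (pw p f))"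
    by (intro sum_mono coord_le_rho[OF p f(1) d])
  also have "\<dots> = (\<Sum>k\<in>K. ennreal d) + ennreal (d powr (1 - p)) * (\<Sum>k\<in>K. rho (prod_encode (0, k)) (pw p f))"
    by (simp add: sum.distrib sum_distrib_left)
  also have "\<dots> \<le> ennreal (m * d) + ennreal (d powr (1 - p)) * ennreal 1"
    using d m by (intro add_mono mult_left_mono rs) (auto simp: m_def ennreal_mult ennreal_of_nat_eq_real_of_nat)
  also have "\<dots> = ennreal (m * d + d powr (1 - p))" using d m by (simp flip: ennreal_plus)
  finally have "(\<Sum>k\<in>K. \<bar>coord p (prod_encode (0, k)) f\<bar>) \<le> m * d + d powr (1 - p)"
    using d m by (subst (asm) ennreal_le_iff) auto
  also have "m * d = m powr (1 - 1 / p)"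
    using m by (simp add: d_def powr_diff powr_minus_divide)
  also have "d powr (1 - p) = m powr (1 - 1 / p)"
  proof -
    have "- (1 / p) * (1 - p) = 1 - 1 / p" using p by (simp add: field_simps)
    then show ?thesis by (simp only: d_def powr_powr)
  qed
  finally have s: "(\<Sum>k\<in>K. \<bar>coord p (prod_encode (0, k)) f\<bar>) \<le> 2 * m powr (1 - 1 / p)" by simp
  have "\<bar>unit_functional p (coord p (prod_encode (0, k))) f\<bar> \<le> 10 * \<bar>coord p (prod_encode (0, k)) f\<bar>" for k
  proof -
    define z where "z = 1 / nrm (banach_dual (mixed_space p)) (coord p (prod_encode (0, k)))"
    have "z \<le> 1 / (1 / 10)"
      unfolding z_def using nrm_coord_ge[OF p, of k] by (intro divide_left_mono) auto
    moreover have "0 \<le> z" unfolding z_def using nrm_coord_ge[OF p, of k] by simp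
    ultimately have "\<bar>z\<bar> \<le> 10" by simp
    then show ?thesis unfolding unit_functional_def z_def[symmetric] abs_mult by (rule mult_right_mono) simp
  qed
  then have "(\<Sum>k\<in>K. \<bar>unit_functional p (coord p (prod_encode (0, k))) f\<bar>) \<le> (\<Sum>k\<in>K. 10 * \<bar>coord p (prod_encode (0, k)) f\<bar>)"
    by (intro sum_mono)
  also have "\<dots> \<le> 20 * m powr (1 - 1 / p)" using s by (simp flip: sum_distrib_left)
  finally show "\<bar>\<Sum>k\<in>K. unit_functional p (coord p (prod_encode (0, k))) f\<bar> \<le> 20 * real (card K) powr (1 - 1 / p)"
    using order_trans[OF sum_abs] by (simp add: m_def)
qed (use zero_in_lattice[OF banach_function_lattice_mixed_space[OF p]] in auto)

text \<open>Tested on unit functions in the row \<open>n\<close> only, whose sum has norm at most \<open>10\<close>.\<close>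

lemma column_sum_lower:
  assumes p: "1 < p" and K: "finite K" and m: "eps n * card K \<le> 1"
  shows "card K * (1/2) ^ n / 40
    \<le> nrm (banach_dual (mixed_space p)) (\<lambda>f. \<Sum>k\<in>K. unit_functional p (column_functional p k) f)"
proof -
  let ?f = "bump p ((\<lambda>k. prod_encode (n, k)) ` K)"
  note f = bump_row[OF p K m]
  have "(1/2) ^ n / 4 \<le> unit_functional p (column_functional p k) ?f" if "k \<in> K" for k
  proof -
    have "1 / 4 \<le> 1 / nrm (banach_dual (mixed_space p)) (column_functional p k)"
      using nrm_column_bounds[OF p, of k] by (intro divide_left_mono) auto
    then have "1 / 4 * (1/2) ^ n \<le> 1 / nrm (banach_dual (mixed_space p)) (column_functional p k) * (1/2) ^ n"
      by (rule mult_right_mono) simp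
    then show ?thesis unfolding unit_functional_def column_bump_row[OF p K f(1) that] by (simp only: mult.commute divide_inverse mult_1_left)
  qed
  then have "(\<Sum>k\<in>K. (1/2) ^ n / 4) \<le> (\<Sum>k\<in>K. unit_functional p (column_functional p k) ?f)" by (intro sum_mono)
  then have "card K * ((1/2) ^ n / 4) \<le> (\<Sum>k\<in>K. unit_functional p (column_functional p k) ?f)" by (simp only: sum_constant)
  moreover have "(\<lambda>f. \<Sum>k\<in>K. unit_functional p (column_functional p k) f) \<in> vecs (banach_dual (mixed_space p))"
  proof (rule banach_dual_closed_sum[OF K])
    fix k
    have "unit_functional p (column_functional p k) = (\<lambda>f. 1 / nrm (banach_dual (mixed_space p)) (column_functional p k) * column_functional p k f)"
      by (simp add: unit_functional_def fun_eq_iff)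
    then show "unit_functional p (column_functional p k) \<in> vecs (banach_dual (mixed_space p))"
      by (simp only: banach_dual_closed_scale[OF column_in_dual[OF p, of k]])
  qed
  then have "(\<Sum>k\<in>K. unit_functional p (column_functional p k) ?f) / 10
      \<le> nrm (banach_dual (mixed_space p)) (\<lambda>f. \<Sum>k\<in>K. unit_functional p (column_functional p k) f)"
    by (rule nrm_functional_ge[OF p _ f])
  ultimately show ?thesis by linarith
qed

text \<open>Equivalence of subsequences would bound \<open>m / 2^n\<close> by a multiple of \<open>m powr (1 - 1/p)\<close> for
  \<open>m = 4 ^ n\<^sup>2 = 1 / eps n\<close>, hence \<open>m powr (1/p) / 2^n\<close> by a constant; but \<open>m powr (1/p) \<ge> 4^n\<close> once
  \<open>n \<ge> p\<close>.\<close>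

lemma not_disjointly_homogeneous_dual_mixed_space:
  assumes p: "1 < p"
  shows "\<not> disjointly_homogeneous (banach_dual (mixed_space p))"
proof
  let ?D = "banach_dual (mixed_space p)"
  define x where "x k = unit_functional p (coord p (prod_encode (0, k)))" for k
  define y where "y k = unit_functional p (column_functional p k)" for k
  assume "disjointly_homogeneous ?D"
  moreover have "normalized_disjoint_seq ?D x"
    unfolding x_def
  proof (rule normalized_disjoint_functionals[OF p coord_in_dual[OF p] coord_nonneg[OF p], where A="\<lambda>k. cell (prod_encode (0, k))"])
    show "0 < nrm ?D (coord p (prod_encode (0, k)))" for k using nrm_coord_ge[OF p, of k] by simp
    show "cell (prod_encode (0, k)) \<in> sets leb01" for k by simp
    show "cell (prod_encode (0, j)) \<inter> cell (prod_encode (0, k)) = {}" if "j \<noteq> k" for j k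
      using that by (intro cell_disjoint) simp
    show "coord p (prod_encode (0, k)) f = 0" if "\<And>t. t \<in> cell (prod_encode (0, k)) \<Longrightarrow> f t = 0" for k f
      by (rule coord_eq_0) (rule that)
  qed
  moreover have "normalized_disjoint_seq ?D y"
    unfolding y_def
  proof (rule normalized_disjoint_functionals[OF p column_in_dual[OF p] column_nonneg[OF p], where A="\<lambda>k. \<Union>n. cell (prod_encode (n, k))"])
    show "0 < nrm ?D (column_functional p k)" for k by (rule nrm_column_bounds(1)[OF p])
    show "(\<Union>n. cell (prod_encode (n, k))) \<in> sets leb01" for k by (intro sets.countable_UN) auto
    show "(\<Union>n. cell (prod_encode (n, j))) \<inter> (\<Union>n. cell (prod_encode (n, k))) = {}" if jk: "j \<noteq> k" for j k
    proof -
      have "cell (prod_encode (n, j)) \<inter> cell (prod_encode (n', k)) = {}" for n n'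
        using jk by (intro cell_disjoint) simp
      then show ?thesis by blast
    qed
    show "column_functional p k f = 0" if "\<And>t. t \<in> (\<Union>n. cell (prod_encode (n, k))) \<Longrightarrow> f t = 0" for k f
      by (rule column_eq_0) (use that in blast)
  qed
  ultimately obtain r s :: "nat \<Rightarrow> nat" where r: "strict_mono r" and s: "strict_mono s"
    and eq: "equivalent_seqs (nrm ?D) (x \<circ> r) (nrm ?D) (y \<circ> s)"
    unfolding disjointly_homogeneous_def by blast
  obtain C where C: "0 < C" "\<And>a. finite {n. a n \<noteq> 0} \<Longrightarrow>
      nrm ?D (lin_comb a (y \<circ> s)) \<le> C * nrm ?D (lin_comb a (x \<circ> r))"
    using eq unfolding equivalent_seqs_def by blast
  have bound: "2 ^ n \<le> 800 * C" if n: "p \<le> real n" for n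
  proof -
    \<comment> \<open>The largest number of unit functions in row \<open>n\<close> for which \<open>bump_row\<close> applies.\<close>
    define m :: nat where "m = 4 ^ (n^2)"
    have m: "0 < m" by (simp add: m_def)
    have em: "eps n * m = 1" by (simp add: eps_def m_def power_one_over)
    define a where "a k = (if k < m then 1 else 0 :: real)" for k :: nat
    have supp: "{k. a k \<noteq> 0} = {..<m}" by (auto simp: a_def)
    have lc: "lin_comb a (z \<circ> q) = (\<lambda>f. \<Sum>k\<in>q ` {..<m}. z k f)" if q: "strict_mono q"
      for z :: "nat \<Rightarrow> (real \<Rightarrow> real) \<Rightarrow> real" and q :: "nat \<Rightarrow> nat"
    proof
      fix f
      have "inj_on q {..<m}" by (rule strict_mono_imp_inj_on[OF q])
      then have "(\<Sum>k\<in>q ` {..<m}. z k f) = (\<Sum>k<m. z (q k) f)" by (simp add: sum.reindex)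
      then show "lin_comb a (z \<circ> q) f = (\<Sum>k\<in>q ` {..<m}. z k f)"
        unfolding lin_comb_def supp by (simp add: a_def)
    qed
    have card: "card (q ` {..<m}) = m" if q: "strict_mono q" for q :: "nat \<Rightarrow> nat"
      using card_image[OF strict_mono_imp_inj_on[OF q], of "{..<m}"] by simp
    have "real m * (1/2) ^ n / 40 \<le> nrm ?D (lin_comb a (y \<circ> s))"
      using column_sum_lower[OF p, of "s ` {..<m}" n] em unfolding lc[OF s] card[OF s] y_def by simp
    also have "\<dots> \<le> C * nrm ?D (lin_comb a (x \<circ> r))" by (rule C(2)) (simp add: supp)
    also have "\<dots> \<le> C * (20 * m powr (1 - 1 / p))"
      using coord_sum_upper[OF p, of "r ` {..<m}"] m C(1) unfolding lc[OF r] card[OF r] x_def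
      by (intro mult_left_mono) (auto simp: lessThan_empty_iff)
    finally have 1: "real m * (1/2) ^ n / 40 \<le> C * (20 * m powr (1 - 1 / p))" .
    have split: "real m = m powr (1 - 1 / p) * m powr (1 / p)" using m by (simp flip: powr_add)
    have "m powr (1 - 1 / p) * (m powr (1 / p) * (1/2) ^ n) \<le> m powr (1 - 1 / p) * (800 * C)"
    proof -
      have "m powr (1 - 1 / p) * (m powr (1 / p) * (1/2) ^ n) = real m * (1/2) ^ n"
        using split by (metis mult.assoc)
      also have "\<dots> \<le> 40 * (C * (20 * m powr (1 - 1 / p)))" using 1 by (simp only: pos_divide_le_eq mult.commute[of _ 40])
      also have "\<dots> = m powr (1 - 1 / p) * (800 * C)" by simp
      finally show ?thesis .
    qed
    then have 2: "m powr (1 / p) * (1/2) ^ n \<le> 800 * C"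
      using m by (subst (asm) mult_le_cancel_left_pos) auto
    have "4 ^ n \<le> m powr (1 / p)"
    proof -
      have "4 powr real (n^2) = (4::real) ^ (n^2)" by (rule powr_realpow) simp
      then have "real m = 4 powr real (n^2)" by (simp only: m_def of_nat_power of_nat_numeral)
      then have "m powr (1 / p) = 4 powr (real (n^2) * (1 / p))" by (simp only: powr_powr)
      moreover have "real n \<le> real (n^2) * (1 / p)"
        using n p mult_right_mono[OF n, of "real n"] by (simp add: pos_le_divide_eq power2_eq_square mult.commute)
      then have "(4::real) powr real n \<le> 4 powr (real (n^2) * (1 / p))" by (rule powr_mono) simp
      ultimately show ?thesis by (simp add: powr_realpow)
    qed
    then have "4 ^ n * (1/2) ^ n \<le> m powr (1 / p) * (1/2) ^ n" by (rule mult_right_mono) simp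
    moreover have "(4::real) ^ n * (1/2) ^ n = 2 ^ n" by (simp flip: power_mult_distrib)
    ultimately show ?thesis using 2 by linarith
  qed
  obtain n1 where n1: "p \<le> real n1" using real_arch_simple by blast
  obtain n2 where n2: "800 * C < 2 ^ n2" using real_arch_pow[of 2 "800 * C"] by auto
  have "(2::real) ^ n2 \<le> 2 ^ max n1 n2" by (rule power_increasing) auto
  also have "\<dots> \<le> 800 * C" using n1 by (intro bound) simp
  finally show False using n2 by simp
qed

theorem theorem2:
  fixes p :: real
  assumes "1 < p"
  shows "\<exists>X :: real blat. ri_space X \<and> reflexive_space X \<and>
    p_disjointly_homogeneous p X \<and> \<not> disjointly_homogeneous (banach_dual X)"
  using ri_space_mixed_space reflexive_mixed_space p_disjointly_homogeneous_mixed_space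
    not_disjointly_homogeneous_dual_mixed_space assms by blast

end
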